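(* Let $b,\sigma$ be uniformly Lipschitz continuous in $(t,x)\in[0,T]\times\mathbb R^d$; let $f$ satisfy $|f(t_2,x_2,y_2,z_2)-f(t_1,x_1,y_1,z_1)|\le C_f(|t_2-t_1|^{1/2}+|x_2-x_1|+|y_2-y_1|+|z_2-z_1|)$ for all arguments; and let $\Phi$ satisfy $|\Phi(\mathbf s^1)-\Phi(\mathbf s^2)|\le C_\Phi\sup_{t\in[0,T]}|s^1_t-s^2_t|$ for all continuous $\mathbf s^1,\mathbf s^2$. Fix an integer $I\ge1$. Let $(Y^N_{t_k},Z^N_{t_k})$ be the discrete-time backward scheme and $(Y^{N,I,I}_{t_k},Z^{N,I,I}_{t_k})$ its approximation by $\mathbf L_2$-projections on the function bases $p_{l,k}$ with $I$ Picard iterations (both defined in the context). Then there are constants $h_0>0$ and $C$, independent of $N$ (equivalently of $h=T/N$) and of the function bases, such that whenever $h\le h_0$, $$\max_{0\le k\le N}\mathbb E|Y^{N,I,I}_{t_k}-Y^N_{t_k}|^2+h\sum_{k=0}^{N-1}\mathbb E|Z^{N,I,I}_{t_k}-Z^N_{t_k}|^2\le C h^{2I-2}\big[1+|S_0|^2+\mathbb E|\Phi^N(P^N_{t_N})|^2\big]+C\sum_{k=0}^{N-1}\mathbb E|\mathcal R_{p_{0,k}}(Y^N_{t_k})|^2+Ch\sum_{k=0}^{N-1}\sum_{l=1}^q\mathbb E|\mathcal R_{p_{l,k}}(Z^N_{l,t_k})|^2 .$$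
   Context: Setting: $T>0$; $W$ is a $q$-dimensional Brownian motion with augmented natural filtration $(\mathcal F_t)_{0\le t\le T}$; $S_0\in\mathbb R^d$ deterministic; $b:[0,T]\times\mathbb R^d\to\mathbb R^d$, $\sigma:[0,T]\times\mathbb R^d\to\mathbb R^{d\times q}$, $f:[0,T]\times\mathbb R^d\times\mathbb R\times\mathbb R^q\to\mathbb R$ deterministic; $\Phi$ a real-valued functional on continuous paths. For $N\ge1$: $h=T/N$, $t_k=kh$, $\Delta W_k=W_{t_{k+1}}-W_{t_k}$ (components $\Delta W_{l,k}$), $\mathbb E_k=\mathbb E(\cdot\mid\mathcal F_{t_k})$. Euler scheme: $S^N_{t_0}=S_0$, $S^N_{t_{k+1}}=S^N_{t_k}+b(t_k,S^N_{t_k})h+\sigma(t_k,S^N_{t_k})\Delta W_k$. $(P^N_{t_k})_{0\le k\le N}$ is an $\mathbb R^{d'}$-valued Markov chain whose first $d$ components are $S^N_{t_k}$, with $P^N_{t_k}$ $\mathcal F_{t_k}$-measurable; $\Phi^N:\mathbb R^{d'}\to\mathbb R$ is deterministic with $\mathbb E[\Phi^N(P^N_{t_N})^2]<\infty$ ($\Phi^N(P^N_{t_N})$ is an approximation of $\Phi(\mathbf S)$, where $dS_t=b(t,S_t)dt+\sigma(t,S_t)dW_t$). Discrete backward scheme: $Y^N_{t_N}=\Phi^N(P^N_{t_N})$ and for $0\le k\le N-1$: $Z^N_{l,t_k}=\frac1h\mathbb E_k(Y^N_{t_{k+1}}\Delta W_{l,k})$ ($1\le l\le q$), $Y^N_{t_k}=\mathbb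 E_k(Y^N_{t_{k+1}})+hf(t_k,S^N_{t_k},Y^N_{t_k},Z^N_{t_k})$ (unique solution in $\mathbf L_2(\mathcal F_{t_k})$ for $h$ small). Function bases: for $0\le l\le q$, $0\le k\le N-1$, $p_{l,k}$ is a finite (column) vector of measurable real functions on $\mathbb R^{d'}$; $p_{l,k}$ also denotes the random vector $p_{l,k}(P^N_{t_k})$. It is assumed that $\mathbb E|p_{l,k}|^2<\infty$ and that $\mathbb E(p_{l,k}p_{l,k}^* )$ is invertible. $\mathcal P_{\phi}(U)$ is the $\mathbf L_2(\Omega,\mathbb P)$-orthogonal projection of $U$ on the linear span of the components of the random vector $\phi$, and $\mathcal R_\phi(U)=U-\mathcal P_\phi(U)$. Projected scheme: for coefficients $\alpha=(\alpha_0,\dots,\alpha_q)$ put $f_k(\alpha)=f(t_k,S^N_{t_k},\alpha_0\cdot p_{0,k},\dots,\alpha_q\cdot p_{q,k})$. Set $Y^{N,i,I}_{t_N}=\Phi^N(P^N_{t_N})$ for all $i$. Backward for $k=N-1,\dots,0$: $\alpha^{0,I}_{l,k}=0$ ($0\le l\le q$), and for $i\ge1$, $\alpha^{i,I}_k=(\alpha^{i,I}_{l,k})_{0\le l\le q}$ is the minimizer over $(\alpha_0,\dots,\alpha_q)$ of $$\mathbb E\Big(Y^{N,I,I}_{t_{k+1}}-\alpha_0\cdot p_{0,k}+hf_k(\alpha^{i-1,I}_k)-\sum_{l=1}^q\alpha_l\cdot p_{l,k}\,\Delta W_{l,k}\Big)^2;$$ then $Y^{N,i,I}_{t_k}=\alpha^{i,I}_{0,k}\cdot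 p_{0,k}$ and $Z^{N,i,I}_{l,t_k}=\alpha^{i,I}_{l,k}\cdot p_{l,k}$ ($1\le l\le q$). The value used at the next (earlier) date is the one with $i=I$. Constants $C,h_0$ may depend on $T,d,q,b,\sigma,f,\Phi$ and on the fixed integer $I$. *)

theory Defs
  imports "HOL-Probability.Probability" "Jordan_Normal_Form.Matrix"
begin

section \<open>Brownian motion and Markov chains\<close>

text \<open>The two clauses on increments say that the real random variables
  \<open>(W (\<tau> (Suc i)) - W (\<tau> i)) $ l\<close>, with \<open>i < n\<close> and \<open>l\<close> a coordinate, are jointly independent
  centred Gaussians: the increments over disjoint intervals are independent, and so are the
  \<open>q = CARD('q)\<close> coordinates.\<close>

definition brownian_motion ::
    "'a measure \<Rightarrow> real \<Rightarrow> (real \<Rightarrow> 'a \<Rightarrow> real ^ 'q) \<Rightarrow> bool" where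
  "brownian_motion M T W \<longleftrightarrow>
     prob_space M \<and>
     (\<forall>t\<in>{0..T}. W t \<in> borel_measurable M) \<and>
     (AE \<omega> in M. W 0 \<omega> = 0) \<and>
     (AE \<omega> in M. continuous_on {0..T} (\<lambda>t. W t \<omega>)) \<and>
     (\<forall>s t l. 0 \<le> s \<and> s < t \<and> t \<le> T \<longrightarrow>
        distributed M lborel (\<lambda>\<omega>. vec_nth (W t \<omega> - W s \<omega>) l) (normal_density 0 (sqrt (t - s)))) \<and>
     (\<forall>(n::nat) \<tau>. 0 \<le> \<tau> 0 \<and> strict_mono_on {..n} \<tau> \<and> \<tau> n \<le> T \<longrightarrow>
        prob_space.indep_vars M (\<lambda>_. borel)
          (\<lambda>(i, l) \<omega>. vec_nth (W (\<tau> (Suc i)) \<omega> - W (\<tau> i) \<omega>) l) ({..<n} \<times> UNIV))"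

definition augmented_filtration ::
    "'a measure \<Rightarrow> (real \<Rightarrow> 'a \<Rightarrow> real ^ 'q) \<Rightarrow> real \<Rightarrow> 'a measure" where
  "augmented_filtration M W t =
     sigma (space M)
       ({W s -` A \<inter> space M | s A. s \<in> {0..t} \<and> A \<in> sets borel} \<union> null_sets M)"

text \<open>The Markov property is taken with respect to the filtration generated by the chain itself.
  For a chain adapted to a larger filtration, it follows from the Markov property with respect to
  that filtration.\<close>

definition markov_chain :: "'a measure \<Rightarrow> 'b measure \<Rightarrow> nat \<Rightarrow> (nat \<Rightarrow> 'a \<Rightarrow> 'b) \<Rightarrow> bool" where
  "markov_chain M E N X \<longleftrightarrow>
     (\<forall>k\<le>N. X k \<in> M \<rightarrow>\<^sub>M E) \<and>
     (\<forall>k<N. \<forall>A\<in>sets E. AE \<omega> in M.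
        real_cond_exp M (sigma (space M) {X j -` B \<inter> space M | j B. j \<le> k \<and> B \<in> sets E})
          (\<lambda>\<omega>. indicator A (X (Suc k) \<omega>)) \<omega> =
        real_cond_exp M (vimage_algebra (space M) (X k) E)
          (\<lambda>\<omega>. indicator A (X (Suc k) \<omega>)) \<omega>)"


section \<open>Projections on finitely many random variables\<close>

definition lin_comb :: "real list \<Rightarrow> ('a \<Rightarrow> real) list \<Rightarrow> 'a \<Rightarrow> real" where
  "lin_comb c \<phi> \<omega> = (\<Sum>j<length \<phi>. c ! j * (\<phi> ! j) \<omega>)"

definition gram_matrix :: "'a measure \<Rightarrow> ('a \<Rightarrow> real) list \<Rightarrow> real mat" where
  "gram_matrix M \<phi> =
     Matrix.mat (length \<phi>) (length \<phi>) (\<lambda>(i, j). \<integral>\<omega>. (\<phi> ! i) \<omega> * (\<phi> ! j) \<omega> \<partial>M)"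

definition L2_proj :: "'a measure \<Rightarrow> ('a \<Rightarrow> real) list \<Rightarrow> ('a \<Rightarrow> real) \<Rightarrow> 'a \<Rightarrow> real" where
  "L2_proj M \<phi> U =
     lin_comb (SOME c. length c = length \<phi> \<and>
       (\<forall>j<length \<phi>. (\<integral>\<omega>. (U \<omega> - lin_comb c \<phi> \<omega>) * (\<phi> ! j) \<omega> \<partial>M) = 0)) \<phi>"

definition L2_resid :: "'a measure \<Rightarrow> ('a \<Rightarrow> real) list \<Rightarrow> ('a \<Rightarrow> real) \<Rightarrow> 'a \<Rightarrow> real" where
  "L2_resid M \<phi> U \<omega> = U \<omega> - L2_proj M \<phi> U \<omega>"


section \<open>Time grid and Euler scheme\<close>

definition grid :: "real \<Rightarrow> nat \<Rightarrow> nat \<Rightarrow> real" where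
  "grid T N k = real k * (T / real N)"

definition bm_incr ::
    "real \<Rightarrow> nat \<Rightarrow> (real \<Rightarrow> 'a \<Rightarrow> real ^ 'q) \<Rightarrow> nat \<Rightarrow> 'a \<Rightarrow> real ^ 'q" where
  "bm_incr T N W k \<omega> = W (grid T N (Suc k)) \<omega> - W (grid T N k) \<omega>"

primrec euler ::
    "real \<Rightarrow> (real \<Rightarrow> real ^ 'd \<Rightarrow> real ^ 'd) \<Rightarrow> (real \<Rightarrow> real ^ 'd \<Rightarrow> real ^ 'q ^ 'd) \<Rightarrow>
     (real \<Rightarrow> 'a \<Rightarrow> real ^ 'q) \<Rightarrow> real ^ 'd \<Rightarrow> nat \<Rightarrow> nat \<Rightarrow> 'a \<Rightarrow> real ^ 'd" where
  "euler T b \<sigma> W S0 N 0 = (\<lambda>\<omega>. S0)"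
| "euler T b \<sigma> W S0 N (Suc k) = (\<lambda>\<omega>.
     let x = euler T b \<sigma> W S0 N k \<omega>; t = grid T N k
     in x + (T / real N) *\<^sub>R b t x + \<sigma> t x *v bm_incr T N W k \<omega>)"

text \<open>The state space \<open>\<real>\<^bsup>d'\<^esup>\<close> with \<open>d' = d + m\<close>, split as \<open>\<real>\<^bsup>d\<^esup> \<times> \<real>\<^bsup>m\<^esup>\<close>. The \<open>m\<close> additional
  coordinates are indexed by natural numbers so that \<open>m\<close> can be quantified.\<close>

definition state_space :: "nat \<Rightarrow> ((real ^ 'd) \<times> (nat \<Rightarrow> real)) measure" where
  "state_space m = borel \<Otimes>\<^sub>M PiM {..<m} (\<lambda>_. borel)"


section \<open>Discrete backward scheme\<close>

definition backward_Z ::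
    "'a measure \<Rightarrow> real \<Rightarrow> (real \<Rightarrow> 'a \<Rightarrow> real ^ 'q) \<Rightarrow> nat \<Rightarrow> (nat \<Rightarrow> 'a \<Rightarrow> real) \<Rightarrow>
     nat \<Rightarrow> 'a \<Rightarrow> real ^ 'q" where
  "backward_Z M T W N Y k \<omega> =
     (\<chi> l. 1 / (T / real N) *
        real_cond_exp M (augmented_filtration M W (grid T N k))
          (\<lambda>\<omega>. Y (Suc k) \<omega> * vec_nth (bm_incr T N W k \<omega>) l) \<omega>)"

text \<open>\<open>S\<close> is the forward scheme and \<open>\<xi>\<close> the terminal value.\<close>

definition backward_scheme ::
    "'a measure \<Rightarrow> real \<Rightarrow> (real \<Rightarrow> real ^ 'd \<Rightarrow> real \<Rightarrow> real ^ 'q \<Rightarrow> real) \<Rightarrow>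
     (real \<Rightarrow> 'a \<Rightarrow> real ^ 'q) \<Rightarrow> nat \<Rightarrow> (nat \<Rightarrow> 'a \<Rightarrow> real ^ 'd) \<Rightarrow> ('a \<Rightarrow> real) \<Rightarrow>
     (nat \<Rightarrow> 'a \<Rightarrow> real) \<Rightarrow> bool" where
  "backward_scheme M T f W N S \<xi> Y \<longleftrightarrow>
     (\<forall>k\<le>N. Y k \<in> borel_measurable (augmented_filtration M W (grid T N k)) \<and>
        integrable M (\<lambda>\<omega>. (Y k \<omega>)\<^sup>2)) \<and>
     (AE \<omega> in M. Y N \<omega> = \<xi> \<omega>) \<and>
     (\<forall>k<N. AE \<omega> in M. Y k \<omega> =
        real_cond_exp M (augmented_filtration M W (grid T N k)) (Y (Suc k)) \<omega> +
        T / real N * f (grid T N k) (S k \<omega>) (Y k \<omega>) (backward_Z M T W N Y k \<omega>))"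


section \<open>Projected scheme with Picard iterations\<close>

text \<open>The index \<open>l \<in> {0, \<dots>, q}\<close> is represented by \<^typ>\<open>'q option\<close>, with \<^term>\<open>None\<close> for \<open>l = 0\<close>.
  A family of function bases is \<open>p :: nat \<Rightarrow> 'q option \<Rightarrow> ('s \<Rightarrow> real) list\<close>, with \<open>p k l\<close> standing
  for the vector \<open>p\<^sub>l\<^sub>,\<^sub>k\<close>, so that the dimensions of these vectors are arbitrary; a
  coefficient family at one date is \<open>a :: 'q option \<Rightarrow> real list\<close>.\<close>

definition basis_rv ::
    "(nat \<Rightarrow> 'q option \<Rightarrow> ('s \<Rightarrow> real) list) \<Rightarrow> (nat \<Rightarrow> 'a \<Rightarrow> 's) \<Rightarrow> nat \<Rightarrow> 'q option \<Rightarrow>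
     ('a \<Rightarrow> real) list" where
  "basis_rv p P k l = map (\<lambda>g \<omega>. g (P k \<omega>)) (p k l)"

definition admissible_bases ::
    "'a measure \<Rightarrow> 's measure \<Rightarrow> nat \<Rightarrow> (nat \<Rightarrow> 'a \<Rightarrow> 's) \<Rightarrow>
     (nat \<Rightarrow> 'q option \<Rightarrow> ('s \<Rightarrow> real) list) \<Rightarrow> bool" where
  "admissible_bases M E N P p \<longleftrightarrow>
     (\<forall>k<N. \<forall>l.
        (\<forall>g\<in>set (p k l). g \<in> borel_measurable E) \<and>
        (\<forall>g\<in>set (p k l). integrable M (\<lambda>\<omega>. (g (P k \<omega>))\<^sup>2)) \<and>
        invertible_mat (gram_matrix M (basis_rv p P k l)))"

definition proj_Z ::
    "(nat \<Rightarrow> 'q option \<Rightarrow> ('s \<Rightarrow> real) list) \<Rightarrow> (nat \<Rightarrow> 'a \<Rightarrow> 's) \<Rightarrow> nat \<Rightarrow>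
     ('q option \<Rightarrow> real list) \<Rightarrow> 'a \<Rightarrow> real ^ 'q" where
  "proj_Z p P k a \<omega> = (\<chi> l. lin_comb (a (Some l)) (basis_rv p P k (Some l)) \<omega>)"

text \<open>\<open>c\<close> is the coefficient family \<open>\<alpha>\<^sup>i\<^sup>,\<^sup>I\<close> at date \<open>k\<close>; it is not used at the terminal date.\<close>

definition proj_Y ::
    "(nat \<Rightarrow> 'q option \<Rightarrow> ('s \<Rightarrow> real) list) \<Rightarrow> (nat \<Rightarrow> 'a \<Rightarrow> 's) \<Rightarrow> nat \<Rightarrow> ('a \<Rightarrow> real) \<Rightarrow> nat \<Rightarrow>
     ('q option \<Rightarrow> real list) \<Rightarrow> 'a \<Rightarrow> real" where
  "proj_Y p P N \<xi> k c \<omega> =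
     (if k = N then \<xi> \<omega> else lin_comb (c None) (basis_rv p P k None) \<omega>)"

text \<open>The least-squares criterion at date \<open>k\<close>: \<open>U\<close> is the value carried over from date \<open>k + 1\<close>,
  \<open>a'\<close> the coefficients of the previous Picard iteration.\<close>

definition picard_loss ::
    "'a measure \<Rightarrow> real \<Rightarrow> (real \<Rightarrow> real ^ 'd \<Rightarrow> real \<Rightarrow> real ^ 'q \<Rightarrow> real) \<Rightarrow>
     (real \<Rightarrow> 'a \<Rightarrow> real ^ 'q) \<Rightarrow> nat \<Rightarrow> (nat \<Rightarrow> 'a \<Rightarrow> real ^ 'd) \<Rightarrow>
     (nat \<Rightarrow> 'q option \<Rightarrow> ('s \<Rightarrow> real) list) \<Rightarrow> (nat \<Rightarrow> 'a \<Rightarrow> 's) \<Rightarrow> nat \<Rightarrow> ('a \<Rightarrow> real) \<Rightarrow>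
     ('q option \<Rightarrow> real list) \<Rightarrow> ('q option \<Rightarrow> real list) \<Rightarrow> real" where
  "picard_loss M T f W N S p P k U a' a =
     (\<integral>\<omega>. (U \<omega>
        - lin_comb (a None) (basis_rv p P k None) \<omega>
        + T / real N * f (grid T N k) (S k \<omega>)
            (lin_comb (a' None) (basis_rv p P k None) \<omega>) (proj_Z p P k a' \<omega>)
        - (\<Sum>l\<in>UNIV. lin_comb (a (Some l)) (basis_rv p P k (Some l)) \<omega>
                        * vec_nth (bm_incr T N W k \<omega>) l))\<^sup>2 \<partial>M)"

text \<open>\<open>\<alpha> i k l\<close> stands for \<open>\<alpha>\<^sup>i\<^sup>,\<^sup>I\<^sub>l\<^sub>,\<^sub>k\<close>. The length constraint makes it a vector of the
  dimension of \<open>p\<^sub>l\<^sub>,\<^sub>k\<close>.\<close>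

definition projected_scheme ::
    "'a measure \<Rightarrow> real \<Rightarrow> (real \<Rightarrow> real ^ 'd \<Rightarrow> real \<Rightarrow> real ^ 'q \<Rightarrow> real) \<Rightarrow>
     (real \<Rightarrow> 'a \<Rightarrow> real ^ 'q) \<Rightarrow> nat \<Rightarrow> (nat \<Rightarrow> 'a \<Rightarrow> real ^ 'd) \<Rightarrow> ('a \<Rightarrow> real) \<Rightarrow>
     (nat \<Rightarrow> 'q option \<Rightarrow> ('s \<Rightarrow> real) list) \<Rightarrow> (nat \<Rightarrow> 'a \<Rightarrow> 's) \<Rightarrow> nat \<Rightarrow>
     (nat \<Rightarrow> nat \<Rightarrow> 'q option \<Rightarrow> real list) \<Rightarrow> bool" where
  "projected_scheme M T f W N S \<xi> p P I \<alpha> \<longleftrightarrow>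
     (\<forall>k<N.
        (\<forall>l. \<alpha> 0 k l = replicate (length (p k l)) 0) \<and>
        (\<forall>i. is_arg_min
           (picard_loss M T f W N S p P k (proj_Y p P N \<xi> (Suc k) (\<alpha> I (Suc k))) (\<alpha> i k))
           (\<lambda>a. \<forall>l. length (a l) = length (p k l))
           (\<alpha> (Suc i) k)))"

end

theory Submission
  imports Defs
begin

text \<open>
  At each date the least-squares problem decouples, because \<open>p\<^sub>0\<close> and the products
  \<open>p\<^sub>l \<Delta>W\<^sub>l\<close> are orthogonal: the minimizer gives
  \<open>Z'\<^sub>l = \<P>\<^sub>l (E\<^sub>k (Y' \<Delta>W\<^sub>l) / h)\<close>, the same for every \<open>i \<ge> 1\<close>, and
  \<open>y\<^sub>i = \<P>\<^sub>0 (E\<^sub>k Y' + h f (y\<^sub>i\<^sub>-\<^sub>1, z\<^sub>i\<^sub>-\<^sub>1))\<close>. Projections are contractions, and the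
  Bessel inequality \<open>h \<parallel>E\<^sub>k (X \<Delta>W) / h\<parallel>\<^sup>2 \<le> \<parallel>X\<parallel>\<^sup>2 - \<parallel>E\<^sub>k X\<parallel>\<^sup>2\<close> lets the drop of the
  conditional variance absorb the \<open>Z\<close>-terms of the driver. Comparing \<open>y\<^sub>I\<close> with \<open>Y\<close> directly,
  without passing to the fixed point of the Picard iteration, leaves the defect
  \<open>f (y\<^sub>I\<^sub>-\<^sub>1, z\<^sub>I\<^sub>-\<^sub>1) - f (y\<^sub>I, z\<^sub>I)\<close>, whose square is of order \<open>h\<^bsup>2 (I - 1)\<^esup>\<close> by
  contraction and the a priori bound on the projected scheme. A backward Gronwall argument
  concludes.
\<close>

section \<open>Elementary inequalities\<close>

text \<open>The delicate point is the power of h in the Picard error. At a single date the Bessel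
  inequality bounds only \<open>h * E|z_1|^2\<close>, so a date taken by itself would lose a factor
  \<open>1 / h\<close>. Summed over all dates, however, the quantities \<open>h * E|z_1|^2\<close>
  remain bounded: each is paid by the drop of conditional variance at its own date, and these drops
  telescope up to a Gronwall factor. The defect of a date enters the error recursion with weight h,
  so exactly this sum occurs, and the I - 1 contractions, each of order \<open>h^2\<close> in the
  squared norm, survive in full. The drop of variance has to pay twice: one half covers the z-terms
  of the driver, the other half the z-term kept on the left of the recursion. This fixes the weight
  \<gamma> in Young's inequality, and with it the step bound
  \<open>(16 * K^2 + 1) * h \<le> 1\<close>.\<close>

lemma backward_gronwall:
  fixes a b g :: "nat \<Rightarrow> real"
  assumes "c \<ge> 0" and "\<And>k. k < N \<Longrightarrow> b k \<ge> 0" and "\<And>k. k < N \<Longrightarrow> g k \<ge> 0" and "a N \<ge> 0"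
    and step: "\<And>k. k < N \<Longrightarrow> a k + b k \<le> (1 + c) * a (Suc k) + g k"
    and "k \<le> N"
  shows "a k + (\<Sum>j\<in>{k..<N}. b j) \<le> exp (c * real N) * (a N + (\<Sum>j<N. g j))"
proof -
  \<comment> \<open>The terms \<open>b\<close> stay on the left: read at each k this bounds
    \<open>a k\<close>, read at k = 0 it bounds the whole sum of the \<open>b j\<close>. The
    induction runs backward from N with the exact factor \<open>(1 + c) ^ (N - k)\<close>; the
    exponential replaces it only afterwards.\<close>
  have main: "a k + (\<Sum>j\<in>{k..<N}. b j) \<le> (1 + c) ^ (N - k) * (a N + (\<Sum>j\<in>{k..<N}. g j))"
    using \<open>k \<le> N\<close>
  proof (induction rule: inc_induct)
    case base
    then show ?case by simp
  next
    case (step n)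
    define A where "A = (1 + c) ^ (N - Suc n)"
    have A: "A \<ge> 1" "A \<ge> 0"
      using \<open>c \<ge> 0\<close> one_le_power[of "1 + c"] by (auto simp: A_def)
    have split: "(\<Sum>j\<in>{n..<N}. v j) = v n + (\<Sum>j\<in>{Suc n..<N}. v j)" for v :: "nat \<Rightarrow> real"
      using step.hyps by (simp add: sum.atLeast_Suc_lessThan)
    have nonneg: "0 \<le> (\<Sum>j\<in>{Suc n..<N}. b j)"
      using assms(2) by (intro sum_nonneg) auto
    have pow: "(1 + c) ^ (N - n) = (1 + c) * A"
      using step.hyps by (simp add: A_def Suc_diff_Suc flip: power_Suc)
    have "a n + (\<Sum>j\<in>{n..<N}. b j) \<le> (1 + c) * a (Suc n) + g n + (\<Sum>j\<in>{Suc n..<N}. b j)"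
      using assms(5)[OF step.hyps(2)] by (simp add: split)
    also have "\<dots> \<le> (1 + c) * (a (Suc n) + (\<Sum>j\<in>{Suc n..<N}. b j)) + g n"
      using nonneg \<open>c \<ge> 0\<close> by (simp add: algebra_simps)
    also have "\<dots> \<le> (1 + c) * (A * (a N + (\<Sum>j\<in>{Suc n..<N}. g j))) + (1 + c) * A * g n"
    proof (rule add_mono)
      have "1 * 1 \<le> (1 + c) * A"
        using \<open>c \<ge> 0\<close> A by (intro mult_mono) auto
      then show "g n \<le> (1 + c) * A * g n"
        using assms(3)[OF step.hyps(2)] mult_right_mono[of 1 "(1 + c) * A" "g n"] by simp
    qed (use step.IH \<open>c \<ge> 0\<close> in \<open>auto simp: A_def intro!: mult_left_mono\<close>)
    also have "\<dots> = (1 + c) ^ (N - n) * (a N + (\<Sum>j\<in>{n..<N}. g j))"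
      by (simp add: pow split algebra_simps)
    finally show ?case .
  qed
  have "(1 + c) ^ (N - k) \<le> (1 + c) ^ N"
    using \<open>c \<ge> 0\<close> by (intro power_increasing) auto
  also have "\<dots> \<le> exp c ^ N"
    using \<open>c \<ge> 0\<close> by (intro power_mono exp_ge_add_one_self) auto
  also have "\<dots> = exp (c * real N)"
    by (metis exp_of_nat_mult mult.commute)
  finally have pow: "(1 + c) ^ (N - k) \<le> exp (c * real N)" .
  have "(\<Sum>j\<in>{k..<N}. g j) \<le> (\<Sum>j<N. g j)"
    using assms(3) by (intro sum_mono2) auto
  moreover have "0 \<le> (\<Sum>j\<in>{k..<N}. g j)"
    using assms(3) by (intro sum_nonneg) auto
  ultimately have "(1 + c) ^ (N - k) * (a N + (\<Sum>j\<in>{k..<N}. g j))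
      \<le> exp (c * real N) * (a N + (\<Sum>j<N. g j))"
    using pow \<open>a N \<ge> 0\<close> by (intro mult_mono) auto
  with main show ?thesis by linarith
qed

lemma power2_sum3_le: "(x + y + z)\<^sup>2 \<le> 3 * (x\<^sup>2 + y\<^sup>2 + z\<^sup>2)" for x y z :: real
proof -
  have "0 \<le> (x - y)\<^sup>2 + (x - z)\<^sup>2 + (y - z)\<^sup>2"
    by simp
  then show ?thesis
    by (simp add: power2_eq_square algebra_simps)
qed

lemma power2_sum4_le: "(w + x + y + z)\<^sup>2 \<le> 4 * (w\<^sup>2 + x\<^sup>2 + y\<^sup>2 + z\<^sup>2)" for w x y z :: real
proof -
  have "0 \<le> (w - x)\<^sup>2 + (w - y)\<^sup>2 + (w - z)\<^sup>2 + (x - y)\<^sup>2 + (x - z)\<^sup>2 + (y - z)\<^sup>2"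
    by simp
  then show ?thesis
    by (simp add: power2_eq_square algebra_simps)
qed

text \<open>Young's inequality \<open>2 * h * x * y \<le> c * h * x^2 + (h / c) * y^2\<close>. The
  parameter trades a larger growth rate, which Gronwall tolerates, for a smaller weight on
  \<open>y^2\<close>, which has to be absorbed.\<close>

lemma power2_add_mult_le:
  fixes x y h c :: real
  assumes "c > 0" "h \<ge> 0"
  shows "(x + h * y)\<^sup>2 \<le> (1 + c * h) * x\<^sup>2 + (h\<^sup>2 + h / c) * y\<^sup>2"
proof -
  have "0 \<le> h * (sqrt c * x - y / sqrt c)\<^sup>2"
    using assms by simp
  also have "(sqrt c * x - y / sqrt c)\<^sup>2 = c * x\<^sup>2 - 2 * (x * y) + y\<^sup>2 / c"
    using assms by (simp add: power2_diff power_mult_distrib power_divide)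
  finally show ?thesis
    by (simp add: power2_eq_square algebra_simps)
qed

lemma norm_power2_vec: "(norm z)\<^sup>2 = (\<Sum>l\<in>UNIV. (vec_nth z l)\<^sup>2)" for z :: "real ^ 'n"
  by (simp add: norm_vec_def L2_set_def sum_nonneg)

section \<open>Square-integrable functions and projections\<close>

lemma measurable_vec_nth [measurable (raw)]:
  fixes X :: "'a \<Rightarrow> 'b::topological_space ^ 'n"
  assumes "X \<in> borel_measurable N"
  shows "(\<lambda>\<omega>. vec_nth (X \<omega>) l) \<in> borel_measurable N"
  by (rule measurable_compose[OF assms borel_measurable_continuous_onI]) (intro continuous_intros)

lemma measurable_vec_lambda [measurable (raw)]:
  fixes g :: "'a \<Rightarrow> 'n::finite \<Rightarrow> real"
  assumes "\<And>l. (\<lambda>\<omega>. g \<omega> l) \<in> borel_measurable N"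
  shows "(\<lambda>\<omega>. \<chi> l. g \<omega> l) \<in> borel_measurable N"
proof (rule borel_measurable_euclidean_space[THEN iffD2], rule ballI)
  fix i :: "real ^ 'n" assume "i \<in> Basis"
  then obtain l where "i = axis l 1"
    by (auto simp: Basis_vec_def)
  then show "(\<lambda>\<omega>. (\<chi> l. g \<omega> l) \<bullet> i) \<in> borel_measurable N"
    using assms by (simp add: inner_axis)
qed

lemma measurable_vecI:
  fixes X :: "'a \<Rightarrow> real ^ 'n"
  assumes "\<And>i. (\<lambda>\<omega>. vec_nth (X \<omega>) i) \<in> borel_measurable N"
  shows "X \<in> borel_measurable N"
  using measurable_vec_lambda[of "\<lambda>\<omega> i. vec_nth (X \<omega>) i" N] assms by simp

definition square_integrable :: "'a measure \<Rightarrow> ('a \<Rightarrow> real) \<Rightarrow> bool" where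
  "square_integrable M X \<longleftrightarrow> X \<in> borel_measurable M \<and> integrable M (\<lambda>\<omega>. (X \<omega>)\<^sup>2)"

lemma square_integrable_measurable [measurable_dest]:
  "square_integrable M X \<Longrightarrow> X \<in> borel_measurable M"
  by (simp add: square_integrable_def)

lemma square_integrable_power2:
  "square_integrable M X \<Longrightarrow> integrable M (\<lambda>\<omega>. (X \<omega>)\<^sup>2)"
  by (simp add: square_integrable_def)

lemma square_integrable_mult:
  assumes "square_integrable M X" "square_integrable M Y"
  shows "integrable M (\<lambda>\<omega>. X \<omega> * Y \<omega>)"
proof (rule Bochner_Integration.integrable_bound)
  show "integrable M (\<lambda>\<omega>. (X \<omega>)\<^sup>2 + (Y \<omega>)\<^sup>2)"
    using assms by (simp add: square_integrable_def)
  have "\<bar>x * y\<bar> \<le> x\<^sup>2 + y\<^sup>2" for x y :: real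
    using sum_squares_bound[of "\<bar>x\<bar>" "\<bar>y\<bar>"] mult_nonneg_nonneg[of "\<bar>x\<bar>" "\<bar>y\<bar>"]
    by (simp add: abs_mult del: mult_nonneg_nonneg)
  then show "AE \<omega> in M. norm (X \<omega> * Y \<omega>) \<le> norm ((X \<omega>)\<^sup>2 + (Y \<omega>)\<^sup>2)"
    by simp
qed (use assms in measurable)

lemma square_integrable_bound:
  assumes "square_integrable M Y" "X \<in> borel_measurable M" "AE \<omega> in M. \<bar>X \<omega>\<bar> \<le> \<bar>Y \<omega>\<bar>"
  shows "square_integrable M X"
  unfolding square_integrable_def
proof
  show "integrable M (\<lambda>\<omega>. (X \<omega>)\<^sup>2)"
    by (rule Bochner_Integration.integrable_bound[OF square_integrable_power2[OF assms(1)]])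
       (use assms(2,3) in \<open>auto simp: abs_le_square_iff\<close>)
qed fact

lemma square_integrable_cmult [intro]:
  "square_integrable M X \<Longrightarrow> square_integrable M (\<lambda>\<omega>. c * X \<omega>)"
  by (auto simp: square_integrable_def power_mult_distrib)

lemma square_integrable_add [intro]:
  assumes "square_integrable M X" "square_integrable M Y"
  shows "square_integrable M (\<lambda>\<omega>. X \<omega> + Y \<omega>)"
  using assms square_integrable_mult[OF assms]
  by (auto simp: square_integrable_def power2_sum mult.assoc)

lemma square_integrable_diff [intro]:
  assumes "square_integrable M X" "square_integrable M Y"
  shows "square_integrable M (\<lambda>\<omega>. X \<omega> - Y \<omega>)"
  using assms square_integrable_mult[OF assms]
  by (auto simp: square_integrable_def power2_diff mult.assoc)

lemma square_integrable_zero [intro, simp]: "square_integrable M (\<lambda>\<omega>. 0)"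
  by (simp add: square_integrable_def)

lemma square_integrable_sum [intro]:
  "(\<And>i. i \<in> A \<Longrightarrow> square_integrable M (X i)) \<Longrightarrow> square_integrable M (\<lambda>\<omega>. \<Sum>i\<in>A. X i \<omega>)"
  by (induction A rule: infinite_finite_induct) auto

lemma square_integrable_abs [intro]:
  "square_integrable M X \<Longrightarrow> square_integrable M (\<lambda>\<omega>. \<bar>X \<omega>\<bar>)"
  by (auto simp: square_integrable_def)

lemma square_integrable_norm:
  fixes X :: "'a \<Rightarrow> real ^ 'n"
  assumes "\<And>l. square_integrable M (\<lambda>\<omega>. vec_nth (X \<omega>) l)"
  shows "square_integrable M (\<lambda>\<omega>. norm (X \<omega>))"
proof -
  have "(\<lambda>\<omega>. norm (X \<omega>)) = (\<lambda>\<omega>. sqrt (\<Sum>l\<in>UNIV. (vec_nth (X \<omega>) l)\<^sup>2))"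
    by (simp add: fun_eq_iff flip: norm_power2_vec)
  moreover have [measurable]: "(\<lambda>\<omega>. vec_nth (X \<omega>) l) \<in> borel_measurable M" for l
    using assms by (simp add: square_integrable_def)
  ultimately have "(\<lambda>\<omega>. norm (X \<omega>)) \<in> borel_measurable M"
    by simp
  then show ?thesis
    using assms by (simp add: square_integrable_def norm_power2_vec)
qed

lemma (in finite_measure) square_integrable_const [intro, simp]: "square_integrable M (\<lambda>\<omega>. c)"
  by (simp add: square_integrable_def)

lemma (in finite_measure) square_integrable_integrable:
  "square_integrable M X \<Longrightarrow> integrable M X"
  using square_integrable_mult[of M X "\<lambda>_. 1"] by simp

text \<open>A relation rather than a function: the minimizers of the scheme and
  \<open>L2_proj\<close>, which rests on a choice, are both handled through the normal equations.
  The length of \<open>c\<close> is left free, as \<open>lin_comb\<close> reads only the entries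
  below \<open>length \<phi>\<close>.\<close>

definition is_proj ::
    "'a measure \<Rightarrow> ('a \<Rightarrow> real) list \<Rightarrow> ('a \<Rightarrow> real) \<Rightarrow> ('a \<Rightarrow> real) \<Rightarrow> bool" where
  "is_proj M \<phi> U y \<longleftrightarrow> (\<exists>c. y = lin_comb c \<phi>) \<and>
     (\<forall>j<length \<phi>. (\<integral>\<omega>. (U \<omega> - y \<omega>) * (\<phi> ! j) \<omega> \<partial>M) = 0)"

lemma square_integrable_lin_comb:
  assumes "\<And>g. g \<in> set \<phi> \<Longrightarrow> square_integrable M g"
  shows "square_integrable M (lin_comb c \<phi>)"
  unfolding lin_comb_def using assms by (intro square_integrable_sum square_integrable_cmult) auto

lemma is_proj_square_integrable:
  assumes "\<And>g. g \<in> set \<phi> \<Longrightarrow> square_integrable M g" "is_proj M \<phi> U y"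
  shows "square_integrable M y"
  using assms square_integrable_lin_comb by (auto simp: is_proj_def)

lemma is_proj_orthogonal:
  assumes \<phi>: "\<And>g. g \<in> set \<phi> \<Longrightarrow> square_integrable M g" and U: "square_integrable M U"
    and proj: "is_proj M \<phi> U y"
  shows "(\<integral>\<omega>. (U \<omega> - y \<omega>) * lin_comb d \<phi> \<omega> \<partial>M) = 0"
proof -
  have y: "square_integrable M y"
    using \<phi> proj by (rule is_proj_square_integrable)
  have "(\<integral>\<omega>. (U \<omega> - y \<omega>) * lin_comb d \<phi> \<omega> \<partial>M)
      = (\<integral>\<omega>. (\<Sum>j<length \<phi>. d ! j * ((U \<omega> - y \<omega>) * (\<phi> ! j) \<omega>)) \<partial>M)"
    by (simp add: lin_comb_def sum_distrib_left mult.left_commute)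
  also have "\<dots> = (\<Sum>j<length \<phi>. d ! j * (\<integral>\<omega>. (U \<omega> - y \<omega>) * (\<phi> ! j) \<omega> \<partial>M))"
    using \<phi> U y by (subst Bochner_Integration.integral_sum)
      (auto intro!: integrable_mult_right square_integrable_mult)
  also have "\<dots> = 0"
    using proj by (simp add: is_proj_def)
  finally show ?thesis .
qed

lemma is_proj_diff:
  assumes \<phi>: "\<And>g. g \<in> set \<phi> \<Longrightarrow> square_integrable M g"
    and U: "square_integrable M U" "square_integrable M U'"
    and proj: "is_proj M \<phi> U y" "is_proj M \<phi> U' y'"
  shows "is_proj M \<phi> (\<lambda>\<omega>. U \<omega> - U' \<omega>) (\<lambda>\<omega>. y \<omega> - y' \<omega>)"
  unfolding is_proj_def
proof (intro conjI allI impI)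
  obtain c c' where "y = lin_comb c \<phi>" "y' = lin_comb c' \<phi>"
    using proj by (auto simp: is_proj_def)
  then have "(\<lambda>\<omega>. y \<omega> - y' \<omega>) = lin_comb (map (\<lambda>j. c ! j - c' ! j) [0..<length \<phi>]) \<phi>"
    by (simp add: lin_comb_def fun_eq_iff algebra_simps flip: sum_subtractf)
  then show "\<exists>c. (\<lambda>\<omega>. y \<omega> - y' \<omega>) = lin_comb c \<phi>"
    by blast
next
  fix j assume j: "j < length \<phi>"
  have y: "square_integrable M y" "square_integrable M y'"
    using \<phi> proj is_proj_square_integrable by blast+
  have "integrable M (\<lambda>\<omega>. (U \<omega> - y \<omega>) * (\<phi> ! j) \<omega>)"
    "integrable M (\<lambda>\<omega>. (U' \<omega> - y' \<omega>) * (\<phi> ! j) \<omega>)"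
    using \<phi> U y j by (auto intro!: square_integrable_mult)
  then have "(\<integral>\<omega>. (U \<omega> - y \<omega>) * (\<phi> ! j) \<omega> - (U' \<omega> - y' \<omega>) * (\<phi> ! j) \<omega> \<partial>M) = 0"
    using proj j by (simp add: is_proj_def)
  then show "(\<integral>\<omega>. (U \<omega> - U' \<omega> - (y \<omega> - y' \<omega>)) * (\<phi> ! j) \<omega> \<partial>M) = 0"
    by (simp add: algebra_simps)
qed

lemma is_proj_pythagoras:
  assumes \<phi>: "\<And>g. g \<in> set \<phi> \<Longrightarrow> square_integrable M g" and U: "square_integrable M U"
    and proj: "is_proj M \<phi> U y"
  shows "(\<integral>\<omega>. (U \<omega> - lin_comb d \<phi> \<omega>)\<^sup>2 \<partial>M)
    = (\<integral>\<omega>. (U \<omega> - y \<omega>)\<^sup>2 \<partial>M) + (\<integral>\<omega>. (y \<omega> - lin_comb d \<phi> \<omega>)\<^sup>2 \<partial>M)"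
proof -
  obtain c where y: "y = lin_comb c \<phi>"
    using proj by (auto simp: is_proj_def)
  have sq: "square_integrable M (lin_comb c \<phi>)" for c
    using \<phi> by (rule square_integrable_lin_comb)
  have cross: "(\<integral>\<omega>. (U \<omega> - y \<omega>) * (y \<omega> - lin_comb d \<phi> \<omega>) \<partial>M) = 0"
    using is_proj_orthogonal[OF \<phi> U proj, of c] is_proj_orthogonal[OF \<phi> U proj, of d] sq U
    unfolding y right_diff_distrib
    by (subst Bochner_Integration.integral_diff) (auto intro!: square_integrable_mult)
  have "(\<integral>\<omega>. (U \<omega> - lin_comb d \<phi> \<omega>)\<^sup>2 \<partial>M)
    = (\<integral>\<omega>. (U \<omega> - y \<omega>)\<^sup>2 + 2 * ((U \<omega> - y \<omega>) * (y \<omega> - lin_comb d \<phi> \<omega>))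
        + (y \<omega> - lin_comb d \<phi> \<omega>)\<^sup>2 \<partial>M)"
    by (intro Bochner_Integration.integral_cong) (auto simp: power2_eq_square algebra_simps)
  also have "\<dots> = (\<integral>\<omega>. (U \<omega> - y \<omega>)\<^sup>2 \<partial>M) + (\<integral>\<omega>. (y \<omega> - lin_comb d \<phi> \<omega>)\<^sup>2 \<partial>M)"
  proof -
    have "integrable M (\<lambda>\<omega>. (U \<omega> - y \<omega>)\<^sup>2)" "integrable M (\<lambda>\<omega>. (y \<omega> - lin_comb d \<phi> \<omega>)\<^sup>2)"
      "integrable M (\<lambda>\<omega>. (U \<omega> - y \<omega>) * (y \<omega> - lin_comb d \<phi> \<omega>))"
      using sq U y by (auto intro!: square_integrable_mult square_integrable_power2)
    then show ?thesis
      using cross by simp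
  qed
  finally show ?thesis .
qed

lemma is_proj_contraction:
  assumes "\<And>g. g \<in> set \<phi> \<Longrightarrow> square_integrable M g" "square_integrable M U" "is_proj M \<phi> U y"
  shows "(\<integral>\<omega>. (y \<omega>)\<^sup>2 \<partial>M) \<le> (\<integral>\<omega>. (U \<omega>)\<^sup>2 \<partial>M)"
proof -
  have "lin_comb (replicate (length \<phi>) 0) \<phi> \<omega> = 0" for \<omega>
    by (simp add: lin_comb_def)
  then show ?thesis
    using is_proj_pythagoras[OF assms, of "replicate (length \<phi>) 0"] by simp
qed

text \<open>The choice in \<open>L2_proj\<close> says nothing until the normal equations are known
  to be solvable. They are a linear system with the Gram matrix, so its inverse applied to the
  vector of inner products with U gives a solution.\<close>

lemma is_proj_L2_proj:
  assumes \<phi>: "\<And>g. g \<in> set \<phi> \<Longrightarrow> square_integrable M g" and U: "square_integrable M U"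
    and inv: "invertible_mat (gram_matrix M \<phi>)"
  shows "is_proj M \<phi> U (L2_proj M \<phi> U)"
proof -
  define n where "n = length \<phi>"
  define A where "A = gram_matrix M \<phi>"
  define v where "v = Matrix.vec n (\<lambda>i. \<integral>\<omega>. U \<omega> * (\<phi> ! i) \<omega> \<partial>M)"
  have A: "A \<in> carrier_mat n n"
    by (simp add: A_def gram_matrix_def n_def)
  obtain B where B: "A * B = 1\<^sub>m n" "B * A = 1\<^sub>m (dim_row B)"
    using inv A by (auto simp: A_def[symmetric] invertible_mat_def inverts_mat_def)
  \<comment> \<open>Invertibility provides only the two products; the dimensions of \<open>B\<close>
    are read off from them.\<close>
  have B_carrier: "B \<in> carrier_mat n n"
  proof -
    have "dim_col (A * B) = n" "dim_col (B * A) = dim_row B"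
      using B by auto
    then show ?thesis
      using A by (intro carrier_matI) auto
  qed
  define w where "w = B *\<^sub>v v"
  have w: "w \<in> carrier_vec n"
    unfolding w_def by (rule mult_mat_vec_carrier[OF B_carrier]) (simp add: v_def)
  have Aw: "A *\<^sub>v w = v"
    using A B_carrier B by (simp add: w_def v_def flip: assoc_mult_mat_vec)
  define c where "c = list_of_vec w"
  have c: "length c = length \<phi>" "c ! j = vec_index w j" if "j < n" for j
    using w that by (auto simp: c_def n_def list_of_vec_index)
  have len: "length c = length \<phi>"
    using w by (auto simp: c_def n_def)
  have "(\<integral>\<omega>. (U \<omega> - lin_comb c \<phi> \<omega>) * (\<phi> ! i) \<omega> \<partial>M) = 0" if i: "i < length \<phi>" for i
  proof -
    have int_sum: "(\<integral>\<omega>. (\<Sum>j<length \<phi>. c ! j * ((\<phi> ! i) \<omega> * (\<phi> ! j) \<omega>)) \<partial>M)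
        = (\<Sum>j<length \<phi>. c ! j * (\<integral>\<omega>. (\<phi> ! i) \<omega> * (\<phi> ! j) \<omega> \<partial>M))"
      using \<phi> i by (subst Bochner_Integration.integral_sum)
        (auto intro!: square_integrable_mult integrable_mult_right)
    have "(\<integral>\<omega>. (U \<omega> - lin_comb c \<phi> \<omega>) * (\<phi> ! i) \<omega> \<partial>M)
      = (\<integral>\<omega>. U \<omega> * (\<phi> ! i) \<omega> - (\<Sum>j<length \<phi>. c ! j * ((\<phi> ! i) \<omega> * (\<phi> ! j) \<omega>)) \<partial>M)"
      by (simp add: lin_comb_def algebra_simps sum_distrib_left)
    also have "\<dots> = vec_index v i - (\<Sum>j<n. c ! j * (\<integral>\<omega>. (\<phi> ! i) \<omega> * (\<phi> ! j) \<omega> \<partial>M))"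
      using \<phi> U i
      by (subst Bochner_Integration.integral_diff)
         (auto intro!: square_integrable_mult integrable_mult_right Bochner_Integration.integrable_sum
            simp: v_def n_def int_sum)
    also have "(\<Sum>j<n. c ! j * (\<integral>\<omega>. (\<phi> ! i) \<omega> * (\<phi> ! j) \<omega> \<partial>M)) = vec_index (A *\<^sub>v w) i"
      using A w i c
      by (auto simp: scalar_prod_def A_def gram_matrix_def n_def atLeast0LessThan mult.commute
          intro!: sum.cong)
    finally show ?thesis
      by (simp add: Aw)
  qed
  with len have ex: "\<exists>c. length c = length \<phi> \<and>
      (\<forall>j<length \<phi>. (\<integral>\<omega>. (U \<omega> - lin_comb c \<phi> \<omega>) * (\<phi> ! j) \<omega> \<partial>M) = 0)"
    by blast
  show ?thesis
    unfolding is_proj_def L2_proj_def using someI_ex[OF ex] by blast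
qed

text \<open>With x the projection of X, the error splits orthogonally into \<open>y - x\<close>,
  which is the projection of \<open>U - X\<close>, and \<open>x - X\<close>, the residual. Both
  terms keep the constant one, which a triangle inequality would lose; the recursion over N dates
  tolerates only factors \<open>1 + O(h)\<close> on the first.\<close>

lemma is_proj_error:
  assumes \<phi>: "\<And>g. g \<in> set \<phi> \<Longrightarrow> square_integrable M g"
    and U: "square_integrable M U" and X: "square_integrable M X"
    and inv: "invertible_mat (gram_matrix M \<phi>)" and proj: "is_proj M \<phi> U y"
  shows "(\<integral>\<omega>. (y \<omega> - X \<omega>)\<^sup>2 \<partial>M)
    \<le> (\<integral>\<omega>. (U \<omega> - X \<omega>)\<^sup>2 \<partial>M) + (\<integral>\<omega>. (L2_resid M \<phi> X \<omega>)\<^sup>2 \<partial>M)"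
proof -
  define x where "x = L2_proj M \<phi> X"
  have x: "is_proj M \<phi> X x"
    unfolding x_def using \<phi> X inv by (rule is_proj_L2_proj)
  obtain c where c: "y = lin_comb c \<phi>"
    using proj by (auto simp: is_proj_def)
  have "(\<integral>\<omega>. (y \<omega> - X \<omega>)\<^sup>2 \<partial>M) = (\<integral>\<omega>. (X \<omega> - x \<omega>)\<^sup>2 \<partial>M) + (\<integral>\<omega>. (y \<omega> - x \<omega>)\<^sup>2 \<partial>M)"
    using is_proj_pythagoras[OF \<phi> X x, of c] by (simp add: c power2_commute)
  moreover have "(\<integral>\<omega>. (y \<omega> - x \<omega>)\<^sup>2 \<partial>M) \<le> (\<integral>\<omega>. (U \<omega> - X \<omega>)\<^sup>2 \<partial>M)"
    using \<phi> square_integrable_diff[OF U X] is_proj_diff[OF \<phi> U X proj x]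
    by (rule is_proj_contraction)
  ultimately show ?thesis
    by (simp add: L2_resid_def x_def)
qed

section \<open>Conditional expectations over one time step\<close>

text \<open>
  The only consequences of independence that one step uses: the components of \<open>D\<close> are
  centred and uncorrelated given \<open>F\<close>, with conditional variance \<open>h\<close>.
\<close>

locale noise_step = prob_space M for M :: "'a measure" +
  fixes F :: "'a measure" and D :: "'a \<Rightarrow> real ^ 'q" and h :: real
  assumes subalg: "subalgebra M F"
    and noise_measurable [measurable]: "D \<in> borel_measurable M"
    and h_pos: "h > 0"
    and noise_mean: "\<And>G l. G \<in> borel_measurable F \<Longrightarrow> integrable M G \<Longrightarrow>
      integrable M (\<lambda>\<omega>. G \<omega> * vec_nth (D \<omega>) l) \<and> (\<integral>\<omega>. G \<omega> * vec_nth (D \<omega>) l \<partial>M) = 0"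
    and noise_covariance: "\<And>G l m. G \<in> borel_measurable F \<Longrightarrow> integrable M G \<Longrightarrow>
      integrable M (\<lambda>\<omega>. G \<omega> * (vec_nth (D \<omega>) l * vec_nth (D \<omega>) m)) \<and>
      (\<integral>\<omega>. G \<omega> * (vec_nth (D \<omega>) l * vec_nth (D \<omega>) m) \<partial>M)
        = (if l = m then h * (\<integral>\<omega>. G \<omega> \<partial>M) else 0)"
begin

sublocale finite_measure_subalgebra M F
  by standard (rule subalg)

lemma measurable_F [measurable_dest]: "X \<in> borel_measurable F \<Longrightarrow> X \<in> borel_measurable M"
  by (rule measurable_from_subalg[OF subalg])

lemma square_integrable_noise_mult:
  assumes "G \<in> borel_measurable F" "square_integrable M G"
  shows "square_integrable M (\<lambda>\<omega>. G \<omega> * vec_nth (D \<omega>) l)"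
proof -
  have [measurable]: "G \<in> borel_measurable M"
    using assms by (simp add: square_integrable_measurable)
  show ?thesis
    using noise_covariance[of "\<lambda>\<omega>. (G \<omega>)\<^sup>2" l l] assms
    by (simp add: square_integrable_def power_mult_distrib power2_eq_square mult.assoc mult.left_commute)
qed

lemma square_integrable_noise: "square_integrable M (\<lambda>\<omega>. vec_nth (D \<omega>) l)"
  using square_integrable_noise_mult[of "\<lambda>_. 1" l] by simp

lemma noise_orthogonal:
  assumes "A \<in> borel_measurable F" "square_integrable M A"
    and "G \<in> borel_measurable F" "square_integrable M G"
  shows "(\<integral>\<omega>. A \<omega> * (G \<omega> * vec_nth (D \<omega>) l) \<partial>M) = 0"
  using noise_mean[of "\<lambda>\<omega>. A \<omega> * G \<omega>" l] assms square_integrable_mult[of M A G]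
  by (simp add: mult.assoc)

lemma noise_inner:
  assumes "A \<in> borel_measurable F" "square_integrable M A"
    and "G \<in> borel_measurable F" "square_integrable M G"
  shows "(\<integral>\<omega>. (A \<omega> * vec_nth (D \<omega>) l) * (G \<omega> * vec_nth (D \<omega>) m) \<partial>M)
    = (if l = m then h * (\<integral>\<omega>. A \<omega> * G \<omega> \<partial>M) else 0)"
  using noise_covariance[of "\<lambda>\<omega>. A \<omega> * G \<omega>" l m] assms square_integrable_mult[of M A G]
  by (simp add: mult.assoc mult.left_commute)

lemma noise_sum_orthogonal:
  assumes "A \<in> borel_measurable F" "square_integrable M A"
    and "\<And>l. G l \<in> borel_measurable F" "\<And>l. square_integrable M (G l)"
  shows "(\<integral>\<omega>. A \<omega> * (\<Sum>l\<in>UNIV. G l \<omega> * vec_nth (D \<omega>) l) \<partial>M) = 0"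
  unfolding sum_distrib_left
  using assms noise_orthogonal square_integrable_noise_mult
  by (subst Bochner_Integration.integral_sum) (auto intro!: square_integrable_mult)

lemma noise_sum_inner:
  assumes "A \<in> borel_measurable F" "square_integrable M A"
    and "\<And>l. G l \<in> borel_measurable F" "\<And>l. square_integrable M (G l)"
  shows "(\<integral>\<omega>. (\<Sum>l\<in>UNIV. G l \<omega> * vec_nth (D \<omega>) l) * (A \<omega> * vec_nth (D \<omega>) m) \<partial>M)
    = h * (\<integral>\<omega>. G m \<omega> * A \<omega> \<partial>M)"
  unfolding sum_distrib_right
  using assms square_integrable_noise_mult noise_inner[OF assms(3,4) assms(1,2)]
  by (subst Bochner_Integration.integral_sum) (auto intro!: square_integrable_mult)

lemma noise_sum_square:
  assumes "\<And>l. G l \<in> borel_measurable F" "\<And>l. square_integrable M (G l)"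
  shows "(\<integral>\<omega>. (\<Sum>l\<in>UNIV. G l \<omega> * vec_nth (D \<omega>) l)\<^sup>2 \<partial>M) = h * (\<Sum>l\<in>UNIV. \<integral>\<omega>. (G l \<omega>)\<^sup>2 \<partial>M)"
proof -
  have "(\<integral>\<omega>. (\<Sum>l\<in>UNIV. G l \<omega> * vec_nth (D \<omega>) l)\<^sup>2 \<partial>M)
    = (\<integral>\<omega>. (\<Sum>m\<in>UNIV. (\<Sum>l\<in>UNIV. G l \<omega> * vec_nth (D \<omega>) l) * (G m \<omega> * vec_nth (D \<omega>) m)) \<partial>M)"
    by (simp add: power2_eq_square sum_distrib_left)
  also have "\<dots> = (\<Sum>m\<in>UNIV. h * (\<integral>\<omega>. G m \<omega> * G m \<omega> \<partial>M))"
    using assms square_integrable_noise_mult noise_sum_inner[OF assms assms]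
    by (subst Bochner_Integration.integral_sum)
       (auto intro!: square_integrable_mult square_integrable_sum)
  finally show ?thesis
    by (simp add: sum_distrib_left power2_eq_square)
qed

text \<open>F-measurable variables are orthogonal to F-measurable multiples of the noise. Applied to
  each component of an Euler step, with \<open>A\<close> its drift part.\<close>

lemma noise_pythagoras:
  assumes A: "A \<in> borel_measurable F" "square_integrable M A"
    and G: "\<And>l. G l \<in> borel_measurable F" "\<And>l. square_integrable M (G l)"
  shows "(\<integral>\<omega>. (A \<omega> + (\<Sum>l\<in>UNIV. G l \<omega> * vec_nth (D \<omega>) l))\<^sup>2 \<partial>M)
    = (\<integral>\<omega>. (A \<omega>)\<^sup>2 \<partial>M) + h * (\<Sum>l\<in>UNIV. \<integral>\<omega>. (G l \<omega>)\<^sup>2 \<partial>M)"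
proof -
  let ?N = "\<lambda>\<omega>. \<Sum>l\<in>UNIV. G l \<omega> * vec_nth (D \<omega>) l"
  have N: "square_integrable M ?N"
    using G square_integrable_noise_mult by (intro square_integrable_sum) auto
  have "(\<integral>\<omega>. (A \<omega> + ?N \<omega>)\<^sup>2 \<partial>M) = (\<integral>\<omega>. (A \<omega>)\<^sup>2 + 2 * (A \<omega> * ?N \<omega>) + (?N \<omega>)\<^sup>2 \<partial>M)"
    by (simp add: power2_sum algebra_simps)
  also have "\<dots> = (\<integral>\<omega>. (A \<omega>)\<^sup>2 \<partial>M) + 2 * (\<integral>\<omega>. A \<omega> * ?N \<omega> \<partial>M) + (\<integral>\<omega>. (?N \<omega>)\<^sup>2 \<partial>M)"
    using square_integrable_mult[OF A(2) N] square_integrable_power2[OF N]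
      square_integrable_power2[OF A(2)] by simp
  finally show ?thesis
    by (simp add: noise_sum_orthogonal[OF A G] noise_sum_square[OF G])
qed

section \<open>Conditional expectations and noise coefficients\<close>

lemma square_integrable_cond_exp:
  assumes "square_integrable M X"
  shows "square_integrable M (real_cond_exp M F X)"
  unfolding square_integrable_def
  using integrable_convex_cond_exp[of X UNIV _ _ "\<lambda>x. x\<^sup>2"] assms
  by (auto simp: square_integrable_integrable square_integrable_power2 convex_power2)

lemma cond_exp_inner:
  assumes "square_integrable M X" "G \<in> borel_measurable F" "square_integrable M G"
  shows "(\<integral>\<omega>. real_cond_exp M F X \<omega> * G \<omega> \<partial>M) = (\<integral>\<omega>. X \<omega> * G \<omega> \<partial>M)"
  using real_cond_exp_intg(2)[of G X] square_integrable_mult[of M G X] assms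
  by (simp add: mult.commute square_integrable_measurable)

text \<open>The coefficient of the l-th component of \<open>D\<close> when X is projected on the
  F-measurable multiples of the noise. Applied to the value at the next date it is a component of Z
  in the backward scheme.\<close>

definition noise_coeff :: "('a \<Rightarrow> real) \<Rightarrow> 'q \<Rightarrow> 'a \<Rightarrow> real" where
  "noise_coeff X l \<omega> = 1 / h * real_cond_exp M F (\<lambda>\<omega>. X \<omega> * vec_nth (D \<omega>) l) \<omega>"

lemma noise_coeff_measurable [measurable]: "noise_coeff X l \<in> borel_measurable F"
  unfolding noise_coeff_def by measurable

text \<open>At this point the coefficient is known only as a conditional expectation of an
  integrable product, so integrability against \<open>G\<close> is part of the claim; it is
  inherited from the product of X, \<open>G\<close> and the noise.\<close>

lemma noise_coeff_inner:
  assumes "square_integrable M X" "G \<in> borel_measurable F" "square_integrable M G"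
  shows "(\<integral>\<omega>. X \<omega> * (G \<omega> * vec_nth (D \<omega>) l) \<partial>M) = h * (\<integral>\<omega>. noise_coeff X l \<omega> * G \<omega> \<partial>M)"
    and "integrable M (\<lambda>\<omega>. noise_coeff X l \<omega> * G \<omega>)"
proof -
  have int: "integrable M (\<lambda>\<omega>. G \<omega> * (X \<omega> * vec_nth (D \<omega>) l))"
    using square_integrable_mult[OF assms(1) square_integrable_noise_mult[OF assms(2,3), of l]]
    by (simp add: mult.left_commute)
  have [measurable]: "X \<in> borel_measurable M"
    using assms by (simp add: square_integrable_measurable)
  have "integrable M (\<lambda>\<omega>. G \<omega> * real_cond_exp M F (\<lambda>\<omega>. X \<omega> * vec_nth (D \<omega>) l) \<omega>)"
    "(\<integral>\<omega>. G \<omega> * (X \<omega> * vec_nth (D \<omega>) l) \<partial>M)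
      = (\<integral>\<omega>. G \<omega> * real_cond_exp M F (\<lambda>\<omega>. X \<omega> * vec_nth (D \<omega>) l) \<omega> \<partial>M)"
    using real_cond_exp_intg[OF int assms(2)] by simp_all
  then show "(\<integral>\<omega>. X \<omega> * (G \<omega> * vec_nth (D \<omega>) l) \<partial>M) = h * (\<integral>\<omega>. noise_coeff X l \<omega> * G \<omega> \<partial>M)"
    "integrable M (\<lambda>\<omega>. noise_coeff X l \<omega> * G \<omega>)"
    using h_pos by (simp_all add: noise_coeff_def mult.left_commute mult.commute)
qed

lemma noise_coeff_diff:
  assumes "square_integrable M X" "square_integrable M Y"
  shows "AE \<omega> in M. \<forall>l. noise_coeff (\<lambda>\<omega>. X \<omega> - Y \<omega>) l \<omega> = noise_coeff X l \<omega> - noise_coeff Y l \<omega>"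
  unfolding AE_all_countable
proof
  fix l
  have "AE \<omega> in M. real_cond_exp M F (\<lambda>\<omega>. X \<omega> * vec_nth (D \<omega>) l - Y \<omega> * vec_nth (D \<omega>) l) \<omega>
    = real_cond_exp M F (\<lambda>\<omega>. X \<omega> * vec_nth (D \<omega>) l) \<omega>
      - real_cond_exp M F (\<lambda>\<omega>. Y \<omega> * vec_nth (D \<omega>) l) \<omega>"
    using assms square_integrable_noise
    by (intro real_cond_exp_diff square_integrable_mult)
  then show "AE \<omega> in M. noise_coeff (\<lambda>\<omega>. X \<omega> - Y \<omega>) l \<omega> = noise_coeff X l \<omega> - noise_coeff Y l \<omega>"
    by eventually_elim (simp add: noise_coeff_def left_diff_distrib diff_divide_distrib)
qed

text \<open>Let R = X - E(X | F), whose squared norm c is the right-hand side, and let s be h times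
  the summed squared norms of the truncated coefficients. Subtracting from R the noise combination
  with these coefficients leaves the squared norm \<open>c - 2 * s + s\<close>, which is
  nonnegative, so \<open>s \<le> c\<close>. Monotone convergence removes the truncation.\<close>

lemma
  assumes X: "square_integrable M X"
  shows square_integrable_noise_coeff: "square_integrable M (noise_coeff X l)"
    and noise_bessel: "h * (\<Sum>l\<in>UNIV. \<integral>\<omega>. (noise_coeff X l \<omega>)\<^sup>2 \<partial>M)
      \<le> (\<integral>\<omega>. (X \<omega>)\<^sup>2 \<partial>M) - (\<integral>\<omega>. (real_cond_exp M F X \<omega>)\<^sup>2 \<partial>M)"
proof -
  (* Truncation, since the square integrability of the coefficients is part of the claim. *)
  define G where "G n l \<omega> = (if \<forall>m. \<bar>noise_coeff X m \<omega>\<bar> \<le> real n then noise_coeff X l \<omega> else 0)"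
    for n l \<omega>
  have G_F [measurable]: "G n l \<in> borel_measurable F" for n l
    unfolding G_def by measurable
  have G_sq: "square_integrable M (G n l)" for n l
    by (rule square_integrable_bound[of _ "\<lambda>_. real n"]) (auto simp: G_def measurable_F)
  let ?E = "real_cond_exp M F X"
  have E: "?E \<in> borel_measurable F" "square_integrable M ?E"
    using square_integrable_cond_exp[OF X] by auto
  define R where "R \<omega> = X \<omega> - ?E \<omega>" for \<omega>
  have R: "square_integrable M R"
    unfolding R_def using X E by auto
  define c where "c = (\<integral>\<omega>. (X \<omega>)\<^sup>2 \<partial>M) - (\<integral>\<omega>. (?E \<omega>)\<^sup>2 \<partial>M)"
  have "(\<integral>\<omega>. (R \<omega>)\<^sup>2 \<partial>M) = (\<integral>\<omega>. (X \<omega>)\<^sup>2 - 2 * (X \<omega> * ?E \<omega>) + (?E \<omega>)\<^sup>2 \<partial>M)"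
    by (simp add: R_def power2_diff algebra_simps)
  also have "\<dots> = (\<integral>\<omega>. (X \<omega>)\<^sup>2 \<partial>M) - 2 * (\<integral>\<omega>. X \<omega> * ?E \<omega> \<partial>M) + (\<integral>\<omega>. (?E \<omega>)\<^sup>2 \<partial>M)"
    using square_integrable_mult[OF X E(2)] square_integrable_power2[OF X]
      square_integrable_power2[OF E(2)] by simp
  also have "(\<integral>\<omega>. X \<omega> * ?E \<omega> \<partial>M) = (\<integral>\<omega>. (?E \<omega>)\<^sup>2 \<partial>M)"
    using cond_exp_inner[OF X E] by (simp add: power2_eq_square)
  finally have R2: "(\<integral>\<omega>. (R \<omega>)\<^sup>2 \<partial>M) = c"
    by (simp add: c_def)
  have bound: "h * (\<Sum>l\<in>UNIV. \<integral>\<omega>. (G n l \<omega>)\<^sup>2 \<partial>M) \<le> c" for n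
  proof -
    let ?N = "\<lambda>\<omega>. \<Sum>l\<in>UNIV. G n l \<omega> * vec_nth (D \<omega>) l"
    have GD: "square_integrable M (\<lambda>\<omega>. G n l \<omega> * vec_nth (D \<omega>) l)" for l
      by (rule square_integrable_noise_mult[OF G_F G_sq])
    then have N: "square_integrable M ?N"
      by auto
    \<comment> \<open>The conditional expectation is orthogonal to the noise, so X may replace R. A
      truncated coefficient is either 0 or the coefficient itself, so its product with the
      coefficient is its own square.\<close>
    have cross: "(\<integral>\<omega>. R \<omega> * (G n l \<omega> * vec_nth (D \<omega>) l) \<partial>M) = h * (\<integral>\<omega>. (G n l \<omega>)\<^sup>2 \<partial>M)" for l
    proof -
      have "(\<integral>\<omega>. R \<omega> * (G n l \<omega> * vec_nth (D \<omega>) l) \<partial>M)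
        = (\<integral>\<omega>. X \<omega> * (G n l \<omega> * vec_nth (D \<omega>) l) \<partial>M)
          - (\<integral>\<omega>. ?E \<omega> * (G n l \<omega> * vec_nth (D \<omega>) l) \<partial>M)"
        unfolding R_def left_diff_distrib using X E(2) GD
        by (intro Bochner_Integration.integral_diff square_integrable_mult)
      also have "\<dots> = h * (\<integral>\<omega>. noise_coeff X l \<omega> * G n l \<omega> \<partial>M)"
        using noise_coeff_inner(1)[OF X G_F G_sq] noise_orthogonal[OF E G_F G_sq] by simp
      also have "(\<integral>\<omega>. noise_coeff X l \<omega> * G n l \<omega> \<partial>M) = (\<integral>\<omega>. (G n l \<omega>)\<^sup>2 \<partial>M)"
        by (intro Bochner_Integration.integral_cong) (auto simp: G_def power2_eq_square)
      finally show ?thesis .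
    qed
    have "(\<integral>\<omega>. R \<omega> * ?N \<omega> \<partial>M) = h * (\<Sum>l\<in>UNIV. \<integral>\<omega>. (G n l \<omega>)\<^sup>2 \<partial>M)"
      unfolding sum_distrib_left using GD R cross
      by (subst Bochner_Integration.integral_sum) (auto intro!: square_integrable_mult)
    moreover have "(\<integral>\<omega>. (R \<omega> - ?N \<omega>)\<^sup>2 \<partial>M)
      = (\<integral>\<omega>. (R \<omega>)\<^sup>2 \<partial>M) - 2 * (\<integral>\<omega>. R \<omega> * ?N \<omega> \<partial>M) + (\<integral>\<omega>. (?N \<omega>)\<^sup>2 \<partial>M)"
    proof -
      have "(\<integral>\<omega>. (R \<omega> - ?N \<omega>)\<^sup>2 \<partial>M) = (\<integral>\<omega>. (R \<omega>)\<^sup>2 - 2 * (R \<omega> * ?N \<omega>) + (?N \<omega>)\<^sup>2 \<partial>M)"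
        by (simp add: power2_diff algebra_simps)
      then show ?thesis
        using square_integrable_mult[OF R N] square_integrable_power2[OF R]
          square_integrable_power2[OF N] by simp
    qed
    moreover have "0 \<le> (\<integral>\<omega>. (R \<omega> - ?N \<omega>)\<^sup>2 \<partial>M)"
      by simp
    ultimately show ?thesis
      using noise_sum_square[OF G_F G_sq] by (simp add: R2)
  qed
  define u where "u \<omega> = (\<Sum>l\<in>UNIV. (noise_coeff X l \<omega>)\<^sup>2)" for \<omega>
  define v where "v n \<omega> = (\<Sum>l\<in>UNIV. (G n l \<omega>)\<^sup>2)" for n \<omega>
  have v_int: "integrable M (v n)" for n
    unfolding v_def using G_sq by (intro Bochner_Integration.integrable_sum square_integrable_power2)
  have v_bound: "integral\<^sup>L M (v n) \<le> c / h" for n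
    using bound[of n] h_pos G_sq unfolding v_def
    by (subst Bochner_Integration.integral_sum) (auto simp: field_simps square_integrable_power2)
  \<comment> \<open>All coordinates are truncated together: raising n can only turn the zero vector
    into the full one.\<close>
  have v_mono: "mono (\<lambda>n. v n \<omega>)" for \<omega>
  proof (rule monoI)
    fix n m :: nat assume "n \<le> m"
    then have "(G n l \<omega>)\<^sup>2 \<le> (G m l \<omega>)\<^sup>2" for l
      by (auto simp: G_def) (meson of_nat_mono order_trans)
    then show "v n \<omega> \<le> v m \<omega>"
      by (auto simp: v_def intro!: sum_mono)
  qed
  have v_lim: "(\<lambda>n. v n \<omega>) \<longlonglongrightarrow> u \<omega>" for \<omega>
  proof (rule tendsto_eventually)
    \<comment> \<open>From this n0 on, which depends on \<omega>, the truncation is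
      inactive.\<close>
    obtain n0 :: nat where n0: "(\<Sum>m\<in>UNIV. \<bar>noise_coeff X m \<omega>\<bar>) \<le> real n0"
      using real_arch_simple by blast
    have le: "\<bar>noise_coeff X m \<omega>\<bar> \<le> real n" if "n \<ge> n0" for m n
    proof -
      have "\<bar>noise_coeff X m \<omega>\<bar> \<le> (\<Sum>m\<in>UNIV. \<bar>noise_coeff X m \<omega>\<bar>)"
        by (intro member_le_sum) auto
      then show ?thesis
        using n0 that by linarith
    qed
    show "\<forall>\<^sub>F n in sequentially. v n \<omega> = u \<omega>"
      using eventually_ge_at_top[of n0]
      by eventually_elim (auto simp: v_def u_def G_def le)
  qed
  have "incseq (\<lambda>n. integral\<^sup>L M (v n))"
    using v_mono v_int by (auto simp: incseq_def mono_def intro!: integral_mono)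
  then obtain L where L: "(\<lambda>n. integral\<^sup>L M (v n)) \<longlonglongrightarrow> L"
    using incseq_convergent[of "\<lambda>n. integral\<^sup>L M (v n)" "c / h"] v_bound by blast
  have [measurable]: "noise_coeff X l \<in> borel_measurable M" for l
    by (rule measurable_F) simp
  have u_meas: "u \<in> borel_measurable M"
    unfolding u_def by measurable
  have u: "integrable M u" "integral\<^sup>L M u = L"
    using integrable_monotone_convergence[of M v u L] integral_monotone_convergence[of M v u L]
      v_int v_mono v_lim L u_meas by auto
  have Z: "square_integrable M (noise_coeff X l)" for l
    unfolding square_integrable_def
  proof
    show "integrable M (\<lambda>\<omega>. (noise_coeff X l \<omega>)\<^sup>2)"
      by (rule Bochner_Integration.integrable_bound[OF u(1)])
         (auto simp: u_def intro!: AE_I2 order_trans[OF _ abs_ge_self] member_le_sum)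
  qed simp
  then show "square_integrable M (noise_coeff X l)" .
  have "L \<le> c / h"
    using L by (rule LIMSEQ_le_const2) (use v_bound in auto)
  moreover have "integral\<^sup>L M u = (\<Sum>l\<in>UNIV. \<integral>\<omega>. (noise_coeff X l \<omega>)\<^sup>2 \<partial>M)"
    unfolding u_def using Z
    by (intro Bochner_Integration.integral_sum square_integrable_power2)
  ultimately show "h * (\<Sum>l\<in>UNIV. \<integral>\<omega>. (noise_coeff X l \<omega>)\<^sup>2 \<partial>M)
      \<le> (\<integral>\<omega>. (X \<omega>)\<^sup>2 \<partial>M) - (\<integral>\<omega>. (?E \<omega>)\<^sup>2 \<partial>M)"
    using u h_pos by (simp add: c_def field_simps)
qed

end

section \<open>First-order conditions for least squares\<close>

lemma lin_comb_list_update: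
  assumes "j < length \<phi>" "length c = length \<phi>"
  shows "lin_comb (c[j := c ! j + t]) \<phi> \<omega> = lin_comb c \<phi> \<omega> + t * (\<phi> ! j) \<omega>"
proof -
  have "lin_comb (c[j := c ! j + t]) \<phi> \<omega>
    = (\<Sum>i<length \<phi>. c ! i * (\<phi> ! i) \<omega> + (if i = j then t * (\<phi> ! i) \<omega> else 0))"
    unfolding lin_comb_def using assms
    by (intro sum.cong) (auto simp: nth_list_update algebra_simps)
  also have "\<dots> = lin_comb c \<phi> \<omega> + t * (\<phi> ! j) \<omega>"
    using assms by (simp add: sum.distrib lin_comb_def)
  finally show ?thesis .
qed

lemma lin_comb_measurable:
  "(\<And>g. g \<in> set \<phi> \<Longrightarrow> g \<in> borel_measurable N) \<Longrightarrow> lin_comb c \<phi> \<in> borel_measurable N"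
  unfolding lin_comb_def by (intro borel_measurable_sum borel_measurable_times) auto

text \<open>A parabola in t with its minimum at 0 has no linear term.\<close>

lemma first_order_condition:
  assumes R: "square_integrable M R" and X: "square_integrable M X"
    and min: "\<And>t. (\<integral>\<omega>. (R \<omega>)\<^sup>2 \<partial>M) \<le> (\<integral>\<omega>. (R \<omega> - t * X \<omega>)\<^sup>2 \<partial>M)"
  shows "(\<integral>\<omega>. R \<omega> * X \<omega> \<partial>M) = 0"
proof -
  define a where "a = (\<integral>\<omega>. R \<omega> * X \<omega> \<partial>M)"
  define s where "s = (\<integral>\<omega>. (X \<omega>)\<^sup>2 \<partial>M)"
  have s: "s \<ge> 0"
    by (simp add: s_def)
  have expand: "(\<integral>\<omega>. (R \<omega> - t * X \<omega>)\<^sup>2 \<partial>M) = (\<integral>\<omega>. (R \<omega>)\<^sup>2 \<partial>M) - 2 * t * a + t\<^sup>2 * s" for t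
  proof -
    have "(\<integral>\<omega>. (R \<omega> - t * X \<omega>)\<^sup>2 \<partial>M)
      = (\<integral>\<omega>. (R \<omega>)\<^sup>2 - 2 * t * (R \<omega> * X \<omega>) + t\<^sup>2 * (X \<omega>)\<^sup>2 \<partial>M)"
      by (simp add: power2_diff power_mult_distrib algebra_simps)
    then show ?thesis
      using square_integrable_mult[OF R X] square_integrable_power2[OF R]
        square_integrable_power2[OF X] by (simp add: a_def s_def)
  qed
  \<comment> \<open>The vertex would be \<open>a / s\<close>; the denominator \<open>s + 1\<close>
    avoids the case s = 0 and still gives a negative value unless a = 0.\<close>
  define t where "t = a / (s + 1)"
  have "0 \<le> - 2 * t * a + t\<^sup>2 * s"
    using min[of t] expand[of t] by simp
  also have "\<dots> = - (a\<^sup>2 * (s + 2)) / (s + 1)\<^sup>2"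
    using s by (simp add: t_def power2_eq_square divide_simps) (simp add: algebra_simps)
  finally have "a\<^sup>2 * (s + 2) \<le> 0"
    using s by (simp add: divide_simps)
  then show ?thesis
    using s by (simp add: a_def[symmetric] mult_le_0_iff)
qed

section \<open>Picard iterations over one time step\<close>

text \<open>One date in isolation: \<open>F\<close> and \<open>D\<close> are its sigma-algebra and
  Brownian increment, and \<open>drv\<close> is f with the date and the Euler state inserted. The
  last bound on h says \<open>\<gamma> * h \<le> 1\<close> for the weight \<gamma> below.\<close>

locale picard_step = noise_step M F D h
  for M :: "'a measure" and F and D :: "'a \<Rightarrow> real ^ 'q" and h +
  fixes B :: "'q option \<Rightarrow> ('a \<Rightarrow> real) list"
    and drv :: "'a \<Rightarrow> real \<Rightarrow> real ^ 'q \<Rightarrow> real"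
    and K :: real
  assumes basis_measurable: "\<And>l g. g \<in> set (B l) \<Longrightarrow> g \<in> borel_measurable F"
    and basis_square_integrable: "\<And>l g. g \<in> set (B l) \<Longrightarrow> square_integrable M g"
    and driver_measurable: "\<And>y z. y \<in> borel_measurable F \<Longrightarrow> z \<in> borel_measurable F \<Longrightarrow>
      (\<lambda>\<omega>. drv \<omega> (y \<omega>) (z \<omega>)) \<in> borel_measurable F"
    and driver_lipschitz: "\<And>\<omega> y z y' z'. \<bar>drv \<omega> y z - drv \<omega> y' z'\<bar> \<le> K * (\<bar>y - y'\<bar> + norm (z - z'))"
    and driver_zero: "square_integrable M (\<lambda>\<omega>. drv \<omega> 0 0)"
    and K_nonneg: "K \<ge> 0"
    and h_small: "h \<le> 1" "(16 * K\<^sup>2 + 1) * h \<le> 1"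
begin

definition basis_val :: "('q option \<Rightarrow> real list) \<Rightarrow> 'a \<Rightarrow> real ^ 'q" where
  "basis_val a \<omega> = (\<chi> l. lin_comb (a (Some l)) (B (Some l)) \<omega>)"

text \<open>The previous iterate enters only through V, which is fixed while \<open>a\<close>
  varies. Each Picard iteration is therefore a linear least-squares problem, whatever the
  nonlinearity of f.\<close>

definition loss ::
    "('a \<Rightarrow> real) \<Rightarrow> ('a \<Rightarrow> real) \<Rightarrow> ('q option \<Rightarrow> real list) \<Rightarrow> real" where
  "loss U V a = (\<integral>\<omega>. (U \<omega> - lin_comb (a None) (B None) \<omega> + h * V \<omega>
     - (\<Sum>l\<in>UNIV. lin_comb (a (Some l)) (B (Some l)) \<omega> * vec_nth (D \<omega>) l))\<^sup>2 \<partial>M)"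

lemma basis_lin_comb:
  "lin_comb c (B l) \<in> borel_measurable F" "square_integrable M (lin_comb c (B l))"
  using basis_measurable basis_square_integrable
  by (auto intro: lin_comb_measurable square_integrable_lin_comb)

lemma basis_nth:
  assumes "j < length (B l)"
  shows "B l ! j \<in> borel_measurable F" "square_integrable M (B l ! j)"
  using basis_measurable[OF nth_mem[OF assms]] basis_square_integrable[OF nth_mem[OF assms]] by auto

lemma driver_square_integrable:
  assumes "y \<in> borel_measurable F" "square_integrable M y"
    and "z \<in> borel_measurable F" "\<And>l. square_integrable M (\<lambda>\<omega>. vec_nth (z \<omega>) l)"
  shows "square_integrable M (\<lambda>\<omega>. drv \<omega> (y \<omega>) (z \<omega>))"
proof (rule square_integrable_bound)
  show "square_integrable M (\<lambda>\<omega>. \<bar>drv \<omega> 0 0\<bar> + K * (\<bar>y \<omega>\<bar> + norm (z \<omega>)))"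
    using assms driver_zero by (intro square_integrable_add square_integrable_cmult
        square_integrable_abs square_integrable_norm)
  show "(\<lambda>\<omega>. drv \<omega> (y \<omega>) (z \<omega>)) \<in> borel_measurable M"
    using assms by (intro measurable_F driver_measurable)
  show "AE \<omega> in M. \<bar>drv \<omega> (y \<omega>) (z \<omega>)\<bar> \<le> \<bar>\<bar>drv \<omega> 0 0\<bar> + K * (\<bar>y \<omega>\<bar> + norm (z \<omega>))\<bar>"
  proof (rule AE_I2)
    fix \<omega>
    show "\<bar>drv \<omega> (y \<omega>) (z \<omega>)\<bar> \<le> \<bar>\<bar>drv \<omega> 0 0\<bar> + K * (\<bar>y \<omega>\<bar> + norm (z \<omega>))\<bar>"
      using driver_lipschitz[of \<omega> "y \<omega>" "z \<omega>" 0 0] by simp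
  qed
qed

text \<open>At a minimizer the residual is orthogonal to each function of \<open>B None\<close> and
  to each function of \<open>B (Some l)\<close> times the l-th noise. Tested with the former, the
  noise sum vanishes; tested with the latter, only the l-th noise term and the noise coefficient of
  U remain.\<close>

lemma minimizer_is_proj:
  assumes U: "square_integrable M U"
    and V: "V \<in> borel_measurable F" "square_integrable M V"
    and min: "is_arg_min (loss U V) (\<lambda>a. \<forall>l. length (a l) = length (B l)) a"
  shows "is_proj M (B None) (\<lambda>\<omega>. real_cond_exp M F U \<omega> + h * V \<omega>) (lin_comb (a None) (B None))"
    and "is_proj M (B (Some l)) (noise_coeff U l) (lin_comb (a (Some l)) (B (Some l)))"
proof -
  have len: "length (a l) = length (B l)" for l
    using min by (auto simp: is_arg_min_def)
  define y where "y = lin_comb (a None) (B None)"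
  define z where "z l = lin_comb (a (Some l)) (B (Some l))" for l
  have y: "y \<in> borel_measurable F" "square_integrable M y"
    by (simp_all add: y_def basis_lin_comb)
  have z: "z l \<in> borel_measurable F" "square_integrable M (z l)" for l
    by (simp_all add: z_def basis_lin_comb)
  define N where "N \<omega> = (\<Sum>l\<in>UNIV. z l \<omega> * vec_nth (D \<omega>) l)" for \<omega>
  have zD: "square_integrable M (\<lambda>\<omega>. z l \<omega> * vec_nth (D \<omega>) l)" for l
    using z by (rule square_integrable_noise_mult)
  then have N: "square_integrable M N"
    unfolding N_def by (rule square_integrable_sum)
  define A where "A \<omega> = h * V \<omega> - y \<omega>" for \<omega>
  have A: "A \<in> borel_measurable F" "square_integrable M A"
    unfolding A_def using V y by (auto intro!: borel_measurable_diff)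
  define R where "R \<omega> = U \<omega> + A \<omega> - N \<omega>" for \<omega>
  have R: "square_integrable M R"
    unfolding R_def using U A N by auto
  \<comment> \<open>The factor that a basis function of family l carries in the criterion.\<close>
  define dir where "dir l \<omega> = (case l of None \<Rightarrow> 1 | Some m \<Rightarrow> vec_nth (D \<omega>) m)" for l \<omega>
  have R_split: "(\<integral>\<omega>. R \<omega> * X \<omega> \<partial>M)
      = (\<integral>\<omega>. U \<omega> * X \<omega> \<partial>M) + (\<integral>\<omega>. A \<omega> * X \<omega> \<partial>M) - (\<integral>\<omega>. N \<omega> * X \<omega> \<partial>M)"
    if "square_integrable M X" for X
    using that U A N by (simp add: R_def algebra_simps square_integrable_mult)
  have normal: "(\<integral>\<omega>. R \<omega> * ((B l ! j) \<omega> * dir l \<omega>) \<partial>M) = 0" if j: "j < length (B l)" for l j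
  proof (rule first_order_condition[OF R])
    show "square_integrable M (\<lambda>\<omega>. (B l ! j) \<omega> * dir l \<omega>)"
      using basis_nth[OF j] square_integrable_noise_mult by (cases l) (auto simp: dir_def)
    fix t
    \<comment> \<open>Moving one coefficient by t shifts the residual by -t times one direction, the
      one-parameter test of \<open>first_order_condition\<close>.\<close>
    define a' where "a' = a(l := (a l)[j := a l ! j + t])"
    have upd: "lin_comb (a' m) (B m) \<omega>
      = lin_comb (a m) (B m) \<omega> + (if m = l then t * (B l ! j) \<omega> else 0)" for m \<omega>
      using j len by (simp add: a'_def lin_comb_list_update)
    have "\<forall>m. length (a' m) = length (B m)"
      using len by (simp add: a'_def)
    then have "loss U V a \<le> loss U V a'"
      using min by (simp add: is_arg_min_linorder)
    also have "loss U V a = (\<integral>\<omega>. (R \<omega>)\<^sup>2 \<partial>M)"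
      by (simp add: loss_def R_def A_def N_def y_def z_def algebra_simps)
    also have "loss U V a' = (\<integral>\<omega>. (R \<omega> - t * ((B l ! j) \<omega> * dir l \<omega>))\<^sup>2 \<partial>M)"
      unfolding loss_def
    proof (intro Bochner_Integration.integral_cong refl arg_cong[where f = "\<lambda>x. x\<^sup>2"])
      fix \<omega>
      have "(\<Sum>m\<in>UNIV. lin_comb (a' (Some m)) (B (Some m)) \<omega> * vec_nth (D \<omega>) m)
        = N \<omega> + (\<Sum>m\<in>UNIV. if Some m = l then t * (B l ! j) \<omega> * vec_nth (D \<omega>) m else 0)"
        unfolding upd N_def z_def sum.distrib[symmetric]
        by (intro sum.cong) (auto simp: algebra_simps)
      then show "U \<omega> - lin_comb (a' None) (B None) \<omega> + h * V \<omega>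
          - (\<Sum>m\<in>UNIV. lin_comb (a' (Some m)) (B (Some m)) \<omega> * vec_nth (D \<omega>) m)
        = R \<omega> - t * ((B l ! j) \<omega> * dir l \<omega>)"
        by (cases l) (simp_all add: upd dir_def R_def A_def y_def)
    qed
    finally show "(\<integral>\<omega>. (R \<omega>)\<^sup>2 \<partial>M) \<le> (\<integral>\<omega>. (R \<omega> - t * ((B l ! j) \<omega> * dir l \<omega>))\<^sup>2 \<partial>M)" .
  qed
  show "is_proj M (B None) (\<lambda>\<omega>. real_cond_exp M F U \<omega> + h * V \<omega>) (lin_comb (a None) (B None))"
    unfolding is_proj_def y_def[symmetric]
  proof (intro conjI allI impI)
    show "\<exists>c. y = lin_comb c (B None)"
      by (auto simp: y_def)
    fix j assume j: "j < length (B None)"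
    note g = basis_nth[OF j]
    have "(\<integral>\<omega>. (B None ! j) \<omega> * N \<omega> \<partial>M) = 0"
      unfolding N_def by (rule noise_sum_orthogonal[OF g z])
    then have "(\<integral>\<omega>. N \<omega> * (B None ! j) \<omega> \<partial>M) = 0"
      by (simp only: mult.commute[of "N _"])
    moreover have "(\<integral>\<omega>. R \<omega> * (B None ! j) \<omega> \<partial>M) = 0"
      using normal[OF j] by (simp add: dir_def)
    ultimately have "(\<integral>\<omega>. U \<omega> * (B None ! j) \<omega> \<partial>M) + (\<integral>\<omega>. A \<omega> * (B None ! j) \<omega> \<partial>M) = 0"
      using R_split[OF g(2)] by simp
    then have "(\<integral>\<omega>. real_cond_exp M F U \<omega> * (B None ! j) \<omega> \<partial>M)
        + (\<integral>\<omega>. A \<omega> * (B None ! j) \<omega> \<partial>M) = 0"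
      by (simp add: cond_exp_inner[OF U g])
    moreover have "(\<integral>\<omega>. (real_cond_exp M F U \<omega> + h * V \<omega> - y \<omega>) * (B None ! j) \<omega> \<partial>M)
      = (\<integral>\<omega>. real_cond_exp M F U \<omega> * (B None ! j) \<omega> + A \<omega> * (B None ! j) \<omega> \<partial>M)"
      by (simp add: A_def algebra_simps)
    ultimately show "(\<integral>\<omega>. (real_cond_exp M F U \<omega> + h * V \<omega> - y \<omega>) * (B None ! j) \<omega> \<partial>M) = 0"
      using square_integrable_mult[OF A(2) g(2)]
        square_integrable_mult[OF square_integrable_cond_exp[OF U] g(2)] by simp
  qed
  show "is_proj M (B (Some l)) (noise_coeff U l) (lin_comb (a (Some l)) (B (Some l)))"
    unfolding is_proj_def z_def[symmetric]
  proof (intro conjI allI impI)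
    show "\<exists>c. z l = lin_comb c (B (Some l))"
      by (auto simp: z_def)
    fix j assume j: "j < length (B (Some l))"
    note g = basis_nth[OF j]
    let ?X = "\<lambda>\<omega>. (B (Some l) ! j) \<omega> * vec_nth (D \<omega>) l"
    have "(\<integral>\<omega>. R \<omega> * ?X \<omega> \<partial>M) = 0"
      using normal[OF j] by (simp add: dir_def)
    moreover have "(\<integral>\<omega>. A \<omega> * ?X \<omega> \<partial>M) = 0"
      by (rule noise_orthogonal[OF A g])
    moreover have "(\<integral>\<omega>. N \<omega> * ?X \<omega> \<partial>M) = h * (\<integral>\<omega>. z l \<omega> * (B (Some l) ! j) \<omega> \<partial>M)"
      unfolding N_def by (rule noise_sum_inner[OF g z])
    moreover have "(\<integral>\<omega>. U \<omega> * ?X \<omega> \<partial>M)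
      = h * (\<integral>\<omega>. noise_coeff U l \<omega> * (B (Some l) ! j) \<omega> \<partial>M)"
      by (rule noise_coeff_inner(1)[OF U g])
    ultimately have "(\<integral>\<omega>. noise_coeff U l \<omega> * (B (Some l) ! j) \<omega> \<partial>M)
        = (\<integral>\<omega>. z l \<omega> * (B (Some l) ! j) \<omega> \<partial>M)"
      using R_split[OF square_integrable_noise_mult[OF g, of l]] h_pos by simp
    then show "(\<integral>\<omega>. (noise_coeff U l \<omega> - z l \<omega>) * (B (Some l) ! j) \<omega> \<partial>M) = 0"
      using noise_coeff_inner(2)[OF U g] square_integrable_mult[OF z(2) g(2)]
      by (simp add: left_diff_distrib)
  qed
qed

definition picard_iterates ::
    "('a \<Rightarrow> real) \<Rightarrow> (nat \<Rightarrow> 'q option \<Rightarrow> real list) \<Rightarrow> bool" where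
  "picard_iterates U a \<longleftrightarrow> (\<forall>l. a 0 l = replicate (length (B l)) 0) \<and>
     (\<forall>i. is_arg_min
        (loss U (\<lambda>\<omega>. drv \<omega> (lin_comb (a i None) (B None) \<omega>) (basis_val (a i) \<omega>)))
        (\<lambda>a. \<forall>l. length (a l) = length (B l)) (a (Suc i)))"

text \<open>The weight in Young's inequality. A driver difference arrives with the factor
  \<open>(h^2 + h / \<gamma>) * (4 * K^2)\<close>, where the 4 comes from splitting into four
  squares and the bracket is at most \<open>2 * h / \<gamma>\<close>. Asking for at most
  \<open>h / 2\<close>, the half that the variance drop can spare, leads to
  \<open>16 * K^2 \<le> \<gamma>\<close>; the added 1 keeps \<gamma> positive when K = 0.\<close>

definition \<gamma> :: real where "\<gamma> = 16 * K\<^sup>2 + 1"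

text \<open>The last two facts move a term \<open>h / 2\<close> times the unknown from right to
  left: multiplication by \<open>1 + h\<close> undoes \<open>1 - h / 2\<close> and turns the growth
  factor \<open>1 + \<gamma> * h\<close> into \<open>1 + (\<gamma> + 2) * h\<close>.\<close>

lemma gamma: "\<gamma> \<ge> 1" "16 * K\<^sup>2 \<le> \<gamma>" "\<gamma> * h \<le> 1" "h\<^sup>2 + h / \<gamma> \<le> 2 * h / \<gamma>" "h\<^sup>2 + h / \<gamma> \<le> 2 * h"
  "(h\<^sup>2 + h / \<gamma>) * (4 * K\<^sup>2) \<le> h / 2" "(1 + h) * (1 + \<gamma> * h) \<le> 1 + (\<gamma> + 2) * h" "1 \<le> (1 + h) * (1 - h / 2)"
proof -
  show g: "\<gamma> \<ge> 1" "16 * K\<^sup>2 \<le> \<gamma>" "\<gamma> * h \<le> 1"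
    using h_small by (auto simp: \<gamma>_def)
  have "h * (\<gamma> * h) \<le> h * 1"
    using g h_pos by (intro mult_left_mono) auto
  then have "h\<^sup>2 \<le> h / \<gamma>"
    using g by (simp add: pos_le_divide_eq power2_eq_square mult_ac)
  then show 4: "h\<^sup>2 + h / \<gamma> \<le> 2 * h / \<gamma>"
    by (simp only: mult_2 add_divide_distrib add_mono order_refl)
  also have "2 * h / \<gamma> \<le> 2 * h"
    using g h_pos by (simp add: field_simps)
  finally show "h\<^sup>2 + h / \<gamma> \<le> 2 * h" .
  have "(h\<^sup>2 + h / \<gamma>) * (4 * K\<^sup>2) \<le> 2 * h / \<gamma> * (\<gamma> / 4)"
    using g h_pos 4 by (intro mult_mono) auto
  then show "(h\<^sup>2 + h / \<gamma>) * (4 * K\<^sup>2) \<le> h / 2"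
    using g by simp
  show "(1 + h) * (1 + \<gamma> * h) \<le> 1 + (\<gamma> + 2) * h"
    using \<open>h * (\<gamma> * h) \<le> h * 1\<close> by (simp add: algebra_simps)
  have "h * h \<le> h * 1"
    using h_pos h_small by (intro mult_left_mono) auto
  then show "1 \<le> (1 + h) * (1 - h / 2)"
    using h_pos by (simp add: algebra_simps)
qed

lemma driver_diff_square:
  "(drv \<omega> y z - drv \<omega> y' z')\<^sup>2 \<le> K\<^sup>2 * (\<bar>y - y'\<bar> + norm (z - z'))\<^sup>2"
  using driver_lipschitz[of \<omega> y z y' z'] K_nonneg
  by (simp add: power_mult_distrib[symmetric] abs_le_square_iff[symmetric])

lemma basis_val:
  "basis_val c \<in> borel_measurable F" "square_integrable M (\<lambda>\<omega>. vec_nth (basis_val c \<omega>) l)"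
  "square_integrable M (\<lambda>\<omega>. norm (basis_val c \<omega>))"
proof -
  show 1: "square_integrable M (\<lambda>\<omega>. vec_nth (basis_val c \<omega>) l)" for l
    by (simp add: basis_val_def basis_lin_comb)
  then show "square_integrable M (\<lambda>\<omega>. norm (basis_val c \<omega>))"
    by (rule square_integrable_norm)
  have [measurable]: "lin_comb (c (Some l)) (B (Some l)) \<in> borel_measurable F" for l
    by (rule basis_lin_comb)
  show "basis_val c \<in> borel_measurable F"
    unfolding basis_val_def by measurable
qed

lemma integral_norm_square:
  fixes z :: "'a \<Rightarrow> real ^ 'n"
  assumes "\<And>l. square_integrable M (\<lambda>\<omega>. vec_nth (z \<omega>) l)"
  shows "(\<integral>\<omega>. (norm (z \<omega>))\<^sup>2 \<partial>M) = (\<Sum>l\<in>UNIV. \<integral>\<omega>. (vec_nth (z \<omega>) l)\<^sup>2 \<partial>M)"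
  unfolding norm_power2_vec using assms
  by (intro Bochner_Integration.integral_sum square_integrable_power2)

section \<open>Moment bounds for the Picard iterates\<close>

context
  fixes U :: "'a \<Rightarrow> real" and a :: "nat \<Rightarrow> 'q option \<Rightarrow> real list"
  assumes U: "square_integrable M U" and iterates: "picard_iterates U a"
begin

abbreviation "y i \<equiv> lin_comb (a i None) (B None)"
abbreviation "z i \<equiv> basis_val (a i)"
abbreviation "V i \<equiv> (\<lambda>\<omega>. drv \<omega> (y i \<omega>) (z i \<omega>))"

lemma V: "V i \<in> borel_measurable F" "square_integrable M (V i)"
  using basis_lin_comb basis_val
  by (auto intro!: driver_measurable driver_square_integrable)

lemma iterate_zero: "y 0 \<omega> = 0" "z 0 \<omega> = 0"
  using iterates by (auto simp: picard_iterates_def lin_comb_def basis_val_def Finite_Cartesian_Product.vec_eq_iff)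

lemma iterate_is_proj:
  "is_proj M (B None) (\<lambda>\<omega>. real_cond_exp M F U \<omega> + h * V i \<omega>) (y (Suc i))"
  "is_proj M (B (Some l)) (noise_coeff U l) (\<lambda>\<omega>. vec_nth (z (Suc i) \<omega>) l)"
  using minimizer_is_proj[OF U V, of i "a (Suc i)"] iterates
  by (auto simp: picard_iterates_def basis_val_def)

lemma target_square_integrable: "square_integrable M (\<lambda>\<omega>. real_cond_exp M F U \<omega> + h * V i \<omega>)"
  by (intro square_integrable_add square_integrable_cmult V square_integrable_cond_exp U)

text \<open>The initial iterate is zero and every later z is a projection of the noise coefficients
  of U, so one bound serves all i.\<close>

lemma iterate_bessel:
  "h * (\<integral>\<omega>. (norm (z i \<omega>))\<^sup>2 \<partial>M) \<le> (\<integral>\<omega>. (U \<omega>)\<^sup>2 \<partial>M) - (\<integral>\<omega>. (real_cond_exp M F U \<omega>)\<^sup>2 \<partial>M)"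
proof -
  have "(\<Sum>l\<in>UNIV. \<integral>\<omega>. (vec_nth (z i \<omega>) l)\<^sup>2 \<partial>M) \<le> (\<Sum>l\<in>UNIV. \<integral>\<omega>. (noise_coeff U l \<omega>)\<^sup>2 \<partial>M)"
  proof (cases i)
    case 0
    then show ?thesis
      by (simp add: iterate_zero sum_nonneg)
  next
    case (Suc j)
    show ?thesis
      unfolding Suc using basis_square_integrable square_integrable_noise_coeff[OF U] iterate_is_proj(2)
      by (intro sum_mono is_proj_contraction) auto
  qed
  then have "h * (\<Sum>l\<in>UNIV. \<integral>\<omega>. (vec_nth (z i \<omega>) l)\<^sup>2 \<partial>M)
      \<le> h * (\<Sum>l\<in>UNIV. \<integral>\<omega>. (noise_coeff U l \<omega>)\<^sup>2 \<partial>M)"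
    using h_pos by simp
  with noise_bessel[OF U] show ?thesis
    by (simp add: integral_norm_square basis_val)
qed

text \<open>The projection contracts its target, and Young's inequality with weight \<gamma> puts
  the whole driver into terms of order h. The coefficient \<open>h / 2\<close> of the previous
  iterate lets the bound close under iteration.\<close>

lemma iterate_step:
  "(\<integral>\<omega>. (y (Suc i) \<omega>)\<^sup>2 \<partial>M) \<le> (1 + \<gamma> * h) * (\<integral>\<omega>. (real_cond_exp M F U \<omega>)\<^sup>2 \<partial>M)
     + 6 * h * (\<integral>\<omega>. (drv \<omega> 0 0)\<^sup>2 \<partial>M)
     + h / 2 * ((\<integral>\<omega>. (y i \<omega>)\<^sup>2 \<partial>M) + (\<integral>\<omega>. (norm (z i \<omega>))\<^sup>2 \<partial>M))"
proof -
  let ?E = "real_cond_exp M F U"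
  let ?\<kappa> = "h\<^sup>2 + h / \<gamma>"
  have \<kappa>: "0 \<le> ?\<kappa>"
    using h_pos gamma by simp
  have int: "integrable M (\<lambda>\<omega>. (?E \<omega>)\<^sup>2)" "integrable M (\<lambda>\<omega>. (drv \<omega> 0 0)\<^sup>2)"
    "integrable M (\<lambda>\<omega>. (y i \<omega>)\<^sup>2)" "integrable M (\<lambda>\<omega>. (norm (z i \<omega>))\<^sup>2)"
    using square_integrable_cond_exp[OF U] driver_zero basis_lin_comb(2) basis_val(3)
    by (auto intro!: square_integrable_power2)
  have pointwise: "(?E \<omega> + h * V i \<omega>)\<^sup>2 \<le> (1 + \<gamma> * h) * (?E \<omega>)\<^sup>2
      + 3 * ?\<kappa> * (drv \<omega> 0 0)\<^sup>2 + 3 * K\<^sup>2 * ?\<kappa> * ((y i \<omega>)\<^sup>2 + (norm (z i \<omega>))\<^sup>2)" for \<omega>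
  proof -
    have "\<bar>V i \<omega>\<bar> \<le> \<bar>drv \<omega> 0 0\<bar> + K * \<bar>y i \<omega>\<bar> + K * norm (z i \<omega>)"
      using driver_lipschitz[of \<omega> "y i \<omega>" "z i \<omega>" 0 0] by (simp add: algebra_simps)
    then have "(V i \<omega>)\<^sup>2 \<le> (\<bar>drv \<omega> 0 0\<bar> + K * \<bar>y i \<omega>\<bar> + K * norm (z i \<omega>))\<^sup>2"
      using K_nonneg by (simp add: abs_le_square_iff[symmetric])
    also have "\<dots> \<le> 3 * ((drv \<omega> 0 0)\<^sup>2 + K\<^sup>2 * (y i \<omega>)\<^sup>2 + K\<^sup>2 * (norm (z i \<omega>))\<^sup>2)"
      using power2_sum3_le[of "\<bar>drv \<omega> 0 0\<bar>" "K * \<bar>y i \<omega>\<bar>" "K * norm (z i \<omega>)"]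
      by (simp add: power_mult_distrib)
    finally have "?\<kappa> * (V i \<omega>)\<^sup>2
        \<le> ?\<kappa> * (3 * ((drv \<omega> 0 0)\<^sup>2 + K\<^sup>2 * (y i \<omega>)\<^sup>2 + K\<^sup>2 * (norm (z i \<omega>))\<^sup>2))"
      using \<kappa> by (rule mult_left_mono)
    with power2_add_mult_le[of \<gamma> h "?E \<omega>" "V i \<omega>"] show ?thesis
      using gamma h_pos by (simp add: algebra_simps)
  qed
  have "(\<integral>\<omega>. (y (Suc i) \<omega>)\<^sup>2 \<partial>M) \<le> (\<integral>\<omega>. (?E \<omega> + h * V i \<omega>)\<^sup>2 \<partial>M)"
    using basis_square_integrable target_square_integrable iterate_is_proj(1)
    by (rule is_proj_contraction)
  also have "\<dots> \<le> (\<integral>\<omega>. (1 + \<gamma> * h) * (?E \<omega>)\<^sup>2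
      + 3 * ?\<kappa> * (drv \<omega> 0 0)\<^sup>2 + 3 * K\<^sup>2 * ?\<kappa> * ((y i \<omega>)\<^sup>2 + (norm (z i \<omega>))\<^sup>2) \<partial>M)"
    using int square_integrable_power2[OF target_square_integrable] pointwise
    by (intro integral_mono) auto
  also have "\<dots> = (1 + \<gamma> * h) * (\<integral>\<omega>. (?E \<omega>)\<^sup>2 \<partial>M) + 3 * ?\<kappa> * (\<integral>\<omega>. (drv \<omega> 0 0)\<^sup>2 \<partial>M)
      + 3 * K\<^sup>2 * ?\<kappa> * ((\<integral>\<omega>. (y i \<omega>)\<^sup>2 \<partial>M) + (\<integral>\<omega>. (norm (z i \<omega>))\<^sup>2 \<partial>M))"
    using int by simp
  also have "\<dots> \<le> (1 + \<gamma> * h) * (\<integral>\<omega>. (?E \<omega>)\<^sup>2 \<partial>M) + 6 * h * (\<integral>\<omega>. (drv \<omega> 0 0)\<^sup>2 \<partial>M)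
      + h / 2 * ((\<integral>\<omega>. (y i \<omega>)\<^sup>2 \<partial>M) + (\<integral>\<omega>. (norm (z i \<omega>))\<^sup>2 \<partial>M))"
  proof (intro add_mono mult_right_mono order_refl add_nonneg_nonneg)
    show "3 * ?\<kappa> \<le> 6 * h"
      using gamma(5) by simp
    \<comment> \<open>Only three squares occur here, so the bound prepared for four
      suffices.\<close>
    have "3 * K\<^sup>2 * ?\<kappa> \<le> ?\<kappa> * (4 * K\<^sup>2)"
      using \<kappa> by (simp add: mult.commute mult_left_mono)
    then show "3 * K\<^sup>2 * ?\<kappa> \<le> h / 2"
      using gamma(6) by linarith
  qed (use h_pos in auto)
  finally show ?thesis .
qed

text \<open>The indices i and j are unrelated: y stays bounded along the iteration, and z obeys the
  Bessel bound at every index. The last y can thus be paired with the first z, which governs the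
  Picard defect.\<close>

lemma iterate_apriori:
  "(\<integral>\<omega>. (y i \<omega>)\<^sup>2 \<partial>M) + h / 2 * (\<integral>\<omega>. (norm (z j \<omega>))\<^sup>2 \<partial>M)
    \<le> (1 + (\<gamma> + 2) * h) * (\<integral>\<omega>. (U \<omega>)\<^sup>2 \<partial>M) + 12 * h * (\<integral>\<omega>. (drv \<omega> 0 0)\<^sup>2 \<partial>M)"
proof -
  define A where "A = (\<integral>\<omega>. (real_cond_exp M F U \<omega>)\<^sup>2 \<partial>M)"
  define c where "c = (\<integral>\<omega>. (U \<omega>)\<^sup>2 \<partial>M)"
  define f where "f = (\<integral>\<omega>. (drv \<omega> 0 0)\<^sup>2 \<partial>M)"
  have nonneg: "A \<ge> 0" "c \<ge> 0" "f \<ge> 0"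
    by (simp_all add: A_def c_def f_def)
  have z: "h * (\<integral>\<omega>. (norm (z i \<omega>))\<^sup>2 \<partial>M) \<le> c - A" for i
    using iterate_bessel by (simp add: A_def c_def)
  have "0 \<le> h * (\<integral>\<omega>. (norm (z 0 \<omega>))\<^sup>2 \<partial>M)"
    using h_pos by simp
  then have cA: "A \<le> c"
    using z[of 0] by linarith
  \<comment> \<open>The right-hand side of \<open>iterate_step\<close> without its y-term, half of
    the variance drop \<open>c - A\<close> being spent on z.\<close>
  define G where "G = (1 + \<gamma> * h) * A + 6 * h * f + (c - A) / 2"
  have G: "G \<ge> 0"
    using nonneg cA gamma h_pos by (simp add: G_def)
  \<comment> \<open>The bound \<open>(1 + h) * G\<close> reproduces itself because
    \<open>(1 + h) / 2 \<le> 1\<close>.\<close>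
  have y: "(\<integral>\<omega>. (y i \<omega>)\<^sup>2 \<partial>M) \<le> (1 + h) * G" for i
  proof (induction i)
    case 0
    then show ?case
      using G h_pos by (simp add: iterate_zero)
  next
    case (Suc i)
    have "(\<integral>\<omega>. (y (Suc i) \<omega>)\<^sup>2 \<partial>M) \<le> G + h / 2 * (\<integral>\<omega>. (y i \<omega>)\<^sup>2 \<partial>M)"
      using iterate_step[of i] z[of i] by (simp add: G_def A_def f_def algebra_simps diff_divide_distrib)
    also have "\<dots> \<le> G + h / 2 * ((1 + h) * G)"
      using Suc.IH h_pos by simp
    also have "\<dots> \<le> G + h * G"
    proof -
      have "h / 2 * ((1 + h) * G) \<le> h / 2 * (2 * G)"
        using h_small h_pos G by (intro mult_left_mono mult_right_mono) auto
      then show ?thesis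
        by simp
    qed
    finally show ?case
      by (simp add: algebra_simps)
  qed
  have "(\<integral>\<omega>. (y i \<omega>)\<^sup>2 \<partial>M) + h / 2 * (\<integral>\<omega>. (norm (z j \<omega>))\<^sup>2 \<partial>M) \<le> (1 + h) * G + (c - A) / 2"
    using y[of i] z[of j] by (intro add_mono) auto
  also have "\<dots> \<le> (1 + h) * G + (1 + h) * ((c - A) / 2)"
    using mult_right_mono[of 1 "1 + h" "(c - A) / 2"] cA h_pos by simp
  \<comment> \<open>The two halves of \<open>c - A\<close> turn the A contained in G into c; only
    \<open>\<gamma> * h * A\<close> remains of it.\<close>
  also have "\<dots> = (1 + h) * (c + \<gamma> * h * A + 6 * h * f)"
    by (simp add: G_def algebra_simps add_divide_distrib diff_divide_distrib)
  also have "\<dots> \<le> (1 + h) * ((1 + \<gamma> * h) * c + 6 * h * f)"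
  proof -
    have "\<gamma> * h * A \<le> \<gamma> * h * c"
      using cA gamma h_pos by (intro mult_left_mono) auto
    then show ?thesis
      using h_pos by (intro mult_left_mono) (auto simp: algebra_simps)
  qed
  also have "\<dots> \<le> (1 + (\<gamma> + 2) * h) * c + 12 * h * f"
  proof -
    have "(1 + h) * (1 + \<gamma> * h) * c \<le> (1 + (\<gamma> + 2) * h) * c"
      using gamma(7) nonneg by (intro mult_right_mono) auto
    moreover have "(1 + h) * (6 * h * f) \<le> 2 * (6 * h * f)"
      using h_small h_pos nonneg by (intro mult_right_mono) auto
    ultimately show ?thesis
      by (simp add: algebra_simps)
  qed
  finally show ?thesis
    by (simp add: c_def f_def)
qed

section \<open>Picard defect and error of one step\<close>

definition increment :: "nat \<Rightarrow> real" where
  "increment i = (\<integral>\<omega>. (y (Suc i) \<omega> - y i \<omega>)\<^sup>2 \<partial>M) + (\<integral>\<omega>. (norm (z (Suc i) \<omega> - z i \<omega>))\<^sup>2 \<partial>M)"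

text \<open>Consecutive targets of y differ by \<open>h * (V (Suc i) - V i)\<close>, whence the
  factor \<open>h^2 * K^2\<close>. From the first iteration on z is constant, as a projection of one
  and the same coefficient, so on the left its increment vanishes; on the right it can be nonzero
  only for i = 0.\<close>

lemma increment_Suc: "increment (Suc i) \<le> 2 * h\<^sup>2 * K\<^sup>2 * increment i"
proof -
  have Zd: "square_integrable M (\<lambda>\<omega>. vec_nth (z i \<omega> - z j \<omega>) l)" for i j l
    using basis_val(2) by auto
  have yd: "square_integrable M (\<lambda>\<omega>. y i \<omega> - y j \<omega>)" for i j
    using basis_lin_comb(2) by auto
  have "(\<integral>\<omega>. (norm (z (Suc (Suc i)) \<omega> - z (Suc i) \<omega>))\<^sup>2 \<partial>M) \<le> 0"
  proof -
    have "(\<integral>\<omega>. (vec_nth (z (Suc (Suc i)) \<omega>) l - vec_nth (z (Suc i) \<omega>) l)\<^sup>2 \<partial>M)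
      \<le> (\<integral>\<omega>. (noise_coeff U l \<omega> - noise_coeff U l \<omega>)\<^sup>2 \<partial>M)" for l
      using basis_square_integrable square_integrable_noise_coeff[OF U] iterate_is_proj(2)
      by (intro is_proj_contraction[where \<phi> = "B (Some l)"] is_proj_diff) auto
    then show ?thesis
      using Zd by (simp add: integral_norm_square sum_nonpos)
  qed
  moreover have "(\<integral>\<omega>. (y (Suc (Suc i)) \<omega> - y (Suc i) \<omega>)\<^sup>2 \<partial>M) \<le> 2 * h\<^sup>2 * K\<^sup>2 * increment i"
  proof -
    let ?E = "real_cond_exp M F U"
    let ?R = "\<lambda>\<omega>. 2 * h\<^sup>2 * K\<^sup>2 * ((y (Suc i) \<omega> - y i \<omega>)\<^sup>2 + (norm (z (Suc i) \<omega> - z i \<omega>))\<^sup>2)"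
    have int: "integrable M (\<lambda>\<omega>. (y (Suc i) \<omega> - y i \<omega>)\<^sup>2)"
      "integrable M (\<lambda>\<omega>. (norm (z (Suc i) \<omega> - z i \<omega>))\<^sup>2)"
      using yd square_integrable_norm[OF Zd] by (auto intro!: square_integrable_power2)
    have diff: "square_integrable M (\<lambda>\<omega>. ?E \<omega> + h * V (Suc i) \<omega> - (?E \<omega> + h * V i \<omega>))"
      using target_square_integrable target_square_integrable by (rule square_integrable_diff)
    have "(\<integral>\<omega>. (y (Suc (Suc i)) \<omega> - y (Suc i) \<omega>)\<^sup>2 \<partial>M)
      \<le> (\<integral>\<omega>. (?E \<omega> + h * V (Suc i) \<omega> - (?E \<omega> + h * V i \<omega>))\<^sup>2 \<partial>M)"
      using basis_square_integrable diff target_square_integrable iterate_is_proj(1)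
      by (intro is_proj_contraction[where \<phi> = "B None"] is_proj_diff) auto
    also have "\<dots> \<le> (\<integral>\<omega>. ?R \<omega> \<partial>M)"
    proof (rule integral_mono)
      show "(?E \<omega> + h * V (Suc i) \<omega> - (?E \<omega> + h * V i \<omega>))\<^sup>2 \<le> ?R \<omega>" for \<omega>
      proof -
        have "(V (Suc i) \<omega> - V i \<omega>)\<^sup>2
            \<le> K\<^sup>2 * (\<bar>y (Suc i) \<omega> - y i \<omega>\<bar> + norm (z (Suc i) \<omega> - z i \<omega>))\<^sup>2"
          by (rule driver_diff_square)
        also have "\<dots> \<le> K\<^sup>2 * (2 * ((y (Suc i) \<omega> - y i \<omega>)\<^sup>2 + (norm (z (Suc i) \<omega> - z i \<omega>))\<^sup>2))"
          using sum_squares_bound[of "\<bar>y (Suc i) \<omega> - y i \<omega>\<bar>" "norm (z (Suc i) \<omega> - z i \<omega>)"]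
          by (intro mult_left_mono) (auto simp: power2_sum)
        finally have "h\<^sup>2 * (V (Suc i) \<omega> - V i \<omega>)\<^sup>2 \<le> h\<^sup>2 * (K\<^sup>2 * (2 * ((y (Suc i) \<omega> - y i \<omega>)\<^sup>2
            + (norm (z (Suc i) \<omega> - z i \<omega>))\<^sup>2)))"
          by (rule mult_left_mono) simp
        moreover have "(?E \<omega> + h * V (Suc i) \<omega> - (?E \<omega> + h * V i \<omega>))\<^sup>2
            = h\<^sup>2 * (V (Suc i) \<omega> - V i \<omega>)\<^sup>2"
          by (simp add: power_mult_distrib flip: right_diff_distrib)
        moreover have "u * (v * (2 * w)) = 2 * u * v * w" for u v w :: real
          by simp
        ultimately show ?thesis
          by (simp only:)
      qed
    qed (use int diff in \<open>auto intro: square_integrable_power2\<close>)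
    also have "\<dots> = 2 * h\<^sup>2 * K\<^sup>2 * increment i"
      using int by (simp add: increment_def)
    finally show ?thesis .
  qed
  ultimately show ?thesis
    by (simp add: increment_def)
qed

lemma increment_nonneg: "0 \<le> increment i"
  by (simp add: increment_def)

text \<open>As the iteration starts from zero, the initial increment is the second moment of the
  first iterate. The factor h is kept because it is \<open>h * E|z_1|^2\<close> that the Bessel
  inequality controls.\<close>

lemma increment_bound:
  "h * increment i \<le> (2 * h\<^sup>2 * K\<^sup>2) ^ i
     * (h * (\<integral>\<omega>. (y 1 \<omega>)\<^sup>2 \<partial>M) + h * (\<integral>\<omega>. (norm (z 1 \<omega>))\<^sup>2 \<partial>M))"
proof -
  have "increment i \<le> (2 * h\<^sup>2 * K\<^sup>2) ^ i * increment 0"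
  proof (induction i)
    case (Suc i)
    have "increment (Suc i) \<le> 2 * h\<^sup>2 * K\<^sup>2 * increment i"
      by (rule increment_Suc)
    also have "\<dots> \<le> 2 * h\<^sup>2 * K\<^sup>2 * ((2 * h\<^sup>2 * K\<^sup>2) ^ i * increment 0)"
      using Suc.IH by (intro mult_left_mono) auto
    finally show ?case
      by (simp add: mult_ac)
  qed simp
  then have "h * increment i \<le> h * ((2 * h\<^sup>2 * K\<^sup>2) ^ i * increment 0)"
    using h_pos by simp
  then show ?thesis
    by (simp add: increment_def iterate_zero algebra_simps)
qed

text \<open>Here \<open>Y\<close> and \<open>Y'\<close> are the backward scheme at this date and at
  the next, and U is the projected value at the next date. The driver at iterate i is compared with
  the driver at \<open>Y\<close>, \<open>Z\<close> by way of iterate \<open>Suc i\<close>: this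
  gives the error being estimated, with a small factor, plus the increment.\<close>

lemma iterate_error:
  assumes Y': "square_integrable M Y'" and Y: "Y \<in> borel_measurable F" "square_integrable M Y"
    and Z: "Z = (\<lambda>\<omega>. \<chi> l. noise_coeff Y' l \<omega>)"
    and eq: "AE \<omega> in M. Y \<omega> = real_cond_exp M F Y' \<omega> + h * drv \<omega> (Y \<omega>) (Z \<omega>)"
    and gram: "\<And>l. invertible_mat (gram_matrix M (B l))"
  shows "(\<integral>\<omega>. (y (Suc i) \<omega> - Y \<omega>)\<^sup>2 \<partial>M) + h / 2 * (\<integral>\<omega>. (norm (z (Suc i) \<omega> - Z \<omega>))\<^sup>2 \<partial>M)
    \<le> (1 + (\<gamma> + 2) * h) * (\<integral>\<omega>. (U \<omega> - Y' \<omega>)\<^sup>2 \<partial>M)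
      + (2 * (\<integral>\<omega>. (L2_resid M (B None) Y \<omega>)\<^sup>2 \<partial>M)
        + 2 * h * (\<Sum>l\<in>UNIV. \<integral>\<omega>. (L2_resid M (B (Some l)) (\<lambda>\<omega>. vec_nth (Z \<omega>) l) \<omega>)\<^sup>2 \<partial>M)
        + h * increment i)"
proof -
  define \<Delta> where "\<Delta> \<omega> = U \<omega> - Y' \<omega>" for \<omega>
  have \<Delta>: "square_integrable M \<Delta>"
    unfolding \<Delta>_def using U Y' by auto
  define c where "c = (\<integral>\<omega>. (\<Delta> \<omega>)\<^sup>2 \<partial>M)"
  define A where "A = (\<integral>\<omega>. (real_cond_exp M F \<Delta> \<omega>)\<^sup>2 \<partial>M)"
  define r0 where "r0 = (\<integral>\<omega>. (L2_resid M (B None) Y \<omega>)\<^sup>2 \<partial>M)"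
  define r where "r = (\<Sum>l\<in>UNIV. \<integral>\<omega>. (L2_resid M (B (Some l)) (\<lambda>\<omega>. vec_nth (Z \<omega>) l) \<omega>)\<^sup>2 \<partial>M)"
  define dy where "dy = (\<integral>\<omega>. (y (Suc i) \<omega> - Y \<omega>)\<^sup>2 \<partial>M)"
  define dz where "dz = (\<integral>\<omega>. (norm (z (Suc i) \<omega> - Z \<omega>))\<^sup>2 \<partial>M)"
  have nonneg: "c \<ge> 0" "A \<ge> 0" "r0 \<ge> 0" "r \<ge> 0" "dy \<ge> 0" "dz \<ge> 0"
    by (simp_all add: c_def A_def r0_def r_def dy_def dz_def sum_nonneg)
  have Z_sq: "square_integrable M (\<lambda>\<omega>. vec_nth (Z \<omega>) l)" for l
    using square_integrable_noise_coeff[OF Y'] by (simp add: Z)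
  have Z_F: "Z \<in> borel_measurable F"
    unfolding Z by measurable
  have bessel: "h * (\<Sum>l\<in>UNIV. \<integral>\<omega>. (noise_coeff \<Delta> l \<omega>)\<^sup>2 \<partial>M) \<le> c - A"
    using noise_bessel[OF \<Delta>] by (simp add: c_def A_def)
  have "0 \<le> h * (\<Sum>l\<in>UNIV. \<integral>\<omega>. (noise_coeff \<Delta> l \<omega>)\<^sup>2 \<partial>M)"
    using h_pos by (simp add: sum_nonneg)
  with bessel have cA: "A \<le> c"
    by linarith
  have zd: "square_integrable M (\<lambda>\<omega>. vec_nth (z i \<omega> - Z \<omega>) l)" for i l
    using basis_val(2) Z_sq by auto
  \<comment> \<open>Projection error, then Bessel for \<Delta>, since the two noise coefficients
    differ by the coefficient of \<Delta>.\<close>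
  have dz_le: "h * dz \<le> c - A + h * r"
  proof -
    have "dz = (\<Sum>l\<in>UNIV. \<integral>\<omega>. (vec_nth (z (Suc i) \<omega>) l - vec_nth (Z \<omega>) l)\<^sup>2 \<partial>M)"
      unfolding dz_def using integral_norm_square[OF zd] by simp
    also have "\<dots> \<le> (\<Sum>l\<in>UNIV. (\<integral>\<omega>. (noise_coeff U l \<omega> - vec_nth (Z \<omega>) l)\<^sup>2 \<partial>M)
        + (\<integral>\<omega>. (L2_resid M (B (Some l)) (\<lambda>\<omega>. vec_nth (Z \<omega>) l) \<omega>)\<^sup>2 \<partial>M))"
      using basis_square_integrable square_integrable_noise_coeff[OF U] Z_sq gram iterate_is_proj(2)
      by (intro sum_mono is_proj_error) auto
    also have "\<dots> = (\<Sum>l\<in>UNIV. \<integral>\<omega>. (noise_coeff U l \<omega> - vec_nth (Z \<omega>) l)\<^sup>2 \<partial>M) + r"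
      by (simp add: sum.distrib r_def)
    also have "(\<Sum>l\<in>UNIV. \<integral>\<omega>. (noise_coeff U l \<omega> - vec_nth (Z \<omega>) l)\<^sup>2 \<partial>M)
        = (\<Sum>l\<in>UNIV. \<integral>\<omega>. (noise_coeff \<Delta> l \<omega>)\<^sup>2 \<partial>M)"
    proof (rule sum.cong[OF refl], rule integral_cong_AE)
      fix l
      show "AE \<omega> in M. (noise_coeff U l \<omega> - vec_nth (Z \<omega>) l)\<^sup>2 = (noise_coeff \<Delta> l \<omega>)\<^sup>2"
        using noise_coeff_diff[OF U Y'] by eventually_elim (simp add: Z \<Delta>_def[abs_def])
      have [measurable]: "noise_coeff X l \<in> borel_measurable M" for X
        by (rule measurable_F) simp
      show "(\<lambda>\<omega>. (noise_coeff U l \<omega> - vec_nth (Z \<omega>) l)\<^sup>2) \<in> borel_measurable M"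
        "(\<lambda>\<omega>. (noise_coeff \<Delta> l \<omega>)\<^sup>2) \<in> borel_measurable M"
        by (simp_all add: Z)
    qed
    finally have "h * dz \<le> h * ((\<Sum>l\<in>UNIV. \<integral>\<omega>. (noise_coeff \<Delta> l \<omega>)\<^sup>2 \<partial>M) + r)"
      using h_pos by simp
    with bessel show ?thesis
      by (simp add: distrib_left)
  qed
  have dy_le: "dy \<le> r0 + (1 + \<gamma> * h) * A + h / 2 * (dy + dz + increment i)"
  proof -
    let ?\<kappa> = "h\<^sup>2 + h / \<gamma>"
    let ?f = "\<lambda>\<omega>. drv \<omega> (Y \<omega>) (Z \<omega>)"
    let ?S = "\<lambda>\<omega>. (y (Suc i) \<omega> - Y \<omega>)\<^sup>2 + (norm (z (Suc i) \<omega> - Z \<omega>))\<^sup>2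
      + ((y (Suc i) \<omega> - y i \<omega>)\<^sup>2 + (norm (z (Suc i) \<omega> - z i \<omega>))\<^sup>2)"
    let ?W = "\<lambda>\<omega>. real_cond_exp M F U \<omega> + h * V i \<omega> - Y \<omega>"
    have \<kappa>: "0 \<le> ?\<kappa>"
      using h_pos gamma by simp
    have zz: "square_integrable M (\<lambda>\<omega>. vec_nth (z (Suc i) \<omega> - z i \<omega>) l)" for l
      using basis_val(2) by auto
    have int: "integrable M (\<lambda>\<omega>. (y (Suc i) \<omega> - Y \<omega>)\<^sup>2)" "integrable M (\<lambda>\<omega>. (norm (z (Suc i) \<omega> - Z \<omega>))\<^sup>2)"
      "integrable M (\<lambda>\<omega>. (y (Suc i) \<omega> - y i \<omega>)\<^sup>2)" "integrable M (\<lambda>\<omega>. (norm (z (Suc i) \<omega> - z i \<omega>))\<^sup>2)"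
      "integrable M (\<lambda>\<omega>. (real_cond_exp M F \<Delta> \<omega>)\<^sup>2)" "integrable M (\<lambda>\<omega>. (?W \<omega>)\<^sup>2)"
      using square_integrable_norm[OF zd] square_integrable_norm[OF zz] basis_lin_comb(2) Y(2)
        square_integrable_cond_exp[OF \<Delta>] target_square_integrable
      by (auto intro!: square_integrable_power2)
    \<comment> \<open>The detour through the new iterate produces four distances, hence the
      \<open>4 * K^2\<close> against which \<gamma> was chosen.\<close>
    have pointwise: "?\<kappa> * (V i \<omega> - ?f \<omega>)\<^sup>2 \<le> h / 2 * ?S \<omega>" for \<omega>
    proof -
      have "\<bar>y i \<omega> - Y \<omega>\<bar> + norm (z i \<omega> - Z \<omega>)
          \<le> \<bar>y (Suc i) \<omega> - Y \<omega>\<bar> + norm (z (Suc i) \<omega> - Z \<omega>)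
            + \<bar>y (Suc i) \<omega> - y i \<omega>\<bar> + norm (z (Suc i) \<omega> - z i \<omega>)"
        using norm_triangle_ineq4[of "z (Suc i) \<omega> - Z \<omega>" "z (Suc i) \<omega> - z i \<omega>"] by simp
      then have "(\<bar>y i \<omega> - Y \<omega>\<bar> + norm (z i \<omega> - Z \<omega>))\<^sup>2
          \<le> (\<bar>y (Suc i) \<omega> - Y \<omega>\<bar> + norm (z (Suc i) \<omega> - Z \<omega>)
            + \<bar>y (Suc i) \<omega> - y i \<omega>\<bar> + norm (z (Suc i) \<omega> - z i \<omega>))\<^sup>2"
        by (intro power_mono) auto
      also have "\<dots> \<le> 4 * ?S \<omega>"
        using power2_sum4_le[of "\<bar>y (Suc i) \<omega> - Y \<omega>\<bar>" "norm (z (Suc i) \<omega> - Z \<omega>)"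
            "\<bar>y (Suc i) \<omega> - y i \<omega>\<bar>" "norm (z (Suc i) \<omega> - z i \<omega>)"] by (simp add: add_ac)
      finally have "K\<^sup>2 * (\<bar>y i \<omega> - Y \<omega>\<bar> + norm (z i \<omega> - Z \<omega>))\<^sup>2 \<le> K\<^sup>2 * (4 * ?S \<omega>)"
        by (rule mult_left_mono) simp
      with driver_diff_square[of \<omega> "y i \<omega>" "z i \<omega>" "Y \<omega>" "Z \<omega>"]
      have "(V i \<omega> - ?f \<omega>)\<^sup>2 \<le> K\<^sup>2 * (4 * ?S \<omega>)"
        by linarith
      then have "?\<kappa> * (V i \<omega> - ?f \<omega>)\<^sup>2 \<le> ?\<kappa> * (K\<^sup>2 * (4 * ?S \<omega>))"
        using \<kappa> by (rule mult_left_mono)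
      also have "\<dots> = ?\<kappa> * (4 * K\<^sup>2) * ?S \<omega>"
        by (simp add: mult_ac)
      also have "\<dots> \<le> h / 2 * ?S \<omega>"
        using gamma(6) by (intro mult_right_mono) auto
      finally show ?thesis .
    qed
    have "dy \<le> (\<integral>\<omega>. (?W \<omega>)\<^sup>2 \<partial>M) + r0"
      unfolding dy_def r0_def
      using basis_square_integrable target_square_integrable Y(2) gram iterate_is_proj(1)
      by (rule is_proj_error)
    also have "(\<integral>\<omega>. (?W \<omega>)\<^sup>2 \<partial>M)
        \<le> (\<integral>\<omega>. (1 + \<gamma> * h) * (real_cond_exp M F \<Delta> \<omega>)\<^sup>2 + h / 2 * ?S \<omega> \<partial>M)"
    proof (rule integral_mono_AE)
      have "AE \<omega> in M. real_cond_exp M F \<Delta> \<omega> = real_cond_exp M F U \<omega> - real_cond_exp M F Y' \<omega>"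
        unfolding \<Delta>_def using U Y' by (intro real_cond_exp_diff square_integrable_integrable)
      with eq show "AE \<omega> in M. (?W \<omega>)\<^sup>2 \<le> (1 + \<gamma> * h) * (real_cond_exp M F \<Delta> \<omega>)\<^sup>2 + h / 2 * ?S \<omega>"
      proof eventually_elim
        case (elim \<omega>)
        \<comment> \<open>The equation of the backward scheme turns target minus Y into the
          conditional expectation of \<Delta> plus h times a driver difference, ready for Young's
          inequality.\<close>
        have "?W \<omega> = real_cond_exp M F \<Delta> \<omega> + h * (V i \<omega> - ?f \<omega>)"
          unfolding elim(2) right_diff_distrib using elim(1) by linarith
        then have "(?W \<omega>)\<^sup>2 \<le> (1 + \<gamma> * h) * (real_cond_exp M F \<Delta> \<omega>)\<^sup>2
            + ?\<kappa> * (V i \<omega> - ?f \<omega>)\<^sup>2"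
          using power2_add_mult_le[of \<gamma> h "real_cond_exp M F \<Delta> \<omega>" "V i \<omega> - ?f \<omega>"]
            gamma(1) h_pos by simp
        then show ?case
          using pointwise[of \<omega>] by linarith
      qed
    qed (use int in auto)
    also have "\<dots> = (1 + \<gamma> * h) * A + h / 2 * (dy + dz + increment i)"
      using int by (simp add: A_def dy_def dz_def increment_def)
    finally show ?thesis
      by simp
  qed
  define R where "R = r0 + h * r + h / 2 * increment i"
  have R: "R \<ge> 0"
    using nonneg h_pos increment_nonneg[of i] by (simp add: R_def)
  \<comment> \<open>The term \<open>h / 2 * dy\<close> on the right of \<open>dy_le\<close> becomes
    \<open>1 - h / 2\<close> on the left, at the price of an overall factor
    \<open>1 + h\<close>.\<close>
  have "dy + h / 2 * dz \<le> (1 + h) * (1 - h / 2) * dy + (1 + h) * (h / 2 * dz)"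
  proof (rule add_mono)
    show "dy \<le> (1 + h) * (1 - h / 2) * dy"
      using mult_right_mono[OF gamma(8) nonneg(5)] by simp
    show "h / 2 * dz \<le> (1 + h) * (h / 2 * dz)"
      using h_pos nonneg by (simp add: algebra_simps)
  qed
  also have "\<dots> = (1 + h) * (dy - h / 2 * dy + h / 2 * dz)"
    by (simp add: algebra_simps)
  also have "\<dots> \<le> (1 + h) * ((1 + \<gamma> * h) * c + R)"
  proof (rule mult_left_mono)
    have "\<gamma> * h * A \<le> \<gamma> * h * c"
      using cA gamma h_pos by (intro mult_left_mono) auto
    \<comment> \<open>One half of \<open>h * dz\<close> comes from \<open>dy_le\<close>, the other
      is the one kept on the left. Together they use \<open>dz_le\<close> exactly once, and its
      \<open>c - A\<close> turns A into c.\<close>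
    with dy_le dz_le show "dy - h / 2 * dy + h / 2 * dz \<le> (1 + \<gamma> * h) * c + R"
      by (simp add: R_def algebra_simps)
  qed (use h_pos in simp)
  also have "\<dots> = (1 + h) * (1 + \<gamma> * h) * c + (1 + h) * R"
    by (simp add: algebra_simps)
  also have "\<dots> \<le> (1 + (\<gamma> + 2) * h) * c + 2 * R"
    using gamma(7) nonneg R h_small by (intro add_mono mult_right_mono) auto
  finally show ?thesis
    by (simp add: dy_def dz_def c_def \<Delta>_def R_def r0_def r_def)
qed

end

end

section \<open>Brownian increments\<close>

lemma (in prob_space) indep_set_mono:
  "indep_set A B \<Longrightarrow> A' \<subseteq> A \<Longrightarrow> B' \<subseteq> B \<Longrightarrow> indep_set A' B'"
  by (rule indep_setI) (blast dest: indep_setD_ev1 indep_setD_ev2 indep_setD)+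

locale brownian =
  fixes M :: "'a measure" and T :: real and W :: "real \<Rightarrow> 'a \<Rightarrow> real ^ 'q"
  assumes bm: "brownian_motion M T W"
begin

sublocale prob_space M
  using bm by (simp add: brownian_motion_def)

section \<open>The augmented filtration\<close>

lemma W_measurable: "s \<in> {0..T} \<Longrightarrow> W s \<in> borel_measurable M"
  using bm by (simp add: brownian_motion_def)

lemma generators_subset:
  "{W s -` A \<inter> space M | s A. s \<in> {0..t} \<and> A \<in> sets borel} \<union> null_sets M \<subseteq> Pow (space M)"
  using sets.sets_into_space by fastforce

lemma sets_filtration:
  "sets (augmented_filtration M W t) = sigma_sets (space M)
    ({W s -` A \<inter> space M | s A. s \<in> {0..t} \<and> A \<in> sets borel} \<union> null_sets M)"
  unfolding augmented_filtration_def by (rule sets_measure_of[OF generators_subset])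

lemma space_filtration [simp]: "space (augmented_filtration M W t) = space M"
  unfolding augmented_filtration_def by (rule space_measure_of[OF generators_subset])

lemma subalgebra_filtration:
  assumes "t \<le> T"
  shows "subalgebra M (augmented_filtration M W t)"
  unfolding subalgebra_def sets_filtration
proof (intro conjI space_filtration sets.sigma_sets_subset)
  show "{W s -` A \<inter> space M | s A. s \<in> {0..t} \<and> A \<in> sets borel} \<union> null_sets M \<subseteq> sets M"
    using W_measurable assms by (auto intro!: measurable_sets)
qed

lemma filtration_mono:
  assumes "s \<le> t"
  shows "subalgebra (augmented_filtration M W t) (augmented_filtration M W s)"
  unfolding subalgebra_def sets_filtration using assms
  by (intro conjI sigma_sets_mono' Un_mono) (auto, force)

lemma W_adapted: "s \<in> {0..t} \<Longrightarrow> W s \<in> borel_measurable (augmented_filtration M W t)"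
  by (rule measurableI) (auto simp: sets_filtration intro!: sigma_sets.Basic)

lemma cylinder_measurable:
  assumes "finite J" "J \<subseteq> {0..T}" "\<And>s. A s \<in> sets borel"
  shows "{\<omega>\<in>space M. \<forall>s\<in>J. W s \<omega> \<in> A s} \<in> events"
proof (rule sets.sets_Collect_finite_All)
  fix s assume "s \<in> J"
  then have "W s -` A s \<inter> space M \<in> events"
    using assms by (intro measurable_sets[OF W_measurable]) auto
  then show "{\<omega>\<in>space M. W s \<omega> \<in> A s} \<in> events"
    by (simp add: vimage_def Int_def conj_commute)
qed fact

text \<open>The given dates, together with 0 and t, form a partition that t' extends by one
  interval. Up to the value at 0, the positions at the given dates are partial sums of the earlier
  increments, which are jointly independent of the last one.\<close>

lemma increment_indep_cylinder:
  assumes t: "0 \<le> t" "t < t'" "t' \<le> T" and J: "finite J" "J \<subseteq> {0..t}"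
    and A: "\<And>s. A s \<in> sets borel" and H: "H \<in> sets borel"
  shows "prob ({\<omega>\<in>space M. \<forall>s\<in>J. W s \<omega> \<in> A s} \<inter> ((\<lambda>\<omega>. W t' \<omega> - W t \<omega>) -` H \<inter> space M))
    = prob {\<omega>\<in>space M. \<forall>s\<in>J. W s \<omega> \<in> A s} * prob ((\<lambda>\<omega>. W t' \<omega> - W t \<omega>) -` H \<inter> space M)"
proof -
  define xs where "xs = sorted_list_of_set (insert 0 (insert t J))"
  \<comment> \<open>The list has \<open>Suc n\<close> entries and ends with t: the increments with
    index below n are the past, and index n is the one from t to t'.\<close>
  define n where "n = length xs - 1"
  define \<tau> where "\<tau> i = (if i \<le> n then xs ! i else t')" for i
  have set_xs: "set xs = insert 0 (insert t J)"
    unfolding xs_def using J by (intro set_sorted_list_of_set) auto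
  then have len: "length xs = Suc n"
    unfolding n_def by (cases xs) auto
  have xs_nth: "xs ! i \<in> {0..t}" if "i \<le> n" for i
    using that len J t set_xs nth_mem[of i xs] by auto
  have sorted: "xs ! i < xs ! j" if "i < j" "j \<le> n" for i j
    using that len sorted_wrt_nth_less[OF strict_sorted_list_of_set, of i j "insert 0 (insert t J)"]
    by (simp add: xs_def)
  have ex_nth: "\<exists>i\<le>n. xs ! i = s" if "s \<in> insert 0 (insert t J)" for s
    using that set_xs len in_set_conv_nth[of s xs] by (auto simp: less_Suc_eq_le)
  have first: "\<tau> 0 = 0"
  proof -
    obtain i where "i \<le> n" "xs ! i = 0"
      using ex_nth by blast
    then show ?thesis
      using sorted[of 0 i] xs_nth[of 0] by (cases "i = 0") (auto simp: \<tau>_def)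
  qed
  have last: "\<tau> n = t" "\<tau> (Suc n) = t'"
  proof -
    obtain i where "i \<le> n" "xs ! i = t"
      using ex_nth by blast
    then show "\<tau> n = t"
      using sorted[of i n] xs_nth[of n] by (cases "i = n") (auto simp: \<tau>_def)
  qed (simp add: \<tau>_def)
  have mono: "strict_mono_on {..Suc n} \<tau>"
  proof (rule strict_mono_onI)
    fix i j assume "i \<in> {..Suc n}" "j \<in> {..Suc n}" "i < j"
    then show "\<tau> i < \<tau> j"
      using sorted[of i j] xs_nth[of i] t by (auto simp: \<tau>_def)
  qed
  define X where "X = (\<lambda>(i, l) \<omega>. vec_nth (W (\<tau> (Suc i)) \<omega> - W (\<tau> i) \<omega>) l)"
  have indep: "indep_vars (\<lambda>_. borel) X ({..<Suc n} \<times> UNIV)"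
    using bm mono first last t unfolding brownian_motion_def X_def by auto
  let ?I = "{..<n} \<times> (UNIV :: 'q set)" and ?L = "{n} \<times> (UNIV :: 'q set)"
  let ?P = "PiM ?I (\<lambda>_. borel :: real measure)" and ?Q = "PiM ?L (\<lambda>_. borel :: real measure)"
  define past where "past \<omega> = restrict (\<lambda>i. X i \<omega>) ?I" for \<omega>
  define new where "new \<omega> = restrict (\<lambda>i. X i \<omega>) ?L" for \<omega>
  have ind: "indep_var ?P past ?Q new"
    unfolding past_def new_def by (rule indep_var_restrict[OF indep]) auto
  define position where "position i f = (\<chi> l. \<Sum>j<i. f (j, l))" for i and f :: "nat \<times> 'q \<Rightarrow> real"
  define E where "E = {f \<in> space ?P. \<forall>i\<in>{i. i \<le> n \<and> xs ! i \<in> J}. position i f \<in> A (xs ! i)}"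
  define H' where "H' = {f \<in> space ?Q. (\<chi> l. f (n, l)) \<in> H}"
  have position_meas: "position i \<in> borel_measurable ?P" if "i \<le> n" for i
    unfolding position_def using that
    by (intro measurable_vec_lambda borel_measurable_sum measurable_component_singleton) auto
  have E: "E \<in> sets ?P"
    unfolding E_def
  proof (rule sets.sets_Collect_finite_All)
    show "{f \<in> space ?P. position i f \<in> A (xs ! i)} \<in> sets ?P"
      if "i \<in> {i. i \<le> n \<and> xs ! i \<in> J}" for i
      using measurable_sets[OF position_meas[of i] A[of "xs ! i"]] that
      by (simp add: vimage_def Int_def conj_commute)
  qed simp
  have H': "H' \<in> sets ?Q"
  proof -
    have "(\<lambda>f. \<chi> l. f (n, l)) \<in> borel_measurable ?Q"
      by (intro measurable_vec_lambda measurable_component_singleton) auto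
    from measurable_sets[OF this H] show ?thesis
      by (simp add: H'_def vimage_def Int_def conj_commute)
  qed
  have past_space: "past \<omega> \<in> space ?P" "new \<omega> \<in> space ?Q" for \<omega>
    by (auto simp: past_def new_def space_PiM)
  have position_past: "position i (past \<omega>) = W (xs ! i) \<omega> - W 0 \<omega>" if "i \<le> n" for i \<omega>
  proof -
    have "vec_nth (position i (past \<omega>)) l = vec_nth (W (xs ! i) \<omega> - W 0 \<omega>) l" for l
    proof -
      have "vec_nth (position i (past \<omega>)) l
          = (\<Sum>j<i. vec_nth (W (\<tau> (Suc j)) \<omega>) l - vec_nth (W (\<tau> j) \<omega>) l)"
        using that by (auto simp: position_def past_def X_def intro!: sum.cong)
      also have "\<dots> = vec_nth (W (\<tau> i) \<omega>) l - vec_nth (W (\<tau> 0) \<omega>) l"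
        by (rule sum_lessThan_telescope)
      finally show ?thesis
        using that first by (simp add: \<tau>_def)
    qed
    then show ?thesis
      by (simp add: Finite_Cartesian_Product.vec_eq_iff)
  qed
  have new_eq: "(\<chi> l. new \<omega> (n, l)) = W t' \<omega> - W t \<omega>" for \<omega>
    by (simp add: new_def X_def last Finite_Cartesian_Product.vec_eq_iff)
  have new_H: "new -` H' \<inter> space M = (\<lambda>\<omega>. W t' \<omega> - W t \<omega>) -` H \<inter> space M"
    using past_space by (auto simp: H'_def new_eq)
  let ?C = "{\<omega>\<in>space M. \<forall>s\<in>J. W s \<omega> \<in> A s}"
  let ?D = "(\<lambda>\<omega>. W t' \<omega> - W t \<omega>) -` H \<inter> space M"
  have C: "?C \<in> events"
    using J t A by (intro cylinder_measurable) auto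
  have "W t \<in> borel_measurable M" "W t' \<in> borel_measurable M"
    using t by (auto intro!: W_measurable)
  then have D: "?D \<in> events"
    using H by (intro measurable_sets[of _ _ borel]) auto
  have past_meas: "past -` E \<inter> space M \<in> events"
    using ind E by (auto simp: indep_var_eq intro: measurable_sets)
  have "AE \<omega> in M. W 0 \<omega> = 0"
    using bm by (simp add: brownian_motion_def)
  \<comment> \<open>The past increments determine \<open>W s - W 0\<close>, and \<open>W 0\<close>
    vanishes only almost surely, so cylinder and preimage agree up to a null set.\<close>
  then have AE: "AE \<omega> in M. (\<omega> \<in> ?C) = (\<omega> \<in> past -` E \<inter> space M)"
  proof eventually_elim
    case (elim \<omega>)
    have "(\<forall>s\<in>J. W s \<omega> \<in> A s) \<longleftrightarrow> (\<forall>i\<in>{i. i \<le> n \<and> xs ! i \<in> J}. W (xs ! i) \<omega> \<in> A (xs ! i))"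
    proof (intro iffI ballI)
      fix s assume R: "\<forall>i\<in>{i. i \<le> n \<and> xs ! i \<in> J}. W (xs ! i) \<omega> \<in> A (xs ! i)" and s: "s \<in> J"
      then obtain i where "i \<le> n" "xs ! i = s"
        using ex_nth[of s] by auto
      with R s show "W s \<omega> \<in> A s"
        by blast
    qed simp
    then show ?case
      using past_space by (auto simp: E_def position_past elim)
  qed
  have "prob (?C \<inter> ?D) = prob ((past -` E \<inter> space M) \<inter> ?D)"
    using AE C D past_meas by (intro finite_measure_eq_AE) auto
  also have "(past -` E \<inter> space M) \<inter> ?D = (\<lambda>\<omega>. (past \<omega>, new \<omega>)) -` (E \<times> H') \<inter> space M"
    unfolding new_H[symmetric] by auto
  also have "prob \<dots> = prob (past -` E \<inter> space M) * prob (new -` H' \<inter> space M)"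
    by (rule indep_varD[OF ind E H'])
  also have "prob (past -` E \<inter> space M) = prob ?C"
    using AE C past_meas by (intro finite_measure_eq_AE) auto
  finally show ?thesis
    by (simp add: new_H)
qed

text \<open>Independence passes from intersection-stable families to the sigma-algebras they
  generate. For cylinders it is the previous lemma, and null sets are independent of every
  event.\<close>

lemma filtration_indep_increment:
  assumes t: "0 \<le> t" "t < t'" "t' \<le> T"
  shows "indep_set (sets (augmented_filtration M W t))
    (sigma_sets (space M) {(\<lambda>\<omega>. W t' \<omega> - W t \<omega>) -` H \<inter> space M | H. H \<in> sets borel})"
proof -
  define cyl where "cyl J A = {\<omega>\<in>space M. \<forall>s\<in>J. W s \<omega> \<in> A s}" for J A
  (* Null sets are added to the cylinders so that the family generates the augmented filtration;
     it stays closed under intersection. *)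
  define \<C> where "\<C> = {cyl J A | J A. finite J \<and> J \<subseteq> {0..t} \<and> (\<forall>s. A s \<in> sets borel)} \<union> null_sets M"
  let ?D = "{(\<lambda>\<omega>. W t' \<omega> - W t \<omega>) -` H \<inter> space M | H. H \<in> sets borel}"
  have meas: "W t \<in> borel_measurable M" "W t' \<in> borel_measurable M"
    using t by (auto intro!: W_measurable)
  have D: "?D \<subseteq> events"
  proof clarify
    fix H :: "(real ^ 'q) set" assume "H \<in> sets borel"
    then show "(\<lambda>\<omega>. W t' \<omega> - W t \<omega>) -` H \<inter> space M \<in> events"
      by (rule measurable_sets[OF borel_measurable_diff[OF meas(2,1)]])
  qed
  have cyl_meas: "cyl J A \<in> events" if "finite J" "J \<subseteq> {0..t}" "\<forall>s. A s \<in> sets borel" for J A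
    unfolding cyl_def using that t by (intro cylinder_measurable) auto
  have "indep_set \<C> ?D"
  proof (rule indep_setI[OF _ D])
    show "\<C> \<subseteq> events"
      using cyl_meas by (auto simp: \<C>_def)
    fix a b assume a: "a \<in> \<C>" and b: "b \<in> ?D"
    show "prob (a \<inter> b) = prob a * prob b"
    proof (cases "a \<in> null_sets M")
      case True
      moreover have "a \<inter> b \<in> null_sets M"
        using True b D by (auto intro!: null_set_Int2)
      ultimately show ?thesis
        by (simp add: measure_eq_0_null_sets)
    next
      case False
      then show ?thesis
        using a b increment_indep_cylinder[OF t] by (auto simp: \<C>_def cyl_def)
    qed
  qed
  moreover have "Int_stable \<C>"
  proof (rule Int_stableI)
    fix a b assume ab: "a \<in> \<C>" "b \<in> \<C>"
    show "a \<inter> b \<in> \<C>"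
    proof (cases "a \<in> null_sets M \<or> b \<in> null_sets M")
      case True
      moreover have "a \<in> events" "b \<in> events"
        using ab cyl_meas by (auto simp: \<C>_def)
      ultimately have "a \<inter> b \<in> null_sets M"
        using null_set_Int1[of b M a] null_set_Int2[of a M b] by (auto simp: Int_commute)
      then show ?thesis
        by (simp add: \<C>_def)
    next
      case False
      then obtain J A J' A' where a: "a = cyl J A" "finite J" "J \<subseteq> {0..t}" "\<forall>s. A s \<in> sets borel"
        and b: "b = cyl J' A'" "finite J'" "J' \<subseteq> {0..t}" "\<forall>s. A' s \<in> sets borel"
        using ab by (auto simp: \<C>_def)
      define A'' where "A'' s = (if s \<in> J then A s else UNIV) \<inter> (if s \<in> J' then A' s else UNIV)" for s
      have "a \<inter> b = cyl (J \<union> J') A''"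
        unfolding a b cyl_def A''_def by (auto split: if_splits)
      moreover have "A'' s \<in> sets borel" for s
        using a b by (auto simp: A''_def)
      moreover have "finite (J \<union> J')" "J \<union> J' \<subseteq> {0..t}"
        using a b by auto
      ultimately show ?thesis
        unfolding \<C>_def by blast
    qed
  qed
  moreover have "Int_stable ?D"
  proof (rule Int_stableI)
    fix a b assume "a \<in> ?D" "b \<in> ?D"
    then obtain H H' where "H \<in> sets borel" "H' \<in> sets borel"
      "a = (\<lambda>\<omega>. W t' \<omega> - W t \<omega>) -` H \<inter> space M" "b = (\<lambda>\<omega>. W t' \<omega> - W t \<omega>) -` H' \<inter> space M"
      by auto
    then show "a \<inter> b \<in> ?D"
      by (intro CollectI exI[of _ "H \<inter> H'"]) auto
  qed
  ultimately have "indep_set (sigma_sets (space M) \<C>) (sigma_sets (space M) ?D)"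
    by (rule indep_set_sigma_sets)
  moreover have "sets (augmented_filtration M W t) \<subseteq> sigma_sets (space M) \<C>"
    unfolding sets_filtration
  proof (rule sigma_sets_mono')
    show "{W s -` A \<inter> space M | s A. s \<in> {0..t} \<and> A \<in> sets borel} \<union> null_sets M \<subseteq> \<C>"
    proof
      fix x assume "x \<in> {W s -` A \<inter> space M | s A. s \<in> {0..t} \<and> A \<in> sets borel} \<union> null_sets M"
      then consider s A where "x = W s -` A \<inter> space M" "s \<in> {0..t}" "A \<in> sets borel"
        | "x \<in> null_sets M"
        by blast
      then show "x \<in> \<C>"
      proof cases
        case 1
        then have "x = cyl {s} (\<lambda>_. A)"
          by (auto simp: cyl_def)
        with 1 show ?thesis
          unfolding \<C>_def by blast
      qed (simp add: \<C>_def)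
    qed
  qed
  ultimately show ?thesis
    by (rule indep_set_mono) simp
qed

lemma filtration_indep_var:
  assumes t: "0 \<le> t" "t < t'" "t' \<le> T"
    and G: "G \<in> borel_measurable (augmented_filtration M W t)" and g: "g \<in> borel_measurable borel"
  shows "indep_var borel G borel (\<lambda>\<omega>. g (W t' \<omega> - W t \<omega>) :: real)"
  unfolding indep_var_eq
proof (intro conjI)
  have [measurable]: "W t \<in> borel_measurable M" "W t' \<in> borel_measurable M"
    using t by (auto intro!: W_measurable)
  show "G \<in> borel_measurable M"
    using G subalgebra_filtration[of t] t by (auto intro: measurable_from_subalg)
  show "(\<lambda>\<omega>. g (W t' \<omega> - W t \<omega>)) \<in> borel_measurable M"
    using g by measurable
  show "indep_set (sigma_sets (space M) {G -` A \<inter> space M | A. A \<in> sets borel})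
      (sigma_sets (space M) {(\<lambda>\<omega>. g (W t' \<omega> - W t \<omega>)) -` A \<inter> space M | A. A \<in> sets borel})"
  proof (rule indep_set_mono[OF filtration_indep_increment[OF t]])
    have "{G -` A \<inter> space M | A. A \<in> sets borel} \<subseteq> sets (augmented_filtration M W t)"
      using measurable_sets[OF G] by auto
    then show "sigma_sets (space M) {G -` A \<inter> space M | A. A \<in> sets borel}
        \<subseteq> sets (augmented_filtration M W t)"
      using sets.sigma_sets_subset[of _ "augmented_filtration M W t"] by simp
    have "(\<lambda>\<omega>. g (W t' \<omega> - W t \<omega>)) -` A \<inter> space M
        = (\<lambda>\<omega>. W t' \<omega> - W t \<omega>) -` (g -` A) \<inter> space M" for A
      by auto
    moreover have "g -` A \<in> sets borel" if "A \<in> sets borel" for A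
      using measurable_sets[OF g that] by simp
    ultimately show "sigma_sets (space M) {(\<lambda>\<omega>. g (W t' \<omega> - W t \<omega>)) -` A \<inter> space M | A. A \<in> sets borel}
      \<subseteq> sigma_sets (space M) {(\<lambda>\<omega>. W t' \<omega> - W t \<omega>) -` H \<inter> space M | H. H \<in> sets borel}"
      by (intro sigma_sets_mono') blast
  qed
qed

lemma increment_moments:
  assumes t: "0 \<le> t" "t < t'" "t' \<le> T"
  shows "integrable M (\<lambda>\<omega>. vec_nth (W t' \<omega> - W t \<omega>) l)"
    and "(\<integral>\<omega>. vec_nth (W t' \<omega> - W t \<omega>) l \<partial>M) = 0"
    and "integrable M (\<lambda>\<omega>. vec_nth (W t' \<omega> - W t \<omega>) l * vec_nth (W t' \<omega> - W t \<omega>) m)"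
    and "(\<integral>\<omega>. vec_nth (W t' \<omega> - W t \<omega>) l * vec_nth (W t' \<omega> - W t \<omega>) m \<partial>M)
      = (if l = m then t' - t else 0)"
proof -
  let ?D = "\<lambda>l \<omega>. vec_nth (W t' \<omega> - W t \<omega>) l"
  have pos: "0 < sqrt (t' - t)"
    using t by simp
  have D: "distributed M lborel (?D l) (normal_density 0 (sqrt (t' - t)))" for l
    using bm t unfolding brownian_motion_def by blast
  show int: "integrable M (?D l)" for l
    by (rule distributed_integrable_var[OF D]) (use integrable_normal_moment[OF pos, of 0 1] in auto)
  show mean: "(\<integral>\<omega>. ?D l \<omega> \<partial>M) = 0" for l
    by (rule normal_distributed_expectation[OF pos D])
  have sq: "integrable M (\<lambda>\<omega>. (?D l \<omega>)\<^sup>2)" for l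
    using distributed_integrable[OF D, of "\<lambda>x. x\<^sup>2"] integrable_normal_moment[OF pos, of 0 2] by auto
  have var: "(\<integral>\<omega>. (?D l \<omega>)\<^sup>2 \<partial>M) = t' - t" for l
    using normal_distributed_variance[OF pos D, of l] mean[of l] t by simp
  have "indep_var borel (?D l) borel (?D m)" if "l \<noteq> m" for l m
  proof -
    \<comment> \<open>The independence of two coordinates is read off from the partition with the
      single interval from t to t'.\<close>
    define \<tau> where "\<tau> i = (if i = 0 then t else t')" for i :: nat
    have \<tau>: "strict_mono_on {..1} \<tau>" "0 \<le> \<tau> 0" "\<tau> 1 \<le> T"
      using t by (auto simp: \<tau>_def strict_mono_on_def)
    have "indep_vars (\<lambda>_. borel) (\<lambda>(i, l) \<omega>. vec_nth (W (\<tau> (Suc i)) \<omega> - W (\<tau> i) \<omega>) l) ({..<1} \<times> UNIV)"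
      using bm \<tau> unfolding brownian_motion_def by blast
    from indep_var_restrict[OF this, of "{(0, l)}" "{(0, m)}"] that
    have "indep_var (PiM {(0, l)} (\<lambda>_. borel))
        (\<lambda>\<omega>. restrict (\<lambda>i. (case i of (i, l) \<Rightarrow> \<lambda>\<omega>. vec_nth (W (\<tau> (Suc i)) \<omega> - W (\<tau> i) \<omega>) l) \<omega>) {(0, l)})
        (PiM {(0, m)} (\<lambda>_. borel))
        (\<lambda>\<omega>. restrict (\<lambda>i. (case i of (i, l) \<Rightarrow> \<lambda>\<omega>. vec_nth (W (\<tau> (Suc i)) \<omega> - W (\<tau> i) \<omega>) l) \<omega>) {(0, m)})"
      by auto
    from indep_var_compose[OF this, of "\<lambda>f. f (0, l)" borel "\<lambda>f. f (0, m)" borel]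
    show ?thesis
      by (simp add: comp_def \<tau>_def measurable_component_singleton)
  qed
  then have cross: "integrable M (\<lambda>\<omega>. ?D l \<omega> * ?D m \<omega>)" "(\<integral>\<omega>. ?D l \<omega> * ?D m \<omega> \<partial>M) = 0"
    if "l \<noteq> m"
    using that int mean indep_var_integrable[of "?D l" "?D m"]
      indep_var_lebesgue_integral[of "?D l" "?D m"] by auto
  show "integrable M (\<lambda>\<omega>. ?D l \<omega> * ?D m \<omega>)"
    using cross sq[of l] by (cases "l = m") (auto simp: power2_eq_square)
  show "(\<integral>\<omega>. ?D l \<omega> * ?D m \<omega> \<partial>M) = (if l = m then t' - t else 0)"
    using cross var[of l] by (cases "l = m") (auto simp: power2_eq_square)
qed

text \<open>By independence, expectations of \<open>G\<close> times a function of the increment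
  factor. This turns Brownian motion into the moment identities on which the one-step analysis
  rests.\<close>

lemma noise_step_increment:
  assumes t: "0 \<le> t" "t < t'" "t' \<le> T"
  shows "noise_step M (augmented_filtration M W t) (\<lambda>\<omega>. W t' \<omega> - W t \<omega>) (t' - t)"
proof unfold_locales
  have [measurable]: "W t \<in> borel_measurable M" "W t' \<in> borel_measurable M"
    using t by (auto intro!: W_measurable)
  show "subalgebra M (augmented_filtration M W t)"
    using t by (intro subalgebra_filtration) simp
  show "(\<lambda>\<omega>. W t' \<omega> - W t \<omega>) \<in> borel_measurable M"
    by measurable
  show "0 < t' - t"
    using t by simp
  fix G :: "'a \<Rightarrow> real" and l m
  assume G: "G \<in> borel_measurable (augmented_filtration M W t)" "integrable M G"
  let ?D = "\<lambda>l \<omega>. vec_nth (W t' \<omega> - W t \<omega>) l"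
  have ind: "indep_var borel G borel (?D l)" "indep_var borel G borel (\<lambda>\<omega>. ?D l \<omega> * ?D m \<omega>)"
    using filtration_indep_var[OF t G(1), of "\<lambda>x. vec_nth x l"]
      filtration_indep_var[OF t G(1), of "\<lambda>x. vec_nth x l * vec_nth x m"]
    by simp_all
  show "integrable M (\<lambda>\<omega>. G \<omega> * ?D l \<omega>) \<and> (\<integral>\<omega>. G \<omega> * ?D l \<omega> \<partial>M) = 0"
    using indep_var_integrable[OF ind(1) G(2)] indep_var_lebesgue_integral[OF ind(1) G(2)]
      increment_moments[OF t] by simp
  show "integrable M (\<lambda>\<omega>. G \<omega> * (?D l \<omega> * ?D m \<omega>)) \<and>
      (\<integral>\<omega>. G \<omega> * (?D l \<omega> * ?D m \<omega>) \<partial>M) = (if l = m then (t' - t) * (\<integral>\<omega>. G \<omega> \<partial>M) else 0)"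
    using indep_var_integrable[OF ind(2) G(2)] indep_var_lebesgue_integral[OF ind(2) G(2)]
      increment_moments[OF t] by simp
qed

end

section \<open>Error of the projected scheme\<close>

lemma lipschitz_linear_growth:
  fixes g :: "real \<Rightarrow> 'b::real_normed_vector \<Rightarrow> 'c::real_normed_vector"
  assumes "\<exists>L. L-lipschitz_on ({0..T} \<times> UNIV) (\<lambda>(t, x). g t x)" and "T \<ge> 0"
  shows "\<exists>c\<ge>0. \<forall>t\<in>{0..T}. \<forall>x. norm (g t x) \<le> c * (1 + norm x)"
proof -
  obtain L where L: "L-lipschitz_on ({0..T} \<times> UNIV) (\<lambda>(t, x). g t x)"
    using assms by blast
  have "L \<ge> 0"
    using L by (rule lipschitz_on_nonneg)
  define c where "c = norm (g 0 0) + L * (T + 1)"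
  have "norm (g t x) \<le> c * (1 + norm x)" if t: "t \<in> {0..T}" for t x
  proof -
    have "norm (g t x - g 0 0) \<le> L * dist (t, x) (0, 0)"
      using lipschitz_onD[OF L, of "(t, x)" "(0, 0)"] t \<open>T \<ge> 0\<close> by (simp add: dist_norm)
    also have "\<dots> \<le> L * (T + norm x)"
      using \<open>L \<ge> 0\<close> norm_Pair_le[of t x] t by (intro mult_left_mono) (auto simp: dist_norm)
    finally have "norm (g t x) \<le> norm (g 0 0) + L * (T + norm x)"
      using norm_triangle_sub[of "g t x" "g 0 0"] by linarith
    also have "\<dots> \<le> c * (1 + norm x)"
      using \<open>L \<ge> 0\<close> \<open>T \<ge> 0\<close> by (simp add: c_def algebra_simps)
    finally show ?thesis .
  qed
  moreover have "c \<ge> 0"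
    using \<open>L \<ge> 0\<close> \<open>T \<ge> 0\<close> by (simp add: c_def)
  ultimately show ?thesis
    by blast
qed

lemma lipschitz_borel_measurable:
  assumes "\<exists>L. L-lipschitz_on ({0..T} \<times> UNIV) (\<lambda>(t, x). g t x)" and "t \<in> {0..T}"
  shows "g t \<in> borel_measurable borel"
proof (rule borel_measurable_continuous_onI)
  obtain L where "L-lipschitz_on ({0..T} \<times> UNIV) (\<lambda>(t, x). g t x)"
    using assms by blast
  then have "continuous_on ({0..T} \<times> UNIV) (\<lambda>(t, x). g t x)"
    by (rule lipschitz_on_continuous_on)
  then have "continuous_on UNIV (\<lambda>x. (\<lambda>(t, x). g t x) (t, x))"
    by (rule continuous_on_compose2) (use assms in \<open>auto intro!: continuous_intros\<close>)
  then show "continuous_on UNIV (g t)"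
    by simp
qed

text \<open>All data at a fixed N, with the Lipschitz assumptions reduced to the form in which they
  are applied: f is compared at equal dates with constant K, and one constant c bounds the growth of
  b, \<sigma> and f. With \<open>Suc n\<close> iterations, n counts the contractions of the Picard
  defect.\<close>

locale projection_scheme = brownian M T W
  for M :: "'a measure" and T and W :: "real \<Rightarrow> 'a \<Rightarrow> real ^ 'q" +
  fixes b :: "real \<Rightarrow> real ^ 'd \<Rightarrow> real ^ 'd"
    and \<sigma> :: "real \<Rightarrow> real ^ 'd \<Rightarrow> real ^ 'q ^ 'd"
    and f :: "real \<Rightarrow> real ^ 'd \<Rightarrow> real \<Rightarrow> real ^ 'q \<Rightarrow> real"
    and S0 :: "real ^ 'd" and N :: nat
    and E :: "'s measure" and P :: "nat \<Rightarrow> 'a \<Rightarrow> 's" and \<xi> :: "'a \<Rightarrow> real"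
    and p :: "nat \<Rightarrow> 'q option \<Rightarrow> ('s \<Rightarrow> real) list"
    and Y :: "nat \<Rightarrow> 'a \<Rightarrow> real" and \<alpha> :: "nat \<Rightarrow> nat \<Rightarrow> 'q option \<Rightarrow> real list"
    and n :: nat and K c h :: real
  assumes T_pos: "T > 0" and N_pos: "N \<ge> 1" and h_def: "h = T / real N"
    and K: "K \<ge> 0" and c: "c \<ge> 0"
    and step_small: "h \<le> 1" "(16 * K\<^sup>2 + 1) * h \<le> 1"
    and b: "\<And>t. t \<in> {0..T} \<Longrightarrow> b t \<in> borel_measurable borel"
      "\<And>t x. t \<in> {0..T} \<Longrightarrow> norm (b t x) \<le> c * (1 + norm x)"
    and \<sigma>: "\<And>t. t \<in> {0..T} \<Longrightarrow> \<sigma> t \<in> borel_measurable borel"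
      "\<And>t x. t \<in> {0..T} \<Longrightarrow> norm (\<sigma> t x) \<le> c * (1 + norm x)"
    and f_lipschitz: "\<And>t x x' y y' z z'. t \<in> {0..T} \<Longrightarrow>
      \<bar>f t x y z - f t x' y' z'\<bar> \<le> K * (norm (x - x') + \<bar>y - y'\<bar> + norm (z - z'))"
    and f_growth: "\<And>t x. t \<in> {0..T} \<Longrightarrow> \<bar>f t x 0 0\<bar> \<le> c * (1 + norm x)"
    and P: "\<And>k. k \<le> N \<Longrightarrow> P k \<in> augmented_filtration M W (grid T N k) \<rightarrow>\<^sub>M E"
    and \<xi>: "square_integrable M \<xi>"
    and bases: "admissible_bases M E N P p"
    and scheme: "backward_scheme M T f W N (euler T b \<sigma> W S0 N) \<xi> Y"
    and projected: "projected_scheme M T f W N (euler T b \<sigma> W S0 N) \<xi> p P (Suc n) \<alpha>"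
begin

abbreviation F :: "nat \<Rightarrow> 'a measure" where "F k \<equiv> augmented_filtration M W (grid T N k)"
abbreviation S :: "nat \<Rightarrow> 'a \<Rightarrow> real ^ 'd" where "S \<equiv> euler T b \<sigma> W S0 N"
abbreviation D :: "nat \<Rightarrow> 'a \<Rightarrow> real ^ 'q" where "D \<equiv> bm_incr T N W"
abbreviation Z :: "nat \<Rightarrow> 'a \<Rightarrow> real ^ 'q" where "Z \<equiv> backward_Z M T W N Y"
abbreviation Y' :: "nat \<Rightarrow> 'a \<Rightarrow> real" where "Y' k \<equiv> proj_Y p P N \<xi> k (\<alpha> (Suc n) k)"
abbreviation Z' :: "nat \<Rightarrow> 'a \<Rightarrow> real ^ 'q" where "Z' k \<equiv> proj_Z p P k (\<alpha> (Suc n) k)"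

lemma h_pos: "h > 0"
  using T_pos N_pos by (simp add: h_def)

lemma grid_Suc: "grid T N (Suc k) - grid T N k = h"
  by (simp add: grid_def h_def field_simps add_divide_distrib)

lemma grid_mem: "k \<le> N \<Longrightarrow> grid T N k \<in> {0..T}"
  using T_pos N_pos by (auto simp: grid_def field_simps)

lemma noise: "k < N \<Longrightarrow> noise_step M (F k) (D k) h"
  using noise_step_increment[of "grid T N k" "grid T N (Suc k)"] grid_mem[of k] grid_mem[of "Suc k"]
    grid_Suc[of k] h_pos
  by (simp add: bm_incr_def[abs_def])

lemma measurable_F: "k \<le> N \<Longrightarrow> X \<in> borel_measurable (F k) \<Longrightarrow> X \<in> borel_measurable M"
  using subalgebra_filtration[of "grid T N k"] grid_mem[of k] by (auto intro: measurable_from_subalg)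

lemma measurable_F_Suc: "X \<in> borel_measurable (F k) \<Longrightarrow> X \<in> borel_measurable (F (Suc k))"
  using filtration_mono[of "grid T N k" "grid T N (Suc k)"] grid_Suc[of k] h_pos
  by (auto intro: measurable_from_subalg)

lemma D_measurable: "k < N \<Longrightarrow> D k \<in> borel_measurable (F (Suc k))"
  unfolding bm_incr_def[abs_def] using grid_mem[of k] grid_Suc[of k] h_pos
  by (intro borel_measurable_diff W_adapted) (auto simp: grid_def)

section \<open>Euler scheme: adaptedness and second moments\<close>

lemma euler_Suc_component:
  "vec_nth (S (Suc k) \<omega>) i = vec_nth (S k \<omega> + h *\<^sub>R b (grid T N k) (S k \<omega>)) i
     + (\<Sum>l\<in>UNIV. vec_nth (vec_nth (\<sigma> (grid T N k) (S k \<omega>)) i) l * vec_nth (D k \<omega>) l)"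
  by (simp add: Let_def matrix_vector_mult_def flip: h_def)

lemma euler_adapted: "k \<le> N \<Longrightarrow> S k \<in> borel_measurable (F k)"
proof (induction k)
  case 0
  show ?case by simp
next
  case (Suc k)
  then have S: "S k \<in> borel_measurable (F (Suc k))" and D: "D k \<in> borel_measurable (F (Suc k))"
    using measurable_F_Suc D_measurable by auto
  have g: "grid T N k \<in> {0..T}"
    using Suc.prems by (intro grid_mem) simp
  have bS: "(\<lambda>\<omega>. b (grid T N k) (S k \<omega>)) \<in> borel_measurable (F (Suc k))"
    and \<sigma>S: "(\<lambda>\<omega>. \<sigma> (grid T N k) (S k \<omega>)) \<in> borel_measurable (F (Suc k))"
    using measurable_compose[OF S b(1)[OF g]] measurable_compose[OF S \<sigma>(1)[OF g]] by auto
  show ?case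
  proof (rule measurable_vecI)
    fix i
    show "(\<lambda>\<omega>. vec_nth (S (Suc k) \<omega>) i) \<in> borel_measurable (F (Suc k))"
      unfolding euler_Suc_component
    proof (rule borel_measurable_add)
      show "(\<lambda>\<omega>. vec_nth (S k \<omega> + h *\<^sub>R b (grid T N k) (S k \<omega>)) i) \<in> borel_measurable (F (Suc k))"
        using S bS by (intro measurable_vec_nth borel_measurable_add borel_measurable_scaleR) auto
      show "(\<lambda>\<omega>. \<Sum>l\<in>UNIV. vec_nth (vec_nth (\<sigma> (grid T N k) (S k \<omega>)) i) l * vec_nth (D k \<omega>) l)
          \<in> borel_measurable (F (Suc k))"
        by (intro borel_measurable_sum borel_measurable_times measurable_vec_nth[OF measurable_vec_nth[OF \<sigma>S]]
            measurable_vec_nth[OF D])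
    qed
  qed
qed

text \<open>Growth rate of \<open>1 + E|S|^2\<close>: 1 from Young's inequality with weight one,
  \<open>4 * c^2\<close> from the size of the drift and \<open>2 * c^2\<close> from the
  diffusion.\<close>

definition \<kappa> :: real where "\<kappa> = 1 + 6 * c\<^sup>2"

lemma growth_square:
  fixes v :: "'v::real_normed_vector" and x :: "'w::real_normed_vector"
  assumes "norm v \<le> c * (1 + norm x)"
  shows "(norm v)\<^sup>2 \<le> 2 * c\<^sup>2 * (1 + (norm x)\<^sup>2)"
proof -
  have "(norm v)\<^sup>2 \<le> (c * (1 + norm x))\<^sup>2"
    using assms by (intro power_mono) auto
  also have "\<dots> = c\<^sup>2 * (1 + norm x)\<^sup>2"
    by (simp add: power_mult_distrib)
  also have "\<dots> \<le> c\<^sup>2 * (2 * (1 + (norm x)\<^sup>2))"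
    using sum_squares_bound[of 1 "norm x"] by (intro mult_left_mono) (auto simp: power2_sum)
  finally show ?thesis
    by (simp only: mult_ac)
qed

text \<open>Each component of a step is a part known at date k plus noise, so second moments add
  without cross terms. Square integrability goes through the same induction because the noise
  identities of the next step require it.\<close>

lemma euler_moment:
  assumes "k \<le> N"
  shows "(\<forall>i. square_integrable M (\<lambda>\<omega>. vec_nth (S k \<omega>) i)) \<and>
    1 + (\<integral>\<omega>. (norm (S k \<omega>))\<^sup>2 \<partial>M) \<le> (1 + h * \<kappa>) ^ k * (1 + (norm S0)\<^sup>2)"
  using assms
proof (induction k)
  case 0
  show ?case
    by (simp add: prob_space)
next
  case (Suc k)
  then have k: "k < N"
    by simp
  interpret noise_step M "F k" "D k" h
    using k by (rule noise)
  let ?t = "grid T N k"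
  have g: "?t \<in> {0..T}"
    using k by (intro grid_mem) simp
  have S_F: "S k \<in> borel_measurable (F k)"
    using k by (intro euler_adapted) simp
  define A where "A \<omega> = S k \<omega> + h *\<^sub>R b ?t (S k \<omega>)" for \<omega>
  define s where "s i l \<omega> = vec_nth (vec_nth (\<sigma> ?t (S k \<omega>)) i) l" for i l \<omega>
  have bS: "(\<lambda>\<omega>. b ?t (S k \<omega>)) \<in> borel_measurable (F k)"
    and \<sigma>S: "(\<lambda>\<omega>. \<sigma> ?t (S k \<omega>)) \<in> borel_measurable (F k)"
    using measurable_compose[OF S_F b(1)[OF g]] measurable_compose[OF S_F \<sigma>(1)[OF g]] by auto
  have S_sq: "square_integrable M (\<lambda>\<omega>. vec_nth (S k \<omega>) i)" for i
    using Suc by simp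
  then have nS: "square_integrable M (\<lambda>\<omega>. norm (S k \<omega>))"
    by (rule square_integrable_norm)
  then have bound: "square_integrable M (\<lambda>\<omega>. c * (1 + norm (S k \<omega>)))"
    by (intro square_integrable_cmult square_integrable_add square_integrable_const)
  have A_F: "A \<in> borel_measurable (F k)"
    unfolding A_def using S_F bS by auto
  have b_sq: "square_integrable M (\<lambda>\<omega>. vec_nth (b ?t (S k \<omega>)) i)" for i
  proof (rule square_integrable_bound[OF bound])
    show "(\<lambda>\<omega>. vec_nth (b ?t (S k \<omega>)) i) \<in> borel_measurable M"
      using bS by (intro measurable_F measurable_vec_nth)
    show "AE \<omega> in M. \<bar>vec_nth (b ?t (S k \<omega>)) i\<bar> \<le> \<bar>c * (1 + norm (S k \<omega>))\<bar>"
    proof (rule AE_I2)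
      fix \<omega>
      show "\<bar>vec_nth (b ?t (S k \<omega>)) i\<bar> \<le> \<bar>c * (1 + norm (S k \<omega>))\<bar>"
        using component_le_norm_cart[of "b ?t (S k \<omega>)" i] b(2)[OF g, of "S k \<omega>"] by linarith
    qed
  qed
  have A_sq: "square_integrable M (\<lambda>\<omega>. vec_nth (A \<omega>) i)" for i
    using S_sq b_sq by (simp add: A_def square_integrable_add square_integrable_cmult del: times_divide_eq_left)
  have s_F: "s i l \<in> borel_measurable (F k)" for i l
    unfolding s_def by (rule measurable_vec_nth[OF measurable_vec_nth[OF \<sigma>S]])
  have s_sq: "square_integrable M (s i l)" for i l
  proof (rule square_integrable_bound[OF bound])
    show "s i l \<in> borel_measurable M"
      using s_F by (rule measurable_F)
    show "AE \<omega> in M. \<bar>s i l \<omega>\<bar> \<le> \<bar>c * (1 + norm (S k \<omega>))\<bar>"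
    proof (rule AE_I2)
      fix \<omega>
      have "\<bar>s i l \<omega>\<bar> \<le> norm (vec_nth (\<sigma> ?t (S k \<omega>)) i)"
        unfolding s_def by (rule component_le_norm_cart)
      also have "\<dots> \<le> norm (\<sigma> ?t (S k \<omega>))"
        by (rule Finite_Cartesian_Product.norm_nth_le)
      finally show "\<bar>s i l \<omega>\<bar> \<le> \<bar>c * (1 + norm (S k \<omega>))\<bar>"
        using \<sigma>(2)[OF g, of "S k \<omega>"] by linarith
    qed
  qed
  have comp: "vec_nth (S (Suc k) \<omega>) i = vec_nth (A \<omega>) i + (\<Sum>l\<in>UNIV. s i l \<omega> * vec_nth (D k \<omega>) l)" for i \<omega>
    unfolding euler_Suc_component A_def s_def ..
  have sq: "square_integrable M (\<lambda>\<omega>. vec_nth (S (Suc k) \<omega>) i)" for i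
    unfolding comp using A_sq square_integrable_noise_mult[OF s_F s_sq]
    by (intro square_integrable_add square_integrable_sum)
  define m where "m = (\<integral>\<omega>. (norm (S k \<omega>))\<^sup>2 \<partial>M)"
  have m: "m \<ge> 0"
    by (simp add: m_def)
  have int: "integrable M (\<lambda>\<omega>. (norm (S k \<omega>))\<^sup>2)"
    using nS by (rule square_integrable_power2)
  have "(\<integral>\<omega>. (norm (S (Suc k) \<omega>))\<^sup>2 \<partial>M) = (\<Sum>i\<in>UNIV. \<integral>\<omega>. (vec_nth (S (Suc k) \<omega>) i)\<^sup>2 \<partial>M)"
    unfolding norm_power2_vec using sq
    by (intro Bochner_Integration.integral_sum square_integrable_power2)
  also have "\<dots> = (\<Sum>i\<in>UNIV. (\<integral>\<omega>. (vec_nth (A \<omega>) i)\<^sup>2 \<partial>M) + h * (\<Sum>l\<in>UNIV. \<integral>\<omega>. (s i l \<omega>)\<^sup>2 \<partial>M))"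
    unfolding comp using A_F A_sq s_F s_sq
    by (intro sum.cong refl noise_pythagoras measurable_vec_nth) auto
  also have "\<dots> = (\<integral>\<omega>. (norm (A \<omega>))\<^sup>2 + h * (norm (\<sigma> ?t (S k \<omega>)))\<^sup>2 \<partial>M)"
  proof -
    \<comment> \<open>The norm of the nested vector type is the Frobenius norm, which is what the
      componentwise sum produces.\<close>
    have norm_\<sigma>: "(norm (\<sigma> ?t (S k \<omega>)))\<^sup>2 = (\<Sum>i\<in>UNIV. \<Sum>l\<in>UNIV. (s i l \<omega>)\<^sup>2)" for \<omega>
      by (simp add: norm_vec_def[of "\<sigma> ?t (S k \<omega>)"] L2_set_def sum_nonneg s_def norm_power2_vec)
    have "integrable M (\<lambda>\<omega>. (s i l \<omega>)\<^sup>2)" "integrable M (\<lambda>\<omega>. (vec_nth (A \<omega>) i)\<^sup>2)" for i l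
      using s_sq A_sq by (auto intro: square_integrable_power2)
    then show ?thesis
      unfolding norm_\<sigma> norm_power2_vec
      by (simp add: Bochner_Integration.integral_sum sum.distrib sum_distrib_left
          del: times_divide_eq_left times_divide_eq_right)
  qed
  also have "\<dots> \<le> (\<integral>\<omega>. (1 + h) * (norm (S k \<omega>))\<^sup>2 + 6 * c\<^sup>2 * h * (1 + (norm (S k \<omega>))\<^sup>2) \<partial>M)"
  proof (rule integral_mono')
    show "integrable M (\<lambda>\<omega>. (1 + h) * (norm (S k \<omega>))\<^sup>2 + 6 * c\<^sup>2 * h * (1 + (norm (S k \<omega>))\<^sup>2))"
      using int by simp
    fix \<omega>
    have bb: "(norm (b ?t (S k \<omega>)))\<^sup>2 \<le> 2 * c\<^sup>2 * (1 + (norm (S k \<omega>))\<^sup>2)"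
      and ss: "(norm (\<sigma> ?t (S k \<omega>)))\<^sup>2 \<le> 2 * c\<^sup>2 * (1 + (norm (S k \<omega>))\<^sup>2)"
      using b(2)[OF g] \<sigma>(2)[OF g] by (auto intro: growth_square)
    have "norm (A \<omega>) \<le> norm (S k \<omega>) + h * norm (b ?t (S k \<omega>))"
      using norm_triangle_ineq[of "S k \<omega>" "h *\<^sub>R b ?t (S k \<omega>)"] h_pos by (simp add: A_def)
    then have "(norm (A \<omega>))\<^sup>2 \<le> (norm (S k \<omega>) + h * norm (b ?t (S k \<omega>)))\<^sup>2"
      by (intro power_mono) auto
    also have "\<dots> \<le> (1 + h) * (norm (S k \<omega>))\<^sup>2 + (h\<^sup>2 + h) * (norm (b ?t (S k \<omega>)))\<^sup>2"
      using power2_add_mult_le[of 1 h "norm (S k \<omega>)" "norm (b ?t (S k \<omega>))"] h_pos by simp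
    also have "\<dots> \<le> (1 + h) * (norm (S k \<omega>))\<^sup>2 + (2 * h) * (2 * c\<^sup>2 * (1 + (norm (S k \<omega>))\<^sup>2))"
    proof (intro add_left_mono mult_mono bb)
      show "h\<^sup>2 + h \<le> 2 * h"
        using mult_right_mono[OF step_small(1), of h] h_pos unfolding power2_eq_square by linarith
    qed (use h_pos in auto)
    finally have "(norm (A \<omega>))\<^sup>2 \<le> (1 + h) * (norm (S k \<omega>))\<^sup>2 + 4 * c\<^sup>2 * h * (1 + (norm (S k \<omega>))\<^sup>2)"
      by (simp only: mult_ac)  
    moreover have "h * (norm (\<sigma> ?t (S k \<omega>)))\<^sup>2 \<le> h * (2 * c\<^sup>2 * (1 + (norm (S k \<omega>))\<^sup>2))"
      using ss h_pos by (intro mult_left_mono) auto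
    ultimately show "(norm (A \<omega>))\<^sup>2 + h * (norm (\<sigma> ?t (S k \<omega>)))\<^sup>2
        \<le> (1 + h) * (norm (S k \<omega>))\<^sup>2 + 6 * c\<^sup>2 * h * (1 + (norm (S k \<omega>))\<^sup>2)"
      by (simp add: algebra_simps)
    show "0 \<le> (1 + h) * (norm (S k \<omega>))\<^sup>2 + 6 * c\<^sup>2 * h * (1 + (norm (S k \<omega>))\<^sup>2)"
      using h_pos by auto
  qed
  also have "\<dots> = (1 + h) * m + 6 * c\<^sup>2 * h * (1 + m)"
    using int by (simp add: m_def prob_space)
  finally have "1 + (\<integral>\<omega>. (norm (S (Suc k) \<omega>))\<^sup>2 \<partial>M) \<le> 1 + (1 + h) * m + 6 * c\<^sup>2 * h * (1 + m)"
    by linarith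
  also have "\<dots> \<le> (1 + h * \<kappa>) * (1 + m)"
    using h_pos by (simp add: \<kappa>_def algebra_simps)
  also have "\<dots> \<le> (1 + h * \<kappa>) * ((1 + h * \<kappa>) ^ k * (1 + (norm S0)\<^sup>2))"
    using Suc h_pos by (intro mult_left_mono) (auto simp: m_def \<kappa>_def)
  finally show ?case
    using sq by (simp add: mult_ac)
qed

lemma euler_moment_bound:
  assumes "k \<le> N"
  shows "square_integrable M (\<lambda>\<omega>. norm (S k \<omega>))"
    and "1 + (\<integral>\<omega>. (norm (S k \<omega>))\<^sup>2 \<partial>M) \<le> exp (T * \<kappa>) * (1 + (norm S0)\<^sup>2)"
proof -
  show "square_integrable M (\<lambda>\<omega>. norm (S k \<omega>))"
    using euler_moment[OF assms] by (intro square_integrable_norm) auto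
  have \<kappa>: "\<kappa> \<ge> 0"
    by (simp add: \<kappa>_def)
  have "(1 + h * \<kappa>) ^ k \<le> exp (h * \<kappa>) ^ k"
    using mult_nonneg_nonneg[of h \<kappa>] h_pos \<kappa> by (intro power_mono exp_ge_add_one_self) linarith
  also have "\<dots> = exp (real k * (h * \<kappa>))"
    by (simp only: exp_of_nat_mult)
  also have "\<dots> \<le> exp (T * \<kappa>)"
  proof -
    have "real k * h \<le> T"
      using grid_mem[OF assms] by (simp add: grid_def flip: h_def)
    then show ?thesis
      using mult_right_mono[OF _ \<kappa>, of "real k * h" T] by (simp only: exp_le_cancel_iff mult.assoc)
  qed
  finally show "1 + (\<integral>\<omega>. (norm (S k \<omega>))\<^sup>2 \<partial>M) \<le> exp (T * \<kappa>) * (1 + (norm S0)\<^sup>2)"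
    using euler_moment[OF assms] mult_right_mono[of "(1 + h * \<kappa>) ^ k" "exp (T * \<kappa>)" "1 + (norm S0)\<^sup>2"]
    by (auto intro: order_trans)
qed

lemma driver_moment:
  assumes "k \<le> N"
  shows "square_integrable M (\<lambda>\<omega>. f (grid T N k) (S k \<omega>) 0 0)"
    and "(\<integral>\<omega>. (f (grid T N k) (S k \<omega>) 0 0)\<^sup>2 \<partial>M) \<le> 2 * c\<^sup>2 * exp (T * \<kappa>) * (1 + (norm S0)\<^sup>2)"
proof -
  let ?f = "\<lambda>\<omega>. f (grid T N k) (S k \<omega>) 0 0"
  note g = grid_mem[OF assms]
  have "K-lipschitz_on UNIV (\<lambda>x. f (grid T N k) x 0 0)"
    using f_lipschitz[OF g, of _ 0 0 _ 0 0] K by (intro lipschitz_onI) (auto simp: dist_norm)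
  then have "(\<lambda>x. f (grid T N k) x 0 0) \<in> borel_measurable borel"
    by (intro borel_measurable_continuous_onI lipschitz_on_continuous_on)
  then have meas: "?f \<in> borel_measurable M"
    using measurable_compose[OF euler_adapted[OF assms]] by (intro measurable_F[OF assms]) auto
  have int: "square_integrable M (\<lambda>\<omega>. norm (S k \<omega>))"
    by (rule euler_moment_bound[OF assms])
  show sq: "square_integrable M ?f"
  proof (rule square_integrable_bound[OF _ meas])
    show "square_integrable M (\<lambda>\<omega>. c * (1 + norm (S k \<omega>)))"
      using int by (intro square_integrable_cmult square_integrable_add square_integrable_const)
    show "AE \<omega> in M. \<bar>?f \<omega>\<bar> \<le> \<bar>c * (1 + norm (S k \<omega>))\<bar>"
      using f_growth[OF g] by (auto intro!: AE_I2 order_trans[OF _ abs_ge_self])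
  qed
  have "(\<integral>\<omega>. (?f \<omega>)\<^sup>2 \<partial>M) \<le> (\<integral>\<omega>. 2 * c\<^sup>2 * (1 + (norm (S k \<omega>))\<^sup>2) \<partial>M)"
    using growth_square[of "?f _" "S k _"] f_growth[OF g] square_integrable_power2[OF sq]
      square_integrable_power2[OF int]
    by (intro integral_mono) auto
  also have "\<dots> = 2 * c\<^sup>2 * (1 + (\<integral>\<omega>. (norm (S k \<omega>))\<^sup>2 \<partial>M))"
    using square_integrable_power2[OF int] by (simp add: prob_space)
  also have "\<dots> \<le> 2 * c\<^sup>2 * (exp (T * \<kappa>) * (1 + (norm S0)\<^sup>2))"
    using euler_moment_bound(2)[OF assms] by (intro mult_left_mono) auto
  finally show "(\<integral>\<omega>. (?f \<omega>)\<^sup>2 \<partial>M) \<le> 2 * c\<^sup>2 * exp (T * \<kappa>) * (1 + (norm S0)\<^sup>2)"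
    by (simp only: mult_ac)
qed

text \<open>The Gronwall rate \<open>\<gamma> + 2\<close> of the one-step estimates, restated
  outside their locale as an expression in K alone.\<close>

definition \<Gamma> :: real where "\<Gamma> = 16 * K\<^sup>2 + 3"

definition data_size :: real where "data_size = 1 + (norm S0)\<^sup>2 + (\<integral>\<omega>. (\<xi> \<omega>)\<^sup>2 \<partial>M)"

definition residual :: "nat \<Rightarrow> real" where
  "residual k = 2 * (\<integral>\<omega>. (L2_resid M (basis_rv p P k None) (Y k) \<omega>)\<^sup>2 \<partial>M)
     + 2 * h * (\<Sum>l\<in>UNIV. \<integral>\<omega>. (L2_resid M (basis_rv p P k (Some l)) (\<lambda>\<omega>. vec_nth (Z k \<omega>) l) \<omega>)\<^sup>2 \<partial>M)"

section \<open>The two schemes at one date\<close>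

lemma basis:
  assumes "k < N" "g \<in> set (basis_rv p P k l)"
  shows "g \<in> borel_measurable (F k)" "square_integrable M g"
proof -
  obtain g' where g': "g' \<in> set (p k l)" "g = (\<lambda>\<omega>. g' (P k \<omega>))"
    using assms by (auto simp: basis_rv_def)
  then have "g' \<in> borel_measurable E" and int: "integrable M (\<lambda>\<omega>. (g \<omega>)\<^sup>2)"
    using bases assms by (auto simp: admissible_bases_def)
  then show meas: "g \<in> borel_measurable (F k)"
    unfolding g' using P[of k] assms by (intro measurable_compose[OF P]) auto
  show "square_integrable M g"
    using int measurable_F[OF _ meas] assms by (simp add: square_integrable_def)
qed

lemma picard:
  assumes k: "k < N"
  shows "picard_step M (F k) (D k) h (basis_rv p P k) (\<lambda>\<omega>. f (grid T N k) (S k \<omega>)) K"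
proof (rule picard_step.intro[OF noise[OF k]], unfold_locales)
  have g: "grid T N k \<in> {0..T}"
    using k by (intro grid_mem) simp
  fix y :: "'a \<Rightarrow> real" and z :: "'a \<Rightarrow> real ^ 'q"
  assume yz: "y \<in> borel_measurable (F k)" "z \<in> borel_measurable (F k)"
  \<comment> \<open>Joint continuity in x, y, z gives Borel measurability of the driver. Each of the
    three distances is at most the product distance, hence the 3.\<close>
  have "(3 * K)-lipschitz_on UNIV (\<lambda>(x, y, z). f (grid T N k) x y z)"
  proof (rule lipschitz_onI)
    fix u v :: "(real ^ 'd) \<times> real \<times> (real ^ 'q)"
    obtain x y z x' y' z' where uv: "u = (x, y, z)" "v = (x', y', z')"
      by (metis prod.exhaust)
    have "norm (x - x') \<le> dist u v" "\<bar>y - y'\<bar> \<le> dist u v" "norm (z - z') \<le> dist u v"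
      using dist_fst_le[of u v] dist_snd_le[of u v] dist_fst_le[of "snd u" "snd v"]
        dist_snd_le[of "snd u" "snd v"] by (auto simp: uv dist_norm)
    then have "K * (norm (x - x') + \<bar>y - y'\<bar> + norm (z - z')) \<le> K * (3 * dist u v)"
      using K by (intro mult_left_mono) auto
    then show "dist (case u of (x, y, z) \<Rightarrow> f (grid T N k) x y z) (case v of (x, y, z) \<Rightarrow> f (grid T N k) x y z)
        \<le> 3 * K * dist u v"
      using f_lipschitz[OF g, of x y z x' y' z'] by (simp add: uv dist_norm)
  qed (use K in simp)
  then have "(\<lambda>(x, y, z). f (grid T N k) x y z) \<in> borel_measurable borel"
    by (intro borel_measurable_continuous_onI lipschitz_on_continuous_on)
  moreover have "(\<lambda>\<omega>. (S k \<omega>, y \<omega>, z \<omega>)) \<in> borel_measurable (F k)"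
    using k by (intro borel_measurable_Pair euler_adapted yz) simp
  ultimately have "(\<lambda>\<omega>. case (S k \<omega>, y \<omega>, z \<omega>) of (x, y, z) \<Rightarrow> f (grid T N k) x y z)
      \<in> borel_measurable (F k)"
    by (rule measurable_compose[rotated])
  then show "(\<lambda>\<omega>. f (grid T N k) (S k \<omega>) (y \<omega>) (z \<omega>)) \<in> borel_measurable (F k)"
    by simp
next
  fix \<omega> y z y' z'
  show "\<bar>f (grid T N k) (S k \<omega>) y z - f (grid T N k) (S k \<omega>) y' z'\<bar> \<le> K * (\<bar>y - y'\<bar> + norm (z - z'))"
    using f_lipschitz[OF grid_mem, of k "S k \<omega>" y z "S k \<omega>" y' z'] k by simp
qed (use basis[OF k] driver_moment(1)[of k] k K step_small in auto)

lemma Y'_square_integrable: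
  assumes "k \<le> N"
  shows "square_integrable M (Y' k)"
proof (cases "k = N")
  case True
  then show ?thesis
    using \<xi> by (simp add: proj_Y_def[abs_def])
next
  case False
  then show ?thesis
    using assms basis[of k _ None] square_integrable_lin_comb[of "basis_rv p P k None" M "\<alpha> (Suc n) k None"]
    by (simp add: proj_Y_def[abs_def])
qed

lemma Y_square_integrable:
  assumes "k \<le> N"
  shows "Y k \<in> borel_measurable (F k)" "square_integrable M (Y k)"
  using scheme assms measurable_F[of k "Y k"]
  by (auto simp: backward_scheme_def square_integrable_def)

context
  fixes k :: nat
  assumes k: "k < N"
begin

interpretation picard_step M "F k" "D k" h "basis_rv p P k" "\<lambda>\<omega>. f (grid T N k) (S k \<omega>)" K
  using k by (rule picard)

lemma iterates: "picard_iterates (Y' (Suc k)) (\<lambda>i. \<alpha> i k)"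
proof -
  have "loss (Y' (Suc k)) (\<lambda>\<omega>. f (grid T N k) (S k \<omega>)
        (lin_comb (a' None) (basis_rv p P k None) \<omega>) (basis_val a' \<omega>))
      = picard_loss M T f W N S p P k (Y' (Suc k)) a'" for a'
    by (rule ext) (simp add: loss_def picard_loss_def basis_val_def proj_Z_def flip: h_def)
  moreover have "(\<lambda>l. \<forall>m. length (l m) = length (basis_rv p P k m)) = (\<lambda>a. \<forall>l. length (a l) = length (p k l))"
    by (simp add: basis_rv_def)
  ultimately show ?thesis
    using projected k unfolding picard_iterates_def projected_scheme_def
    by (simp add: basis_rv_def)
qed

lemma U: "square_integrable M (Y' (Suc k))"
  using k by (intro Y'_square_integrable) simp

lemma step_values:
  "Y' k = lin_comb (\<alpha> (Suc n) k None) (basis_rv p P k None)"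
  "Z' k = basis_val (\<alpha> (Suc n) k)"
  "Z k = (\<lambda>\<omega>. \<chi> l. noise_coeff (Y (Suc k)) l \<omega>)"
  "\<Gamma> = \<gamma> + 2"
proof -
  show "Z k = (\<lambda>\<omega>. \<chi> l. noise_coeff (Y (Suc k)) l \<omega>)"
    unfolding fun_eq_iff backward_Z_def noise_coeff_def h_def[symmetric] by simp
qed (use k in \<open>simp_all add: proj_Y_def[abs_def] proj_Z_def[abs_def] basis_val_def[abs_def] fun_eq_iff
      \<Gamma>_def \<gamma>_def\<close>)

text \<open>As the iteration starts from zero, \<open>first_Y\<close> and \<open>first_Z\<close> are
  the two parts of the initial increment. \<open>inc\<close> has index n, so it compares the last
  two iterates.\<close>

definition first_Y where "first_Y = (\<integral>\<omega>. (lin_comb (\<alpha> 1 k None) (basis_rv p P k None) \<omega>)\<^sup>2 \<partial>M)"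
definition first_Z where "first_Z = (\<integral>\<omega>. (norm (basis_val (\<alpha> 1 k) \<omega>))\<^sup>2 \<partial>M)"
definition inc where "inc = increment (\<lambda>i. \<alpha> i k) n"

text \<open>The first bound pairs the last y with the first z, so that one Gronwall recursion for
  the projected values also sums \<open>h * first_Z\<close>. The second bounds
  \<open>first_Y\<close> by the projected value at the next date.\<close>

lemma apriori_step:
  "(\<integral>\<omega>. (Y' k \<omega>)\<^sup>2 \<partial>M) + h / 2 * first_Z \<le> (1 + \<Gamma> * h) * (\<integral>\<omega>. (Y' (Suc k) \<omega>)\<^sup>2 \<partial>M)
    + 12 * h * (2 * c\<^sup>2 * exp (T * \<kappa>) * (1 + (norm S0)\<^sup>2))"
  "first_Y \<le> (1 + \<Gamma> * h) * (\<integral>\<omega>. (Y' (Suc k) \<omega>)\<^sup>2 \<partial>M)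
    + 12 * h * (2 * c\<^sup>2 * exp (T * \<kappa>) * (1 + (norm S0)\<^sup>2))"
proof -
  have F0: "12 * h * (\<integral>\<omega>. (f (grid T N k) (S k \<omega>) 0 0)\<^sup>2 \<partial>M)
      \<le> 12 * h * (2 * c\<^sup>2 * exp (T * \<kappa>) * (1 + (norm S0)\<^sup>2))"
    using driver_moment(2)[of k] k h_pos by (intro mult_left_mono) auto
  show "(\<integral>\<omega>. (Y' k \<omega>)\<^sup>2 \<partial>M) + h / 2 * first_Z \<le> (1 + \<Gamma> * h) * (\<integral>\<omega>. (Y' (Suc k) \<omega>)\<^sup>2 \<partial>M)
    + 12 * h * (2 * c\<^sup>2 * exp (T * \<kappa>) * (1 + (norm S0)\<^sup>2))"
    using iterate_apriori[OF U iterates, of "Suc n" 1] F0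
    unfolding first_Z_def step_values by linarith
  have "0 \<le> h / 2 * first_Z"
    using h_pos by (simp add: first_Z_def)
  then show "first_Y \<le> (1 + \<Gamma> * h) * (\<integral>\<omega>. (Y' (Suc k) \<omega>)\<^sup>2 \<partial>M)
    + 12 * h * (2 * c\<^sup>2 * exp (T * \<kappa>) * (1 + (norm S0)\<^sup>2))"
    using iterate_apriori[OF U iterates, of 1 1] F0
    unfolding first_Y_def first_Z_def step_values by linarith
qed

lemma inc_bound: "h * inc \<le> (2 * h\<^sup>2 * K\<^sup>2) ^ n * (h * first_Y + h * first_Z)"
  using increment_bound[OF U iterates, of n] unfolding inc_def first_Y_def first_Z_def .

lemma inc_nonneg: "0 \<le> inc"
  using increment_nonneg[OF U iterates] by (simp add: inc_def)

lemma first_nonneg: "0 \<le> first_Y" "0 \<le> first_Z"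
  by (simp_all add: first_Y_def first_Z_def)

lemma error_step:
  "(\<integral>\<omega>. (Y' k \<omega> - Y k \<omega>)\<^sup>2 \<partial>M) + h / 2 * (\<integral>\<omega>. (norm (Z' k \<omega> - Z k \<omega>))\<^sup>2 \<partial>M)
    \<le> (1 + \<Gamma> * h) * (\<integral>\<omega>. (Y' (Suc k) \<omega> - Y (Suc k) \<omega>)\<^sup>2 \<partial>M) + (residual k + h * inc)"
proof -
  have eq: "AE \<omega> in M. Y k \<omega> = real_cond_exp M (F k) (Y (Suc k)) \<omega> + h * f (grid T N k) (S k \<omega>) (Y k \<omega>) (Z k \<omega>)"
    using scheme k by (simp add: backward_scheme_def flip: h_def)
  have gram: "invertible_mat (gram_matrix M (basis_rv p P k l))" for l
    using bases k by (simp add: admissible_bases_def)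
  show ?thesis
    using iterate_error[OF U iterates Y_square_integrable(2)[of "Suc k"] Y_square_integrable[of k]
        step_values(3) eq gram, of n] k
    unfolding step_values(1,2,4) residual_def inc_def by simp
qed

end

section \<open>Summation over the dates\<close>

definition apriori_const :: real where
  "apriori_const = exp (\<Gamma> * T) * (1 + 24 * T * c\<^sup>2 * exp (T * \<kappa>))"

text \<open>Three times the Gronwall bound: once for the maximum, twice for the sum of the Z-errors,
  which the recursion carries with weight \<open>h / 2\<close>. The doubled residuals turn 3 into 6.
  The second summand is the Picard defect, with \<open>T * (2 + \<Gamma>)\<close> from
  \<open>first_Y\<close> and 2 from \<open>first_Z\<close>.\<close>

definition error_const :: real where
  "error_const = 6 * exp (\<Gamma> * T)
     + 3 * exp (\<Gamma> * T) * (2 * K\<^sup>2) ^ n * ((T * (2 + \<Gamma>) + 2) * apriori_const)"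

text \<open>Gronwall for the second moments of the projected scheme, started from \<xi> at date N.
  For \<open>first_Z\<close> it is the weighted sum that has a bound uniform in h.\<close>

lemma apriori_bound:
  shows "k \<le> N \<Longrightarrow> (\<integral>\<omega>. (Y' k \<omega>)\<^sup>2 \<partial>M) \<le> apriori_const * data_size"
    and "(\<Sum>k<N. h * first_Z k) \<le> 2 * apriori_const * data_size"
    and "k < N \<Longrightarrow> first_Y k \<le> (2 + \<Gamma>) * apriori_const * data_size"
proof -
  define g where "g = 12 * h * (2 * c\<^sup>2 * exp (T * \<kappa>) * (1 + (norm S0)\<^sup>2))"
  have g: "g \<ge> 0"
    using h_pos by (simp add: g_def)
  have \<Gamma>: "\<Gamma> \<ge> 0"
    by (simp add: \<Gamma>_def)
  have \<xi>2: "0 \<le> (\<integral>\<omega>. (\<xi> \<omega>)\<^sup>2 \<partial>M)"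
    by simp
  \<comment> \<open>N forcing terms proportional to h; \<open>h * real N = T\<close> removes N from
    the constant.\<close>
  have total: "(\<Sum>j<N. g) = 24 * T * c\<^sup>2 * exp (T * \<kappa>) * (1 + (norm S0)\<^sup>2)"
    using N_pos by (simp add: g_def h_def)
  have hN: "h * real N = T"
    using N_pos by (simp add: h_def)
  have total_le: "exp (\<Gamma> * h * real N) * ((\<integral>\<omega>. (Y' N \<omega>)\<^sup>2 \<partial>M) + (\<Sum>j<N. g)) \<le> apriori_const * data_size"
  proof -
    define e where "e = 24 * T * c\<^sup>2 * exp (T * \<kappa>)"
    have "e \<ge> 0"
      using T_pos by (simp add: e_def)
    then have "0 \<le> e * (\<integral>\<omega>. (\<xi> \<omega>)\<^sup>2 \<partial>M)" "0 \<le> (norm S0)\<^sup>2"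
      using \<xi>2 by simp_all
    then have "(\<integral>\<omega>. (\<xi> \<omega>)\<^sup>2 \<partial>M) + e * (1 + (norm S0)\<^sup>2) \<le> (1 + e) * data_size"
      by (simp add: data_size_def algebra_simps)
    then show ?thesis
      by (simp add: proj_Y_def total[simplified] apriori_const_def e_def mult.assoc hN)
  qed
  have main: "(\<integral>\<omega>. (Y' k \<omega>)\<^sup>2 \<partial>M) + (\<Sum>j\<in>{k..<N}. h / 2 * first_Z j) \<le> apriori_const * data_size"
    if "k \<le> N" for k
    using backward_gronwall[of "\<Gamma> * h" N "\<lambda>j. h / 2 * first_Z j" "\<lambda>_. g" "\<lambda>j. \<integral>\<omega>. (Y' j \<omega>)\<^sup>2 \<partial>M" k]
      apriori_step(1) first_nonneg(2) h_pos \<Gamma> g that order_trans[OF _ total_le]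
    by (auto simp: g_def)
  have nonneg: "0 \<le> (\<Sum>j\<in>{k..<N}. h / 2 * first_Z j)" for k
    using first_nonneg(2) h_pos by (intro sum_nonneg) auto
  show Y': "(\<integral>\<omega>. (Y' k \<omega>)\<^sup>2 \<partial>M) \<le> apriori_const * data_size" if "k \<le> N" for k
    using main[OF that] nonneg[of k] by linarith
  have "0 \<le> (\<integral>\<omega>. (Y' 0 \<omega>)\<^sup>2 \<partial>M)"
    by simp
  then have "(\<Sum>j<N. h / 2 * first_Z j) \<le> apriori_const * data_size"
    using main[OF le0] unfolding atLeast0LessThan by linarith
  then show "(\<Sum>k<N. h * first_Z k) \<le> 2 * apriori_const * data_size"
    by (simp add: sum_divide_distrib[symmetric])
  show "first_Y k \<le> (2 + \<Gamma>) * apriori_const * data_size" if k: "k < N"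
  proof -
    \<comment> \<open>One forcing term is at most the sum of all, hence covered by the bound on the
      whole recursion. It raises the \<open>1 + \<Gamma>\<close> below to
      \<open>2 + \<Gamma>\<close>.\<close>
    have "g \<le> (\<Sum>j<N. g)"
      using N_pos g mult_right_mono[of 1 "real N" g] by simp
    also have "\<dots> \<le> (\<integral>\<omega>. (Y' N \<omega>)\<^sup>2 \<partial>M) + (\<Sum>j<N. g)"
      by simp
    also have "\<dots> \<le> exp (\<Gamma> * h * real N) * ((\<integral>\<omega>. (Y' N \<omega>)\<^sup>2 \<partial>M) + (\<Sum>j<N. g))"
      using mult_right_mono[of 1 "exp (\<Gamma> * h * real N)" "(\<integral>\<omega>. (Y' N \<omega>)\<^sup>2 \<partial>M) + (\<Sum>j<N. g)"] \<Gamma> h_pos g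
      by simp
    also note total_le
    finally have "g \<le> apriori_const * data_size" .
    moreover have "(1 + \<Gamma> * h) * (\<integral>\<omega>. (Y' (Suc k) \<omega>)\<^sup>2 \<partial>M) \<le> (1 + \<Gamma>) * (apriori_const * data_size)"
      using Y'[of "Suc k"] k \<Gamma> h_pos step_small mult_left_mono[of h 1 \<Gamma>] by (intro mult_mono) auto
    ultimately show ?thesis
      using apriori_step(2)[OF k] unfolding g_def by (simp add: algebra_simps)
  qed
qed

text \<open>The first iterates enter through their weighted sums, so n contractions yield
  \<open>h ^ (2 * n)\<close> with no negative power of h.\<close>

lemma inc_sum:
  "(\<Sum>k<N. h * inc k) \<le> (2 * K\<^sup>2) ^ n * h ^ (2 * n) * ((T * (2 + \<Gamma>) + 2) * apriori_const * data_size)"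
proof -
  define A where "A = apriori_const * data_size"
  have "(\<Sum>k<N. h * first_Y k) \<le> (\<Sum>k<N. h * ((2 + \<Gamma>) * A))"
    using apriori_bound(3) h_pos by (intro sum_mono mult_left_mono) (auto simp: A_def mult.assoc)
  also have "\<dots> = T * (2 + \<Gamma>) * A"
    using N_pos by (simp add: h_def)
  finally have first: "(\<Sum>k<N. h * first_Y k + h * first_Z k) \<le> (T * (2 + \<Gamma>) + 2) * A"
    using apriori_bound(2) by (simp add: sum.distrib A_def algebra_simps)
  have "(\<Sum>k<N. h * inc k) \<le> (\<Sum>k<N. (2 * h\<^sup>2 * K\<^sup>2) ^ n * (h * first_Y k + h * first_Z k))"
    by (intro sum_mono inc_bound) simp
  also have "\<dots> = (2 * h\<^sup>2 * K\<^sup>2) ^ n * (\<Sum>k<N. h * first_Y k + h * first_Z k)"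
    by (simp only: sum_distrib_left)
  also have "\<dots> \<le> (2 * h\<^sup>2 * K\<^sup>2) ^ n * ((T * (2 + \<Gamma>) + 2) * A)"
    using first by (intro mult_left_mono) auto
  also have "(2 * h\<^sup>2 * K\<^sup>2) ^ n = (2 * K\<^sup>2) ^ n * h ^ (2 * n)"
    by (simp add: power_mult_distrib mult_ac flip: power_mult)
  finally show ?thesis
    by (simp only: A_def mult.assoc)
qed

lemma error_bound:
  "(MAX k\<in>{0..N}. \<integral>\<omega>. (Y' k \<omega> - Y k \<omega>)\<^sup>2 \<partial>M) + h * (\<Sum>k<N. \<integral>\<omega>. (norm (Z' k \<omega> - Z k \<omega>))\<^sup>2 \<partial>M)
   \<le> error_const * h ^ (2 * n) * data_size
     + error_const * (\<Sum>k<N. \<integral>\<omega>. (L2_resid M (basis_rv p P k None) (Y k) \<omega>)\<^sup>2 \<partial>M)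
     + error_const * h * (\<Sum>k<N. \<Sum>l\<in>UNIV.
         \<integral>\<omega>. (L2_resid M (basis_rv p P k (Some l)) (\<lambda>\<omega>. vec_nth (Z k \<omega>) l) \<omega>)\<^sup>2 \<partial>M)"
proof -
  define dy where "dy k = (\<integral>\<omega>. (Y' k \<omega> - Y k \<omega>)\<^sup>2 \<partial>M)" for k
  define dz where "dz k = (\<integral>\<omega>. (norm (Z' k \<omega> - Z k \<omega>))\<^sup>2 \<partial>M)" for k
  define r0 where "r0 = (\<Sum>k<N. \<integral>\<omega>. (L2_resid M (basis_rv p P k None) (Y k) \<omega>)\<^sup>2 \<partial>M)"
  define r where "r = (\<Sum>k<N. \<Sum>l\<in>UNIV.
      \<integral>\<omega>. (L2_resid M (basis_rv p P k (Some l)) (\<lambda>\<omega>. vec_nth (Z k \<omega>) l) \<omega>)\<^sup>2 \<partial>M)"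
  define B where "B = (T * (2 + \<Gamma>) + 2) * apriori_const"
  define R where "R = exp (\<Gamma> * T) * (2 * r0 + 2 * h * r + (2 * K\<^sup>2) ^ n * h ^ (2 * n) * (B * data_size))"
  have \<Gamma>: "\<Gamma> \<ge> 0"
    by (simp add: \<Gamma>_def)
  have nonneg: "r0 \<ge> 0" "r \<ge> 0" "B \<ge> 0" "data_size \<ge> 0" "\<And>k. dy k \<ge> 0" "\<And>k. dz k \<ge> 0"
    using \<Gamma> T_pos
    by (auto simp: r0_def r_def B_def apriori_const_def data_size_def dy_def dz_def
        intro!: sum_nonneg mult_nonneg_nonneg add_nonneg_nonneg)
  \<comment> \<open>Both schemes have the terminal value \<xi>, the backward one almost everywhere,
    so the recursion starts from zero error.\<close>
  have dyN: "dy N = 0"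
  proof -
    have "AE \<omega> in M. (Y' N \<omega> - Y N \<omega>)\<^sup>2 = 0"
      using scheme unfolding backward_scheme_def by (auto simp: proj_Y_def)
    then show ?thesis
      unfolding dy_def by (rule integral_eq_zero_AE)
  qed
  have res: "0 \<le> residual k + h * inc k" if "k < N" for k
    using inc_nonneg[OF that] h_pos by (auto simp: residual_def intro!: add_nonneg_nonneg mult_nonneg_nonneg sum_nonneg)
  have sum: "(\<Sum>k<N. residual k + h * inc k) \<le> 2 * r0 + 2 * h * r + (2 * K\<^sup>2) ^ n * h ^ (2 * n) * (B * data_size)"
    using inc_sum by (simp add: sum.distrib residual_def r0_def r_def B_def sum_distrib_left mult.assoc)
  have main: "dy k + (\<Sum>j\<in>{k..<N}. h / 2 * dz j) \<le> R" if "k \<le> N" for k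
  proof -
    have "dy k + (\<Sum>j\<in>{k..<N}. h / 2 * dz j)
        \<le> exp (\<Gamma> * h * real N) * (dy N + (\<Sum>k<N. residual k + h * inc k))"
      using that res nonneg h_pos \<Gamma> error_step dyN
      by (intro backward_gronwall) (auto simp: dy_def dz_def)
    also have "\<dots> = exp (\<Gamma> * T) * (\<Sum>k<N. residual k + h * inc k)"
      using N_pos dyN by (simp add: h_def)
    also have "\<dots> \<le> R"
      unfolding R_def using sum by (intro mult_left_mono) auto
    finally show ?thesis .
  qed
  have sum_nonneg: "0 \<le> (\<Sum>j\<in>{k..<N}. h / 2 * dz j)" for k
    using nonneg h_pos by (intro sum_nonneg) auto
  have "(MAX k\<in>{0..N}. dy k) \<le> R"
    using main sum_nonneg by (intro Max.boundedI) (auto, smt (verit))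
  moreover have "h * (\<Sum>k<N. dz k) \<le> 2 * R"
    using main[of 0] nonneg(5)[of 0] by (simp add: atLeast0LessThan sum_distrib_left sum_divide_distrib[symmetric])
  ultimately have "(MAX k\<in>{0..N}. dy k) + h * (\<Sum>k<N. dz k) \<le> 3 * R"
    by linarith
  also have "3 * R = 6 * exp (\<Gamma> * T) * r0 + 6 * exp (\<Gamma> * T) * (h * r)
      + 3 * exp (\<Gamma> * T) * (2 * K\<^sup>2) ^ n * B * (h ^ (2 * n) * data_size)"
    by (simp add: R_def algebra_simps)
  also have "\<dots> \<le> error_const * r0 + error_const * (h * r) + error_const * (h ^ (2 * n) * data_size)"
    using nonneg h_pos
    by (intro add_mono mult_right_mono) (auto simp: error_const_def B_def)
  finally show ?thesis
    unfolding dy_def dz_def r0_def r_def by (simp only: mult.assoc add_ac)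
qed

end

theorem theorem2:
  fixes T :: real and I :: nat and C\<^sub>f C\<^sub>\<Phi> :: real
    and b :: "real \<Rightarrow> real ^ 'd \<Rightarrow> real ^ 'd"
    and \<sigma> :: "real \<Rightarrow> real ^ 'd \<Rightarrow> real ^ 'q ^ 'd"
    and f :: "real \<Rightarrow> real ^ 'd \<Rightarrow> real \<Rightarrow> real ^ 'q \<Rightarrow> real"
    and \<Phi> :: "(real \<Rightarrow> real ^ 'd) \<Rightarrow> real"
  assumes "T > 0" and "I \<ge> 1"
    and "\<exists>L. L-lipschitz_on ({0..T} \<times> UNIV) (\<lambda>(t, x). b t x)"
    and "\<exists>L. L-lipschitz_on ({0..T} \<times> UNIV) (\<lambda>(t, x). \<sigma> t x)"
    and "\<And>t1 t2 x1 x2 y1 y2 z1 z2. t1 \<in> {0..T} \<Longrightarrow> t2 \<in> {0..T} \<Longrightarrow>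
           \<bar>f t2 x2 y2 z2 - f t1 x1 y1 z1\<bar>
             \<le> C\<^sub>f * (\<bar>t2 - t1\<bar> powr (1/2) + norm (x2 - x1) + \<bar>y2 - y1\<bar> + norm (z2 - z1))"
    and "\<And>s1 s2. continuous_on {0..T} s1 \<Longrightarrow> continuous_on {0..T} s2 \<Longrightarrow>
           \<bar>\<Phi> s1 - \<Phi> s2\<bar> \<le> C\<^sub>\<Phi> * (SUP t\<in>{0..T}. norm (s1 t - s2 t))"
  shows "\<exists>h0>0. \<exists>C. \<forall>(M :: 'a measure) (W :: real \<Rightarrow> 'a \<Rightarrow> real ^ 'q) (S0 :: real ^ 'd)
           (N :: nat) (m :: nat) (P :: nat \<Rightarrow> 'a \<Rightarrow> (real ^ 'd) \<times> (nat \<Rightarrow> real))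
           (\<Phi>N :: (real ^ 'd) \<times> (nat \<Rightarrow> real) \<Rightarrow> real)
           (p :: nat \<Rightarrow> 'q option \<Rightarrow> ((real ^ 'd) \<times> (nat \<Rightarrow> real) \<Rightarrow> real) list)
           (Y :: nat \<Rightarrow> 'a \<Rightarrow> real) (\<alpha> :: nat \<Rightarrow> nat \<Rightarrow> 'q option \<Rightarrow> real list).
         let h = T / real N;
             S = euler T b \<sigma> W S0 N;
             \<xi> = (\<lambda>\<omega>. \<Phi>N (P N \<omega>));
             Z = backward_Z M T W N Y;
             Y' = (\<lambda>k. proj_Y p P N \<xi> k (\<alpha> I k));
             Z' = (\<lambda>k. proj_Z p P k (\<alpha> I k))
         in
           N \<ge> 1 \<and> h \<le> h0 \<and>
           brownian_motion M T W \<and>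
           markov_chain M (state_space m) N P \<and>
           (\<forall>k\<le>N. P k \<in> augmented_filtration M W (grid T N k) \<rightarrow>\<^sub>M state_space m) \<and>
           (\<forall>k\<le>N. AE \<omega> in M. fst (P k \<omega>) = S k \<omega>) \<and>
           \<Phi>N \<in> borel_measurable (state_space m) \<and>
           integrable M (\<lambda>\<omega>. (\<xi> \<omega>)\<^sup>2) \<and>
           admissible_bases M (state_space m) N P p \<and>
           backward_scheme M T f W N S \<xi> Y \<and>
           projected_scheme M T f W N S \<xi> p P I \<alpha> \<longrightarrow>
           (MAX k\<in>{0..N}. \<integral>\<omega>. (Y' k \<omega> - Y k \<omega>)\<^sup>2 \<partial>M)
             + h * (\<Sum>k<N. \<integral>\<omega>. (norm (Z' k \<omega> - Z k \<omega>))\<^sup>2 \<partial>M)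
           \<le> C * h ^ (2 * I - 2) * (1 + (norm S0)\<^sup>2 + (\<integral>\<omega>. (\<xi> \<omega>)\<^sup>2 \<partial>M))
             + C * (\<Sum>k<N. \<integral>\<omega>. (L2_resid M (basis_rv p P k None) (Y k) \<omega>)\<^sup>2 \<partial>M)
             + C * h * (\<Sum>k<N. \<Sum>l\<in>UNIV.
                 \<integral>\<omega>. (L2_resid M (basis_rv p P k (Some l)) (\<lambda>\<omega>. vec_nth (Z k \<omega>) l) \<omega>)\<^sup>2 \<partial>M)"
proof -
  note f_lip = assms(5)
  obtain n where I: "I = Suc n"
    using \<open>I \<ge> 1\<close> by (cases I) auto
  have T0: "T \<ge> 0"
    using \<open>T > 0\<close> by simp
  \<comment> \<open>Two arguments that differ only by 1 in y reduce the right-hand side to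
    \<open>C\<^sub>f\<close>.\<close>
  have Cf: "C\<^sub>f \<ge> 0"
    using f_lip[of 0 0 0 1 0 0 0 0] T0 by simp
  \<comment> \<open>At equal dates the time term is \<open>0 powr (1/2) = 0\<close>.\<close>
  have f_lipschitz: "\<bar>f t x y z - f t x' y' z'\<bar> \<le> C\<^sub>f * (norm (x - x') + \<bar>y - y'\<bar> + norm (z - z'))"
    if "t \<in> {0..T}" for t x x' y y' z z'
    using f_lip[of t t x y z x' y' z'] that by simp
  obtain cb where cb: "cb \<ge> 0" "\<And>t x. t \<in> {0..T} \<Longrightarrow> norm (b t x) \<le> cb * (1 + norm x)"
    using lipschitz_linear_growth[OF assms(3) T0] by blast
  obtain cs where cs: "cs \<ge> 0" "\<And>t x. t \<in> {0..T} \<Longrightarrow> norm (\<sigma> t x) \<le> cs * (1 + norm x)"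
    using lipschitz_linear_growth[OF assms(4) T0] by blast
  define cf where "cf = \<bar>f 0 0 0 0\<bar> + C\<^sub>f * (T powr (1/2) + 1)"
  have cf: "cf \<ge> 0" "\<And>t x. t \<in> {0..T} \<Longrightarrow> \<bar>f t x 0 0\<bar> \<le> cf * (1 + norm x)"
  proof -
    show "cf \<ge> 0"
      using Cf by (simp add: cf_def)
    fix t :: real and x :: "real ^ 'd" assume t: "t \<in> {0..T}"
    have "\<bar>f t x 0 0 - f 0 0 0 0\<bar> \<le> C\<^sub>f * (t powr (1/2) + norm x)"
      using f_lip[of 0 t x 0 0 0 0 0] t T0 by simp
    also have "\<dots> \<le> C\<^sub>f * (T powr (1/2) + norm x)"
      using t Cf by (intro mult_left_mono add_right_mono powr_mono2) auto
    finally have "\<bar>f t x 0 0\<bar> \<le> \<bar>f 0 0 0 0\<bar> + C\<^sub>f * (T powr (1/2) + norm x)"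
      by linarith
    also have "\<dots> \<le> cf * (1 + norm x)"
      using Cf by (simp add: cf_def algebra_simps)
    finally show "\<bar>f t x 0 0\<bar> \<le> cf * (1 + norm x)" .
  qed
  define c where "c = cb + cs + cf"
  have c: "c \<ge> 0"
    using cb cs cf by (simp add: c_def)
  have le_c: "u \<le> c * (1 + norm x)" if "u \<le> c' * (1 + norm x)" "c' \<in> {cb, cs, cf}"
    for u c' and x :: "real ^ 'd"
  proof -
    have "c' * (1 + norm x) \<le> c * (1 + norm x)"
      using that(2) cb(1) cs(1) cf(1) by (intro mult_right_mono) (auto simp: c_def)
    with that(1) show ?thesis
      by linarith
  qed
  \<comment> \<open>Equality in \<open>\<gamma> * h \<le> 1\<close> with \<open>C\<^sub>f\<close>
    for K; the denominator is at least 1, so \<open>h \<le> 1\<close> follows as well.\<close>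
  define h0 where "h0 = 1 / (16 * C\<^sub>f\<^sup>2 + 1)"
  have h0: "h0 > 0" "h0 \<le> 1" "(16 * C\<^sub>f\<^sup>2 + 1) * h0 = 1"
  proof -
    have "16 * C\<^sub>f\<^sup>2 + 1 > 0"
      by (rule add_nonneg_pos) auto
    then show "h0 > 0" "h0 \<le> 1" "(16 * C\<^sub>f\<^sup>2 + 1) * h0 = 1"
      by (simp_all add: h0_def)
  qed
  show ?thesis
    unfolding Let_def
  \<comment> \<open>Outside its locale \<open>error_const\<close> takes only T, n,
    \<open>C\<^sub>f\<close> and c as arguments, so it is fixed before the probability space, N, the
    initial value and the bases are chosen.\<close>
  proof (rule exI[of _ h0], rule conjI[OF h0(1)],
      rule exI[of _ "projection_scheme.error_const T n C\<^sub>f c"], intro allI, rule impI, elim conjE)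
    fix M :: "'a measure" and W :: "real \<Rightarrow> 'a \<Rightarrow> real ^ 'q" and S0 :: "real ^ 'd" and N m
      and P :: "nat \<Rightarrow> 'a \<Rightarrow> (real ^ 'd) \<times> (nat \<Rightarrow> real)" and \<Phi>N p Y \<alpha>
    assume N: "1 \<le> N" and step: "T / real N \<le> h0" and bm: "brownian_motion M T W"
      and P: "\<forall>k\<le>N. P k \<in> augmented_filtration M W (grid T N k) \<rightarrow>\<^sub>M state_space m"
      and \<Phi>N: "\<Phi>N \<in> borel_measurable (state_space m :: ((real ^ 'd) \<times> (nat \<Rightarrow> real)) measure)"
      and sq: "integrable M (\<lambda>\<omega>. (\<Phi>N (P N \<omega>))\<^sup>2)"
      and bases: "admissible_bases M (state_space m) N P p"
      and scheme: "backward_scheme M T f W N (euler T b \<sigma> W S0 N) (\<lambda>\<omega>. \<Phi>N (P N \<omega>)) Y"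
      and proj: "projected_scheme M T f W N (euler T b \<sigma> W S0 N) (\<lambda>\<omega>. \<Phi>N (P N \<omega>)) p P I \<alpha>"
    interpret brownian M T W
      using bm by (rule brownian.intro)
    have "(\<lambda>\<omega>. \<Phi>N (P N \<omega>)) \<in> borel_measurable (augmented_filtration M W (grid T N N))"
      by (rule measurable_compose[OF P[rule_format, OF order_refl] \<Phi>N])
    moreover have "grid T N N \<le> T"
      using N by (simp add: grid_def)
    ultimately have \<xi>: "square_integrable M (\<lambda>\<omega>. \<Phi>N (P N \<omega>))"
      using sq measurable_from_subalg[OF subalgebra_filtration] by (auto simp: square_integrable_def)
    have small: "T / real N \<le> 1" "(16 * C\<^sub>f\<^sup>2 + 1) * (T / real N) \<le> 1"
    proof -
      show "T / real N \<le> 1"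
        using step h0 by linarith
      have "(16 * C\<^sub>f\<^sup>2 + 1) * (T / real N) \<le> (16 * C\<^sub>f\<^sup>2 + 1) * h0"
        using step by (intro mult_left_mono) auto
      then show "(16 * C\<^sub>f\<^sup>2 + 1) * (T / real N) \<le> 1"
        using h0 by simp
    qed
    interpret projection_scheme M T W b \<sigma> f S0 N "state_space m" P "\<lambda>\<omega>. \<Phi>N (P N \<omega>)" p Y \<alpha> n
      "C\<^sub>f" c "T / real N"
      by unfold_locales
        (use \<open>T > 0\<close> N Cf c small f_lipschitz P \<xi> bases scheme proj
          lipschitz_borel_measurable[OF assms(3)] lipschitz_borel_measurable[OF assms(4)]
          le_c[OF cb(2)] le_c[OF cs(2)] le_c[OF cf(2)] in \<open>auto simp: I\<close>)
    show "(MAX k\<in>{0..N}. \<integral>\<omega>. (proj_Y p P N (\<lambda>\<omega>. \<Phi>N (P N \<omega>)) k (\<alpha> I k) \<omega> - Y k \<omega>)\<^sup>2 \<partial>M)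
        + T / real N * (\<Sum>k<N. \<integral>\<omega>. (norm (proj_Z p P k (\<alpha> I k) \<omega> - backward_Z M T W N Y k \<omega>))\<^sup>2 \<partial>M)
      \<le> error_const * (T / real N) ^ (2 * I - 2) * (1 + (norm S0)\<^sup>2 + (\<integral>\<omega>. (\<Phi>N (P N \<omega>))\<^sup>2 \<partial>M))
        + error_const * (\<Sum>k<N. \<integral>\<omega>. (L2_resid M (basis_rv p P k None) (Y k) \<omega>)\<^sup>2 \<partial>M)
        + error_const * (T / real N) * (\<Sum>k<N. \<Sum>l\<in>UNIV.
            \<integral>\<omega>. (L2_resid M (basis_rv p P k (Some l)) (\<lambda>\<omega>. vec_nth (backward_Z M T W N Y k \<omega>) l) \<omega>)\<^sup>2 \<partial>M)"
    proof -
      have exponent: "2 * I - 2 = 2 * n"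
        by (simp add: I)
      show ?thesis
        using error_bound unfolding exponent unfolding I data_size_def .
    qed
  qed
qed

end
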